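(* Let $\Phi=(\varphi_e)_{e\in I}\in\mathrm{CIFS}(X)$ and let $\psi:I^{\mathbb N}\to\mathbb R$ be Hölder continuous. Let $t$ be the free energy function of $(\Phi,\psi)$, let $\alpha_-,\alpha_+$ be defined from $t$ and let $f(\alpha)=\dim_H(\mathcal F_\alpha)$, all as in the context. Then for every $\alpha\in\mathbb R$ we have $f(\alpha)\le\max\{-t^*(-\alpha),0\}$, and for every $\alpha\in(\alpha_-,\alpha_+)$ we have $f(\alpha)=-t^*(-\alpha)$.
   Context: **Conformal iterated function systems.** Let $X\subset\mathbb R^D$, $D\ge1$, be a fixed compact connected set with $X=\overline{\mathrm{Int}(X)}$, and let $\mathbb N=\{1,2,\dots\}$. $\mathrm{CIFS}(X)$ is the set of all families $\Phi=(\varphi_e:X\to X)_{e\in I}$, with $I\subset\mathbb N$ and $\mathrm{card}(I)\ge2$ ($I$ finite or infinite), of injective contractions with Lipschitz constants globally bounded away from $1$ (bounded above by a common constant $<1$) such that: (b) (open set condition) $\varphi_a(\mathrm{Int}X)\cap\varphi_b(\mathrm{Int}X)=\emptyset$ for all $a\ne b$ in $I$; (c) there is an open connected set $W\supset X$ such that every $\varphi_e$ extends to a $C^1$ conformal diffeomorphism of $W$ into $W$; (d) (cone property) there are $\gamma,l>0$, $\gamma<\pi/2$, such that for every $x\in X$ there is an open cone $\mathrm{Con}(x,\gamma,l)\subset\mathrm{Int}(X)$ with vertex $x$, central angle of measure $\gamma$ and altitude $l$; (e) there are constants $L_\Phi\ge1$, $\alpha_\Phi>0$ with $\big||\varphi_e'(y)|-|\varphi_e'(x)|\big|\le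 \frac{L_\Phi}{\Vert(\varphi_e')^{-1}\Vert_X}\Vert y-x\Vert^{\alpha_\Phi}$ for all $e\in I$, $x,y\in X$. Here $|\varphi'(x)|$ is the operator norm of the derivative and $\Vert\cdot\Vert_X$ is the supremum norm over $X$. **Symbolic notation.** For $\omega\in I^{\mathbb N}$ let $\omega_{|k}=\omega_1\cdots\omega_k$; for a finite word $\omega=\omega_1\cdots\omega_k$ let $\varphi_\omega=\varphi_{\omega_1}\circ\cdots\circ\varphi_{\omega_k}$ and $[\omega]=\{\tau\in\mathbb N^{\mathbb N}:\tau_{|k}=\omega\}$. The coding map $\pi_\Phi:I^{\mathbb N}\to X$ is defined by $\{\pi_\Phi(\omega)\}=\bigcap_k\varphi_{\omega_{|k}}(X)$. Let $\sigma$ be the left shift and $S_kg=\sum_{n=0}^{k-1}g\circ\sigma^n$. For $J\subset\mathbb N$, a function $g:J^{\mathbb N}\to\mathbb R$ is Hölder continuous if for some $\theta>0$, $\sup_{n\ge1}\sup\{|g(\omega)-g(\tau)|e^{\theta n}:\omega,\tau\in J^{\mathbb N},\ \omega_{|n}=\tau_{|n}\}<\infty$ (so $g$ may be unbounded). **Pressure and free energy.** For continuous $g:J^{\mathbb N}\to\mathbb R$ let $Z_n(g)=\sum_{\omega\in J^n}\exp\sup_{\tau\in[\omega]\cap J^{\mathbb N}}S_ng(\tau)$ and $\mathcal P(g)=\lim_n\frac1n\log Z_n(g)\in\mathbb R\cup\{+\infty\}$. The geometric potential of $\Phi$ is $\zeta(\omega)=\log|\varphi_{\omega_1}'(\pi_\Phi(\sigma\omega))|$,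 $\omega\in I^{\mathbb N}$. The free energy function of $(\Phi,\psi)$ is $t:\mathbb R\to\mathbb R\cup\{\infty\}$, $t(\beta)=\inf\{s\in\mathbb R:\mathcal P(s\zeta+\beta\psi)\le0\}$ (with $\inf\emptyset=+\infty$). Its Legendre conjugate is $t^*(a)=\sup_{\beta\in\mathbb R}\{\beta a-t(\beta)\}$, so $-t^*(-\alpha)=\inf_\beta\{t(\beta)+\beta\alpha\}$. **Spectrum.** $\mathrm{dom}(t)=\{x\in\mathbb R:t(x)<+\infty\}$; $t^+$ and $t^-$ are the right and left derivatives of the convex function $t$; $\alpha_-=\inf\{-t^-(x):x\in\mathrm{Int}(\mathrm{dom}(t))\}$ and $\alpha_+=\sup\{-t^+(x):x\in\mathrm{Int}(\mathrm{dom}(t))\}$. For $\alpha\in\mathbb R$ let $\mathcal F_\alpha=\pi_\Phi\{\omega\in I^{\mathbb N}:\lim_{k\to\infty}S_k\psi(\omega)/\log\Vert\varphi_{\omega_{|k}}'\Vert_X=\alpha\}$ and $f(\alpha)=\dim_H(\mathcal F_\alpha)$ (Hausdorff dimension). *)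

theory Defs
  imports "HOL-Analysis.Analysis" "HOL-Library.Stream"
begin

section \<open>Hausdorff dimension\<close>

text \<open>The case distinction implements the conventions \<open>0\<^sup>0 = 1\<close> for a nonempty set and
  value \<open>0\<close> for the empty set.\<close>

definition diam_powr :: "real \<Rightarrow> 'a::metric_space set \<Rightarrow> real" where
  "diam_powr s U = (if U = {} then 0 else if s = 0 then 1 else diameter U powr s)"

definition hausdorff_content :: "real \<Rightarrow> real \<Rightarrow> 'a::metric_space set \<Rightarrow> ennreal" where
  "hausdorff_content \<delta> s A =
     (INF U \<in> {U :: nat \<Rightarrow> 'a set. A \<subseteq> (\<Union>i. U i) \<and> (\<forall>i. bounded (U i) \<and> diameter (U i) \<le> \<delta>)}.
        \<Sum>i. ennreal (diam_powr s (U i)))"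

definition hausdorff_measure :: "real \<Rightarrow> 'a::metric_space set \<Rightarrow> ennreal" where
  "hausdorff_measure s A = (SUP \<delta> \<in> {0<..}. hausdorff_content \<delta> s A)"

definition hausdorff_dim :: "'a::metric_space set \<Rightarrow> ereal" where
  "hausdorff_dim A = (INF s \<in> {s. 0 \<le> s \<and> hausdorff_measure s A = 0}. ereal s)"

section \<open>Conformal iterated function systems\<close>

definition C1_on :: "'a::euclidean_space set \<Rightarrow> ('a \<Rightarrow> 'a) \<Rightarrow> bool" where
  "C1_on S g \<longleftrightarrow>
     (\<exists>g' :: 'a \<Rightarrow> 'a \<Rightarrow>\<^sub>L 'a. continuous_on S g' \<and> (\<forall>x\<in>S. (g has_derivative blinfun_apply (g' x)) (at x)))"

definition C1_diffeo_into :: "'a::euclidean_space set \<Rightarrow> ('a \<Rightarrow> 'a) \<Rightarrow> bool" where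
  "C1_diffeo_into W g \<longleftrightarrow>
     inj_on g W \<and> g ` W \<subseteq> W \<and> open (g ` W) \<and> C1_on W g \<and> C1_on (g ` W) (inv_into W g)"

text \<open>Every derivative is a similarity; it may reverse orientation.\<close>

definition conformal_on :: "'a::euclidean_space set \<Rightarrow> ('a \<Rightarrow> 'a) \<Rightarrow> bool" where
  "conformal_on W g \<longleftrightarrow>
     (\<forall>x\<in>W. \<exists>c>0. \<exists>T. orthogonal_transformation T \<and> (g has_derivative (\<lambda>v. c *\<^sub>R T v)) (at x))"

text \<open>Open truncated cone with vertex \<open>x\<close>, axis direction \<open>u\<close> (a unit vector), full apex angle \<open>\<gamma>\<close>
  and altitude \<open>l\<close> measured along the axis.\<close>

definition open_cone :: "'a::euclidean_space \<Rightarrow> 'a \<Rightarrow> real \<Rightarrow> real \<Rightarrow> 'a set" where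
  "open_cone x u \<gamma> l = {y. cos (\<gamma> / 2) * norm (y - x) < (y - x) \<bullet> u \<and> (y - x) \<bullet> u < l}"

text \<open>The maps of the system are only given on \<open>X\<close>, so their derivative at \<open>x \<in> X\<close> is taken within
  \<open>X\<close>.  Under the cone property below, the derivative within \<open>X\<close> is unique at each point of
  \<open>X\<close>; it is therefore the derivative of any differentiable extension to a neighbourhood of \<open>X\<close>.\<close>

definition deriv_in :: "'a::euclidean_space set \<Rightarrow> ('a \<Rightarrow> 'a) \<Rightarrow> 'a \<Rightarrow> 'a \<Rightarrow> 'a" where
  "deriv_in X g x = frechet_derivative g (at x within X)"

definition deriv_norm :: "'a::euclidean_space set \<Rightarrow> ('a \<Rightarrow> 'a) \<Rightarrow> 'a \<Rightarrow> real" where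
  "deriv_norm X g x = onorm (deriv_in X g x)"

definition sup_deriv_norm :: "'a::euclidean_space set \<Rightarrow> ('a \<Rightarrow> 'a) \<Rightarrow> real" where
  "sup_deriv_norm X g = (SUP x\<in>X. deriv_norm X g x)"

definition sup_inverse_deriv_norm :: "'a::euclidean_space set \<Rightarrow> ('a \<Rightarrow> 'a) \<Rightarrow> real" where
  "sup_inverse_deriv_norm X g = (SUP x\<in>X. onorm (inv (deriv_in X g x)))"

text \<open>\<open>card I = 0\<close> for infinite \<open>I\<close>, hence the explicit case \<open>infinite I\<close>.\<close>

definition CIFS :: "'a::euclidean_space set \<Rightarrow> nat set \<Rightarrow> (nat \<Rightarrow> 'a \<Rightarrow> 'a) \<Rightarrow> bool" where
  "CIFS X I \<phi> \<longleftrightarrow>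
     I \<subseteq> {1..} \<and> (infinite I \<or> 2 \<le> card I) \<and>
     (\<forall>e\<in>I. \<phi> e ` X \<subseteq> X \<and> inj_on (\<phi> e) X) \<and>
     (\<exists>c<1. \<forall>e\<in>I. c-lipschitz_on X (\<phi> e)) \<and>
     (\<forall>a\<in>I. \<forall>b\<in>I. a \<noteq> b \<longrightarrow> \<phi> a ` interior X \<inter> \<phi> b ` interior X = {}) \<and>
     (\<exists>W. open W \<and> connected W \<and> X \<subseteq> W \<and>
        (\<forall>e\<in>I. \<exists>g. (\<forall>x\<in>X. g x = \<phi> e x) \<and> C1_diffeo_into W g \<and> conformal_on W g)) \<and>
     (\<exists>\<gamma>>0. \<exists>l>0. \<gamma> < pi / 2 \<and>
        (\<forall>x\<in>X. \<exists>u. norm u = 1 \<and> open_cone x u \<gamma> l \<subseteq> interior X)) \<and>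
     (\<exists>L\<ge>1. \<exists>\<alpha>>0. \<forall>e\<in>I. \<forall>x\<in>X. \<forall>y\<in>X.
        \<bar>deriv_norm X (\<phi> e) y - deriv_norm X (\<phi> e) x\<bar>
          \<le> L / sup_inverse_deriv_norm X (\<phi> e) * norm (y - x) powr \<alpha>)"

section \<open>Symbolic dynamics\<close>

text \<open>\<open>I\<^sup>\<nat>\<close> is \<^term>\<open>streams I\<close>, the restriction of \<open>\<omega>\<close> to its first \<open>k\<close> letters is
  \<^term>\<open>stake k \<omega>\<close>, the shift is \<^term>\<open>stl\<close> and its \<open>n\<close>-th iterate \<^term>\<open>sdrop n\<close>; the map \<open>\<phi>\<^sub>\<omega>\<close> of
  a finite word \<open>\<omega>\<close> is \<^term>\<open>foldr \<phi> \<omega>\<close>.\<close>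

definition words :: "nat set \<Rightarrow> nat \<Rightarrow> nat list set" where
  "words J n = {w \<in> lists J. length w = n}"

definition cylinder :: "nat list \<Rightarrow> nat stream set" where
  "cylinder w = {\<tau>. stake (length w) \<tau> = w}"

definition birkhoff_sum :: "nat \<Rightarrow> (nat stream \<Rightarrow> real) \<Rightarrow> nat stream \<Rightarrow> real" where
  "birkhoff_sum k g \<omega> = (\<Sum>n<k. g (sdrop n \<omega>))"

definition holder_continuous_on_shift :: "nat set \<Rightarrow> (nat stream \<Rightarrow> real) \<Rightarrow> bool" where
  "holder_continuous_on_shift J g \<longleftrightarrow>
     (\<exists>\<theta>>0. bdd_above {\<bar>g \<omega> - g \<tau>\<bar> * exp (\<theta> * real n) | \<omega> \<tau> n.
        1 \<le> n \<and> \<omega> \<in> streams J \<and> \<tau> \<in> streams J \<and> stake n \<omega> = stake n \<tau>})"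

definition coding_map :: "'a::euclidean_space set \<Rightarrow> (nat \<Rightarrow> 'a \<Rightarrow> 'a) \<Rightarrow> nat stream \<Rightarrow> 'a" where
  "coding_map X \<phi> \<omega> = (THE x. {x} = (\<Inter>k. foldr \<phi> (stake k \<omega>) ` X))"

section \<open>Pressure and free energy\<close>

fun exp_ereal :: "ereal \<Rightarrow> ennreal" where
  "exp_ereal (ereal r) = ennreal (exp r)"
| "exp_ereal PInfty = \<infinity>"
| "exp_ereal MInfty = 0"

definition ln_ennreal :: "ennreal \<Rightarrow> ereal" where
  "ln_ennreal x = (if x = 0 then -\<infinity> else if x = \<infinity> then \<infinity> else ereal (ln (enn2real x)))"

definition partition_sum :: "nat set \<Rightarrow> (nat stream \<Rightarrow> real) \<Rightarrow> nat \<Rightarrow> ennreal" where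
  "partition_sum J g n =
     (\<Sum>\<^sub>\<infinity>w\<in>words J n. exp_ereal (SUP \<tau>\<in>cylinder w \<inter> streams J. ereal (birkhoff_sum n g \<tau>)))"

definition pressure :: "nat set \<Rightarrow> (nat stream \<Rightarrow> real) \<Rightarrow> ereal" where
  "pressure J g = lim (\<lambda>n. ereal (1 / real n) * ln_ennreal (partition_sum J g n))"

definition geometric_potential ::
  "'a::euclidean_space set \<Rightarrow> (nat \<Rightarrow> 'a \<Rightarrow> 'a) \<Rightarrow> nat stream \<Rightarrow> real" where
  "geometric_potential X \<phi> \<omega> = ln (deriv_norm X (\<phi> (shd \<omega>)) (coding_map X \<phi> (stl \<omega>)))"

definition free_energy ::
  "'a::euclidean_space set \<Rightarrow> nat set \<Rightarrow> (nat \<Rightarrow> 'a \<Rightarrow> 'a) \<Rightarrow> (nat stream \<Rightarrow> real) \<Rightarrow> real \<Rightarrow> ereal" where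
  "free_energy X I \<phi> \<psi> \<beta> =
     (INF s \<in> {s::real. pressure I (\<lambda>\<omega>. s * geometric_potential X \<phi> \<omega> + \<beta> * \<psi> \<omega>) \<le> 0}. ereal s)"

definition legendre_conjugate :: "(real \<Rightarrow> ereal) \<Rightarrow> real \<Rightarrow> ereal" where
  "legendre_conjugate t a = (SUP \<beta>. ereal (\<beta> * a) - t \<beta>)"

section \<open>Multifractal spectrum\<close>

definition dom_finite :: "(real \<Rightarrow> ereal) \<Rightarrow> real set" where
  "dom_finite t = {x. t x < \<infinity>}"

text \<open>Only used at interior points of \<^term>\<open>dom_finite t\<close> for a convex \<open>t\<close> that never takes the value
  \<open>-\<infinity>\<close>, where \<open>t\<close> is real-valued in a neighbourhood of \<open>x\<close>.\<close>

definition left_deriv :: "(real \<Rightarrow> ereal) \<Rightarrow> real \<Rightarrow> real" where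
  "left_deriv t x = (THE D. ((\<lambda>y. real_of_ereal (t y)) has_real_derivative D) (at_left x))"

definition right_deriv :: "(real \<Rightarrow> ereal) \<Rightarrow> real \<Rightarrow> real" where
  "right_deriv t x = (THE D. ((\<lambda>y. real_of_ereal (t y)) has_real_derivative D) (at_right x))"

definition alpha_minus :: "(real \<Rightarrow> ereal) \<Rightarrow> ereal" where
  "alpha_minus t = (INF x \<in> interior (dom_finite t). ereal (- left_deriv t x))"

definition alpha_plus :: "(real \<Rightarrow> ereal) \<Rightarrow> ereal" where
  "alpha_plus t = (SUP x \<in> interior (dom_finite t). ereal (- right_deriv t x))"

definition level_set ::
  "'a::euclidean_space set \<Rightarrow> nat set \<Rightarrow> (nat \<Rightarrow> 'a \<Rightarrow> 'a) \<Rightarrow> (nat stream \<Rightarrow> real) \<Rightarrow> real \<Rightarrow> 'a set" where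
  "level_set X I \<phi> \<psi> \<alpha> = coding_map X \<phi> ` {\<omega> \<in> streams I.
     (\<lambda>k. birkhoff_sum k \<psi> \<omega> / ln (sup_deriv_norm X (foldr \<phi> (stake k \<omega>)))) \<longlonglongrightarrow> \<alpha>}"

definition spectrum ::
  "'a::euclidean_space set \<Rightarrow> nat set \<Rightarrow> (nat \<Rightarrow> 'a \<Rightarrow> 'a) \<Rightarrow> (nat stream \<Rightarrow> real) \<Rightarrow> real \<Rightarrow> ereal" where
  "spectrum X I \<phi> \<psi> \<alpha> = hausdorff_dim (level_set X I \<phi> \<psi> \<alpha>)"

end

theory Submission
  imports Defs "HOL-Library.Sublist"
begin

text \<open>
  The proof is elementary: it reads everything off from two functions of a finite word \<open>w\<close>, namely
  \<open>lam w\<close>, the logarithm of the supremum of \<open>\<bar>\<phi>\<^sub>w'\<bar>\<close> over \<open>X\<close>, and \<open>B w\<close>, the Birkhoff sum of \<open>\<psi>\<close> along a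
  sequence that begins with \<open>w\<close>.  Bounded distortion and Hoelder continuity make both additive under
  concatenation up to a bounded error.  Hence the pressure of \<open>s \<zeta> + \<beta> \<psi>\<close> is the exponential growth rate
  of \<open>z s \<beta> n\<close>, the sum of \<open>exp (s * lam w + \<beta> * B w)\<close> over the words of length \<open>n\<close>, and \<open>t \<beta>\<close> is the
  infimum of all \<open>s\<close> for which this growth rate is at most \<open>0\<close> (\<open>subcritical s \<beta>\<close>, lemma
  \<open>pressure_le_0_iff\<close>).

  Upper bound (\<open>level_set_null\<close>).  Let \<open>subcritical s0 \<beta>\<close>, \<open>s > s0 + \<alpha> * \<beta>\<close> and \<open>s > 0\<close>.  Along a sequence
  coding a point of the level set, \<open>B\<close> is eventually close to \<open>\<alpha> * lam\<close>, so every long prefix \<open>w\<close> satisfies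
  \<open>s * lam w \<le> (s0 + d) * lam w + \<beta> * B w\<close> up to a constant, for some \<open>d > 0\<close>.  The exponentials of the
  right-hand sides, summed over all long words, are the tail of a convergent geometric series, because
  \<open>lam\<close> decreases linearly with the length.  The images \<open>\<phi>\<^sub>w(X)\<close> of these prefixes, each cut into a fixed
  number of pieces of diameter at most a constant times \<open>exp (lam w)\<close>, are therefore efficient covers.

  Lower bound (\<open>level_set_not_null\<close>).  Let \<open>disc \<alpha> w = B w - \<alpha> * lam w\<close>, and let \<open>0 < s < t \<beta> + \<alpha> * \<beta>\<close>
  for all \<open>\<beta>\<close>.  Then, for every \<open>\<beta>\<close>, the sums of the weights \<open>exp (s * lam w + \<beta> * disc \<alpha> w)\<close> over words of equal length are unbounded.
  If \<open>\<alpha>\<close> lies strictly between \<open>\<alpha>\<^sub>-\<close> and \<open>\<alpha>\<^sub>+\<close>, there are moreover words of arbitrarily large positive and of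
  arbitrarily large negative discrepancy.  For either sign consider the set of those \<open>\<beta>\<close> for which
  finitely many words of equal length, all with large discrepancy of that sign, have a weight sum above
  the error of concatenation.  Both sets are open and nonempty, and they cover the line: in a huge sum the
  words of one sign carry at least half of the weight, and appending to each a single fixed word makes their
  discrepancy large.  The line is connected, so one \<open>\<beta>\<close> serves both signs (\<open>common_tilt\<close>).
  Now build a tree of words, always appending a word of the family whose sign opposes the current
  discrepancy.  The discrepancy stays bounded, so every infinite branch codes a point of the level set,
  and for the same reason the weight of a node \<open>v\<close> is at most a constant times \<open>exp (s * lam v)\<close>: the
  tilt has disappeared.  As the weight of a node is at most the total weight of its children, it acts as
  a mass distribution.  By the open set condition a set of diameter \<open>r\<close> meets only boundedly many
  images of size about \<open>r\<close> (\<open>card_antichain_hitting_le\<close>).  A cover with a small sum would thus block only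
  nodes of small total weight, and a branch that avoids all of them exists (\<open>tree_path_avoiding\<close>); it
  codes an uncovered point.

  What remains is convex analysis: \<open>t\<close> is convex and never \<open>-\<infinity>\<close>, so its one-sided derivatives exist, and
  \<open>\<alpha>\<^sub>- < \<alpha> < \<alpha>\<^sub>+\<close> says that \<open>t \<beta> + \<alpha> * \<beta>\<close> strictly increases somewhere and strictly decreases somewhere.
  Comparing the sums at the two parameters yields the words of large discrepancy.  The same words
  show that \<open>t \<beta> + \<alpha> * \<beta>\<close> is nonnegative, which removes the maximum with \<open>0\<close> from the upper bound.
\<close>

section \<open>Weighted sums over words\<close>

text \<open>The averages at \<open>m\<close> and at \<open>n\<close> are within \<open>C / m\<close> and \<open>C / n\<close> of the average at \<open>m * n\<close>, so they form a
  Cauchy sequence.\<close>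

lemma quasi_additive_average_converges:
  fixes a :: "nat \<Rightarrow> real"
  assumes qa: "\<And>m n. 1 \<le> m \<Longrightarrow> 1 \<le> n \<Longrightarrow> \<bar>a (m + n) - a m - a n\<bar> \<le> C"
  shows "convergent (\<lambda>n. a n / real n)"
proof -
  have C0: "C \<ge> 0" using qa[of 1 1] by linarith
  have mult: "\<bar>a (k * n) - real k * a n\<bar> \<le> real k * C" if "1 \<le> k" "1 \<le> n" for k n
    using that(1)
  proof (induction k rule: dec_induct)
    case base then show ?case using C0 by simp
  next
    case (step k)
    have "\<bar>a (k * n + n) - a (k * n) - a n\<bar> \<le> C" by (rule qa) (use step that in auto)
    then have "\<bar>a (Suc k * n) - real (Suc k) * a n\<bar> \<le> C + \<bar>a (k * n) - real k * a n\<bar>"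
      by (simp add: algebra_simps)
    then show ?case using step.IH by (simp add: algebra_simps)
  qed
  have near: "\<bar>a (k * n) / real (k * n) - a n / real n\<bar> \<le> C / real n" if "1 \<le> k" "1 \<le> n" for k n
  proof -
    have "a (k * n) / real (k * n) - a n / real n = (a (k * n) - real k * a n) / real (k * n)"
      using that by (simp add: field_simps)
    then have "\<bar>a (k * n) / real (k * n) - a n / real n\<bar> = \<bar>a (k * n) - real k * a n\<bar> / real (k * n)"
      using that by simp
    also have "\<dots> \<le> (real k * C) / real (k * n)"
      by (intro divide_right_mono mult that) simp
    also have "\<dots> = C / real n" using that by simp
    finally show ?thesis .
  qed
  have close: "\<bar>a m / real m - a n / real n\<bar> \<le> C / real m + C / real n" if "1 \<le> m" "1 \<le> n" for m n
    using near[of n m] near[of m n] that by (simp add: mult.commute)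
  have "Cauchy (\<lambda>n. a n / real n)"
  proof (rule metric_CauchyI)
    fix e :: real assume e: "0 < e"
    obtain N where N: "real N > 2 * C / e" using reals_Archimedean2 by blast
    have "dist (a m / real m) (a n / real n) < e" if "Suc N \<le> m" "Suc N \<le> n" for m n
    proof -
      have half: "C / real k < e / 2" if "Suc N \<le> k" for k
      proof -
        have "2 * C / e < real k" using N that by linarith
        then show ?thesis using e that by (simp add: field_simps)
      qed
      have "C / real m < e / 2" "C / real n < e / 2" using half that by blast+
      then show ?thesis using close[of m n] that unfolding dist_real_def by linarith
    qed
    then show "\<exists>M. \<forall>m\<ge>M. \<forall>n\<ge>M. dist (a m / real m) (a n / real n) < e" by blast
  qed
  then show ?thesis by (rule Cauchy_convergent)
qed

text \<open>Sums of nonnegative terms over words are handled as integrals for the counting measure where Fubini's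
  theorem is needed, and as suprema of finite sums elsewhere; this lemma translates.\<close>

lemma countable_nn_integral_eq_SUP_sum:
  fixes f :: "'a::countable \<Rightarrow> ennreal"
  shows "(\<integral>\<^sup>+x. f x \<partial>count_space A) = (SUP F\<in>{F. finite F \<and> F \<subseteq> A}. sum f F)"
proof (rule antisym)
  have fin: "(\<integral>\<^sup>+x. f x * indicator F x \<partial>count_space A) = sum f F" if "finite F" "F \<subseteq> A" for F
  proof -
    have "(\<integral>\<^sup>+x. f x * indicator F x \<partial>count_space A) = (\<integral>\<^sup>+x. f x \<partial>count_space F)"
      using that
      by (simp add: nn_integral_count_space_indicator mult.assoc inf.absorb1 flip: indicator_inter_arith)
    then show ?thesis using that by (simp add: nn_integral_count_space_finite)
  qed
  define F where "F k = {x\<in>A. to_nat x < k}" for k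
  have finF: "finite (F k)" for k
    unfolding F_def by (rule finite_imageD[of to_nat]) (auto intro: finite_subset[of _ "{..<k}"] inj_onI)
  have subF: "F k \<subseteq> A" for k by (auto simp: F_def)
  have "(\<integral>\<^sup>+x. f x \<partial>count_space A) = (\<integral>\<^sup>+x. (SUP k. f x * indicator (F k) x) \<partial>count_space A)"
  proof (rule nn_integral_cong)
    fix x assume x: "x \<in> space (count_space A)"
    have "f x * indicator (F (Suc (to_nat x))) x \<le> (SUP k. f x * indicator (F k) x)"
      by (rule SUP_upper) simp
    moreover have "(SUP k. f x * indicator (F k) x) \<le> f x"
      by (rule SUP_least) (simp add: indicator_def)
    ultimately show "f x = (SUP k. f x * indicator (F k) x)" using x by (simp add: F_def antisym)
  qed
  also have "\<dots> = (SUP k. \<integral>\<^sup>+x. f x * indicator (F k) x \<partial>count_space A)"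
    by (rule nn_integral_monotone_convergence_SUP)
       (auto intro!: incseq_SucI le_funI mult_left_mono simp: F_def indicator_def)
  also have "\<dots> = (SUP k. sum f (F k))" by (simp add: fin finF subF)
  also have "\<dots> \<le> (SUP F\<in>{F. finite F \<and> F \<subseteq> A}. sum f F)"
    by (rule SUP_mono) (use finF subF in blast)
  finally show "(\<integral>\<^sup>+x. f x \<partial>count_space A) \<le> (SUP F\<in>{F. finite F \<and> F \<subseteq> A}. sum f F)" .
  show "(SUP F\<in>{F. finite F \<and> F \<subseteq> A}. sum f F) \<le> (\<integral>\<^sup>+x. f x \<partial>count_space A)"
  proof (rule SUP_least)
    fix F assume "F \<in> {F. finite F \<and> F \<subseteq> A}"
    then have "sum f F = (\<integral>\<^sup>+x. f x * indicator F x \<partial>count_space A)" using fin by simp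
    also have "\<dots> \<le> (\<integral>\<^sup>+x. f x \<partial>count_space A)"
      by (rule nn_integral_mono) (simp add: indicator_def)
    finally show "sum f F \<le> (\<integral>\<^sup>+x. f x \<partial>count_space A)" .
  qed
qed

lemma infsum_ennreal_eq_nn_integral:
  fixes f :: "'a::countable \<Rightarrow> ennreal"
  shows "infsum f A = (\<integral>\<^sup>+x. f x \<partial>count_space A)"
  unfolding countable_nn_integral_eq_SUP_sum by (rule nonneg_infsum_complete) simp

lemma words_append_bij:
  "bij_betw (\<lambda>(u, v). u @ v) (words I m \<times> words I n) (words I (m + n))"
  unfolding bij_betw_def
proof
  show "inj_on (\<lambda>(u, v). u @ v) (words I m \<times> words I n)"
    by (auto simp: inj_on_def words_def)
  show "(\<lambda>(u, v). u @ v) ` (words I m \<times> words I n) = words I (m + n)"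
  proof
    show "words I (m + n) \<subseteq> (\<lambda>(u, v). u @ v) ` (words I m \<times> words I n)"
    proof
      fix w assume "w \<in> words I (m + n)"
      then have "(take m w, drop m w) \<in> words I m \<times> words I n" "w = take m w @ drop m w"
        by (auto simp: words_def dest: in_set_takeD in_set_dropD)
      then show "w \<in> (\<lambda>(u, v). u @ v) ` (words I m \<times> words I n)"
        by (metis (no_types, lifting) case_prod_conv image_eqI)
    qed
  qed (auto simp: words_def)
qed

text \<open>The system and the potential as the combinatorial half of the argument sees them are two functions of words
  that are additive up to \<open>C\<close>, one of which decreases at least linearly in the length.\<close>

locale word_potentials =
  fixes I :: "nat set" and lam B :: "nat list \<Rightarrow> real" and C \<kappa> :: real
  assumes I_nonempty: "I \<noteq> {}"
    and lam_append: "u \<in> lists I \<Longrightarrow> v \<in> lists I \<Longrightarrow> \<bar>lam (u @ v) - lam u - lam v\<bar> \<le> C"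
    and B_append: "u \<in> lists I \<Longrightarrow> v \<in> lists I \<Longrightarrow> \<bar>B (u @ v) - B u - B v\<bar> \<le> C"
    and lam_le: "w \<in> lists I \<Longrightarrow> lam w \<le> - \<kappa> * real (length w)"
    and \<kappa>_pos: "\<kappa> > 0"
    and lam_Nil: "lam [] = 0" and B_Nil: "B [] = 0"
begin

definition wt :: "real \<Rightarrow> real \<Rightarrow> nat list \<Rightarrow> real" where
  "wt s \<beta> w = exp (s * lam w + \<beta> * B w)"

text \<open>The partition function, with each supremum over a cylinder replaced by a value on the word.\<close>

definition z :: "real \<Rightarrow> real \<Rightarrow> nat \<Rightarrow> ennreal" where
  "z s \<beta> n = (\<integral>\<^sup>+w. ennreal (wt s \<beta> w) \<partial>count_space (words I n))"

text \<open>This says that the growth rate of \<open>z s \<beta> n\<close> is at most \<open>0\<close>, without presupposing that it exists.\<close>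

definition subcritical :: "real \<Rightarrow> real \<Rightarrow> bool" where
  "subcritical s \<beta> \<longleftrightarrow> (\<forall>\<epsilon>>0. \<forall>\<^sub>F n in sequentially. z s \<beta> n \<le> ennreal (exp (\<epsilon> * real n)))"

lemma C_nonneg: "C \<ge> 0" using lam_append[of "[]" "[]"] by simp

lemma wt_pos: "wt s \<beta> w > 0" by (simp add: wt_def)

lemma wt_append:
  assumes "u \<in> lists I" "v \<in> lists I"
  shows "wt s \<beta> (u @ v) \<le> exp ((\<bar>s\<bar> + \<bar>\<beta>\<bar>) * C) * (wt s \<beta> u * wt s \<beta> v)"
    and "wt s \<beta> u * wt s \<beta> v \<le> exp ((\<bar>s\<bar> + \<bar>\<beta>\<bar>) * C) * wt s \<beta> (u @ v)"
proof -
  have "\<bar>s * (lam (u @ v) - lam u - lam v)\<bar> \<le> \<bar>s\<bar> * C" "\<bar>\<beta> * (B (u @ v) - B u - B v)\<bar> \<le> \<bar>\<beta>\<bar> * C"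
    unfolding abs_mult by (intro mult_left_mono lam_append B_append assms; simp)+
  then have *: "\<bar>(s * lam (u @ v) + \<beta> * B (u @ v)) - ((s * lam u + \<beta> * B u) + (s * lam v + \<beta> * B v))\<bar>
      \<le> (\<bar>s\<bar> + \<bar>\<beta>\<bar>) * C"
    by (simp add: algebra_simps abs_le_iff)
  show "wt s \<beta> (u @ v) \<le> exp ((\<bar>s\<bar> + \<bar>\<beta>\<bar>) * C) * (wt s \<beta> u * wt s \<beta> v)"
    and "wt s \<beta> u * wt s \<beta> v \<le> exp ((\<bar>s\<bar> + \<bar>\<beta>\<bar>) * C) * wt s \<beta> (u @ v)"
    unfolding wt_def exp_add[symmetric] using * by (auto simp: abs_le_iff)
qed

lemma sum_le_z: "finite F \<Longrightarrow> F \<subseteq> words I n \<Longrightarrow> ennreal (sum (wt s \<beta>) F) \<le> z s \<beta> n"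
  unfolding z_def countable_nn_integral_eq_SUP_sum
  by (rule SUP_upper2[of F]) (auto simp: sum_ennreal wt_pos less_imp_le)

lemma z_le:
  assumes "\<And>F. finite F \<Longrightarrow> F \<subseteq> words I n \<Longrightarrow> ennreal (sum (wt s \<beta>) F) \<le> c"
  shows "z s \<beta> n \<le> c"
  unfolding z_def countable_nn_integral_eq_SUP_sum
  by (rule SUP_least) (use assms in \<open>auto simp: sum_ennreal wt_pos less_imp_le\<close>)

text \<open>A word of length \<open>m + n\<close> splits uniquely, and the weight of a concatenation is the product of the weights
  up to a constant; so the double sum of products is compared with a single sum.\<close>

lemma z_append:
  "z s \<beta> (m + n) \<le> ennreal (exp ((\<bar>s\<bar> + \<bar>\<beta>\<bar>) * C)) * (z s \<beta> m * z s \<beta> n)"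
  "z s \<beta> m * z s \<beta> n \<le> ennreal (exp ((\<bar>s\<bar> + \<bar>\<beta>\<bar>) * C)) * z s \<beta> (m + n)"
proof -
  let ?K = "ennreal (exp ((\<bar>s\<bar> + \<bar>\<beta>\<bar>) * C))"
  let ?W = "words I m \<times> words I n"
  have sum: "z s \<beta> (m + n) = (\<integral>\<^sup>+p. ennreal (wt s \<beta> (fst p @ snd p)) \<partial>count_space ?W)"
    unfolding z_def
    by (subst nn_integral_bij_count_space[OF words_append_bij, symmetric]) (simp add: case_prod_beta)
  have "z s \<beta> m * z s \<beta> n
      = (\<integral>\<^sup>+u. \<integral>\<^sup>+v. ennreal (wt s \<beta> u) * indicator (words I m) u *
            (ennreal (wt s \<beta> v) * indicator (words I n) v) \<partial>count_space UNIV \<partial>count_space UNIV)"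
    unfolding z_def
    by (simp add: nn_integral_count_space_indicator nn_integral_cmult nn_integral_multc)
  also have "\<dots> = (\<integral>\<^sup>+p. ennreal (wt s \<beta> (fst p)) * indicator (words I m) (fst p) *
            (ennreal (wt s \<beta> (snd p)) * indicator (words I n) (snd p)) \<partial>count_space UNIV)"
    by (subst nn_integral_fst_count_space[symmetric]) simp
  also have "\<dots> = (\<integral>\<^sup>+p. ennreal (wt s \<beta> (fst p) * wt s \<beta> (snd p)) * indicator ?W p \<partial>count_space UNIV)"
    by (rule nn_integral_cong) (auto simp: indicator_def ennreal_mult' wt_pos less_imp_le)
  also have "\<dots> = (\<integral>\<^sup>+p. ennreal (wt s \<beta> (fst p) * wt s \<beta> (snd p)) \<partial>count_space ?W)"
    by (simp add: nn_integral_count_space_indicator)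
  finally have prod: "z s \<beta> m * z s \<beta> n = \<dots>" .
  show "z s \<beta> (m + n) \<le> ?K * (z s \<beta> m * z s \<beta> n)"
    unfolding prod sum
    by (subst nn_integral_cmult[symmetric], simp)
       (intro nn_integral_mono, auto simp: words_def ennreal_mult'[symmetric] intro!: ennreal_leI wt_append)
  show "z s \<beta> m * z s \<beta> n \<le> ?K * z s \<beta> (m + n)"
    unfolding prod sum
    by (subst nn_integral_cmult[symmetric], simp)
       (intro nn_integral_mono, auto simp: words_def ennreal_mult'[symmetric] intro!: ennreal_leI wt_append)
qed

lemma z_pos: "z s \<beta> n > 0"
proof -
  obtain e where "e \<in> I" using I_nonempty by blast
  then have "{replicate n e} \<subseteq> words I n" by (auto simp: words_def)
  from sum_le_z[OF _ this, of s \<beta>] have "ennreal (wt s \<beta> (replicate n e)) \<le> z s \<beta> n" by simp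
  moreover have "0 < ennreal (wt s \<beta> (replicate n e))" by (simp add: wt_pos)
  ultimately show ?thesis by (rule order_less_le_trans[rotated])
qed

text \<open>Since \<^const>\<open>lim\<close> is unspecified for a divergent sequence, convergence has to be proved before the pressure
  can be used.  If \<open>z s \<beta> 1\<close> is infinite, then all \<open>z s \<beta> n\<close> are, and the limit is \<open>\<infinity>\<close>; otherwise
  \<open>ln (z s \<beta> n)\<close> is quasi-additive, and \<open>ln (Z n)\<close> differs from it by a bounded amount.\<close>

lemma lim_log_average_le_0_iff:
  assumes upper: "\<And>n. 1 \<le> n \<Longrightarrow> Z n \<le> ennreal (exp K) * z s \<beta> n"
    and lower: "\<And>n. 1 \<le> n \<Longrightarrow> z s \<beta> n \<le> ennreal (exp K) * Z n"
  shows "lim (\<lambda>n. ereal (1 / real n) * ln_ennreal (Z n)) \<le> 0 \<longleftrightarrow> subcritical s \<beta>"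
proof (cases "z s \<beta> 1 = \<infinity>")
  case True
  let ?M = "(\<bar>s\<bar> + \<bar>\<beta>\<bar>) * C"
  have z_inf: "z s \<beta> n = \<infinity>" if "1 \<le> n" for n
    using that
  proof (cases n rule: nat.exhaust)
    case (Suc m)
    have "z s \<beta> m * z s \<beta> 1 = \<infinity>" using True z_pos[of s \<beta> m] by (simp add: ennreal_mult_eq_top_iff)
    then have "ennreal (exp ?M) * z s \<beta> n = top"
      using z_append(2)[of s \<beta> m 1] Suc by (simp add: top_unique)
    then show ?thesis by (auto simp: ennreal_mult_eq_top_iff)
  qed simp
  have "Z n = \<infinity>" if "1 \<le> n" for n
    using lower[OF that] z_inf[OF that] by (simp add: ennreal_mult_eq_top_iff top_unique)
  then have "\<forall>\<^sub>F n in sequentially. ereal (1 / real n) * ln_ennreal (Z n) = \<infinity>"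
    by (intro eventually_sequentiallyI[of 1]) (simp add: ln_ennreal_def)
  then have "lim (\<lambda>n. ereal (1 / real n) * ln_ennreal (Z n)) = \<infinity>"
    by (intro limI tendsto_eventually)
  moreover have "\<not> subcritical s \<beta>"
  proof
    assume "subcritical s \<beta>"
    then have "\<forall>\<^sub>F n in sequentially. z s \<beta> n \<le> ennreal (exp (1 * real n))"
      unfolding subcritical_def by (metis zero_less_one)
    then obtain N where "\<And>n. n \<ge> N \<Longrightarrow> z s \<beta> n \<le> ennreal (exp (1 * real n))"
      by (auto simp: eventually_sequentially)
    from this[of "max 1 N"] z_inf[of "max 1 N"] show False by (simp add: top_unique)
  qed
  ultimately show ?thesis by simp
next
  case False
  let ?M = "(\<bar>s\<bar> + \<bar>\<beta>\<bar>) * C"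
  have z_fin: "z s \<beta> n < \<infinity>" if "1 \<le> n" for n
    using that
  proof (induction n rule: dec_induct)
    case base then show ?case using False by (simp add: top.not_eq_extremum)
  next
    case (step n)
    have "ennreal (exp ?M) * (z s \<beta> n * z s \<beta> 1) < \<infinity>"
      using step False by (simp add: ennreal_mult_less_top top.not_eq_extremum)
    then show ?case using z_append(1)[of s \<beta> n 1] by (auto simp: order_le_less_trans)
  qed
  have Z_fin: "Z n < \<infinity>" if "1 \<le> n" for n
    using upper[OF that] z_fin[OF that] by (auto simp: ennreal_mult_less_top intro: order_le_less_trans)
  have Z_pos: "Z n > 0" if "1 \<le> n" for n
    using lower[OF that] z_pos[of s \<beta> n] by (auto simp: zero_less_iff_neq_zero)
  define a where "a n = ln (enn2real (z s \<beta> n))" for n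
  define b where "b n = ln (enn2real (Z n))" for n
  have z_eq: "z s \<beta> n = ennreal (exp (a n))" if "1 \<le> n" for n
    using z_fin[OF that] z_pos[of s \<beta> n] unfolding a_def
    by (simp add: enn2real_positive_iff)
  have Z_eq: "Z n = ennreal (exp (b n))" if "1 \<le> n" for n
    using Z_fin[OF that] Z_pos[OF that] unfolding b_def
    by (simp add: enn2real_positive_iff)
  have "\<bar>a (m + n) - a m - a n\<bar> \<le> ?M" if "1 \<le> m" "1 \<le> n" for m n
    using z_append[of s \<beta> m n] z_eq[of m] z_eq[of n] z_eq[of "m + n"] that
    by (simp add: ennreal_mult'[symmetric] exp_add[symmetric] abs_le_iff)
  then have "convergent (\<lambda>n. a n / real n)" by (rule quasi_additive_average_converges)
  then obtain L where L: "(\<lambda>n. a n / real n) \<longlonglongrightarrow> L" by (auto simp: convergent_def)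
  have diff: "\<bar>b n - a n\<bar> \<le> K" if "1 \<le> n" for n
    using upper[OF that] lower[OF that] z_eq[OF that] Z_eq[OF that]
    by (simp add: ennreal_mult'[symmetric] exp_add[symmetric] abs_le_iff)
  have "(\<lambda>n. (b n - a n) / real n) \<longlonglongrightarrow> 0"
  proof (rule Lim_null_comparison)
    show "\<forall>\<^sub>F n in sequentially. norm ((b n - a n) / real n) \<le> K / real n"
      using diff by (intro eventually_sequentiallyI[of 1]) (simp add: divide_right_mono)
    show "(\<lambda>n. K / real n) \<longlonglongrightarrow> 0" by (rule lim_const_over_n)
  qed
  from tendsto_add[OF L this] have "(\<lambda>n. b n / real n) \<longlonglongrightarrow> L"
    by (simp add: add_divide_distrib[symmetric])
  then have "(\<lambda>n. ereal (b n / real n)) \<longlonglongrightarrow> ereal L" by simp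
  moreover have "\<forall>\<^sub>F n in sequentially. ereal (b n / real n) = ereal (1 / real n) * ln_ennreal (Z n)"
    using Z_eq by (intro eventually_sequentiallyI[of 1]) (simp add: ln_ennreal_def)
  ultimately have "(\<lambda>n. ereal (1 / real n) * ln_ennreal (Z n)) \<longlonglongrightarrow> ereal L"
    by (rule Lim_transform_eventually)
  then have lim: "lim (\<lambda>n. ereal (1 / real n) * ln_ennreal (Z n)) = ereal L" by (rule limI)
  have ev: "(\<forall>\<^sub>F n in sequentially. z s \<beta> n \<le> ennreal (exp (\<epsilon> * real n))) \<longleftrightarrow>
      (\<forall>\<^sub>F n in sequentially. a n / real n \<le> \<epsilon>)" for \<epsilon>
    by (rule eventually_cong[OF eventually_sequentiallyI[of 1]])
       (use z_eq in \<open>auto simp: field_simps\<close>)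
  have "L \<le> 0 \<longleftrightarrow> subcritical s \<beta>"
  proof
    assume "L \<le> 0"
    show "subcritical s \<beta>" unfolding subcritical_def ev
    proof (intro allI impI)
      fix \<epsilon> :: real assume "\<epsilon> > 0"
      with \<open>L \<le> 0\<close> have "L < \<epsilon>" by simp
      from order_tendstoD(2)[OF L this] show "\<forall>\<^sub>F n in sequentially. a n / real n \<le> \<epsilon>"
        by (rule eventually_mono) simp
    qed
  next
    assume "subcritical s \<beta>"
    then have "\<And>\<epsilon>. \<epsilon> > 0 \<Longrightarrow> \<forall>\<^sub>F n in sequentially. a n / real n \<le> \<epsilon>"
      unfolding subcritical_def ev by blast
    then have "\<And>\<epsilon>. \<epsilon> > 0 \<Longrightarrow> L \<le> \<epsilon>"
      using L tendsto_upperbound trivial_limit_sequentially by blast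
    then show "L \<le> 0" using field_le_epsilon[of L 0] by simp
  qed
  then show ?thesis by (simp add: lim)
qed

section \<open>Subcritical parameters and a common tilt\<close>

lemma subcritical_transfer:
  assumes sub: "subcritical s \<beta>" and le: "\<And>n. z s' \<beta>' n \<le> ennreal (exp K) * z s \<beta> n"
  shows "subcritical s' \<beta>'"
  unfolding subcritical_def
proof (intro allI impI)
  fix \<epsilon> :: real assume \<epsilon>: "\<epsilon> > 0"
  then have "\<forall>\<^sub>F n in sequentially. z s \<beta> n \<le> ennreal (exp (\<epsilon> / 2 * real n))"
    using sub unfolding subcritical_def by (metis half_gt_zero)
  moreover have "\<forall>\<^sub>F n in sequentially. real n \<ge> 2 * K / \<epsilon>" by (rule eventually_ge_at_top[THEN eventually_compose_filterlim]) (rule filterlim_real_sequentially)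
  ultimately show "\<forall>\<^sub>F n in sequentially. z s' \<beta>' n \<le> ennreal (exp (\<epsilon> * real n))"
  proof eventually_elim
    case (elim n)
    have "z s' \<beta>' n \<le> ennreal (exp K) * ennreal (exp (\<epsilon> / 2 * real n))"
      using le[of n] mult_left_mono[OF elim(1), of "ennreal (exp K)"] by (rule order_trans) simp
    also have "\<dots> = ennreal (exp (K + \<epsilon> / 2 * real n))" by (simp add: ennreal_mult'[symmetric] exp_add)
    also have "\<dots> \<le> ennreal (exp (\<epsilon> * real n))"
      using elim(2) \<epsilon> by (intro ennreal_leI) (simp add: field_simps)
    finally show ?case .
  qed
qed

lemma z_cmult_le:
  assumes "\<And>w. w \<in> words I n \<Longrightarrow> wt s' \<beta>' w \<le> K * wt s \<beta> w" and "K \<ge> 0"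
  shows "z s' \<beta>' n \<le> ennreal K * z s \<beta> n"
  unfolding z_def
  by (subst nn_integral_cmult[symmetric], simp, rule nn_integral_mono)
     (use assms in \<open>auto simp: ennreal_mult'[symmetric] intro!: ennreal_leI\<close>)

lemma z_decay:
  assumes "s \<le> s'"
  shows "z s' \<beta> n \<le> ennreal (exp (- ((s' - s) * \<kappa> * real n))) * z s \<beta> n"
proof (rule z_cmult_le)
  fix w assume w: "w \<in> words I n"
  then have "lam w \<le> - \<kappa> * real n" using lam_le by (auto simp: words_def)
  then have "(s' - s) * lam w \<le> (s' - s) * (- \<kappa> * real n)" using assms by (intro mult_left_mono) auto
  then show "wt s' \<beta> w \<le> exp (- ((s' - s) * \<kappa> * real n)) * wt s \<beta> w"
    unfolding wt_def exp_add[symmetric] by (simp add: algebra_simps)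
qed simp

lemma subcritical_mono:
  assumes "subcritical s \<beta>" "s \<le> s'"
  shows "subcritical s' \<beta>"
proof (rule subcritical_transfer[OF assms(1)])
  fix n
  have "z s' \<beta> n \<le> ennreal (exp (- ((s' - s) * \<kappa> * real n))) * z s \<beta> n" by (rule z_decay[OF assms(2)])
  also have "\<dots> \<le> ennreal (exp 0) * z s \<beta> n"
    using assms(2) \<kappa>_pos by (intro mult_right_mono ennreal_leI) auto
  finally show "z s' \<beta> n \<le> ennreal (exp 0) * z s \<beta> n" .
qed

text \<open>By convexity of \<^const>\<open>exp\<close>, the weight of each word at the mixed parameter is at most the mixture of its
  weights, and subexponential growth survives mixing.\<close>

lemma subcritical_convex:
  assumes sub: "subcritical s1 \<beta>1" "subcritical s2 \<beta>2" and u: "0 \<le> u" "u \<le> 1"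
  shows "subcritical ((1 - u) * s1 + u * s2) ((1 - u) * \<beta>1 + u * \<beta>2)"
  unfolding subcritical_def
proof (intro allI impI)
  fix \<epsilon> :: real assume \<epsilon>: "\<epsilon> > 0"
  let ?s = "(1 - u) * s1 + u * s2" and ?\<beta> = "(1 - u) * \<beta>1 + u * \<beta>2"
  have conv: "wt ?s ?\<beta> w \<le> (1 - u) * wt s1 \<beta>1 w + u * wt s2 \<beta>2 w" for w
  proof -
    have "?s * lam w + ?\<beta> * B w = (1 - u) *\<^sub>R (s1 * lam w + \<beta>1 * B w) + u *\<^sub>R (s2 * lam w + \<beta>2 * B w)"
      by (simp add: algebra_simps)
    then show ?thesis unfolding wt_def using convex_onD[OF exp_convex u] by simp
  qed
  have le: "z ?s ?\<beta> n \<le> ennreal (1 - u) * z s1 \<beta>1 n + ennreal u * z s2 \<beta>2 n" for n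
  proof (rule z_le)
    fix F assume F: "finite F" "F \<subseteq> words I n"
    have "sum (wt ?s ?\<beta>) F \<le> (1 - u) * sum (wt s1 \<beta>1) F + u * sum (wt s2 \<beta>2) F"
      unfolding sum_distrib_left sum.distrib[symmetric] by (rule sum_mono) (rule conv)
    then have "ennreal (sum (wt ?s ?\<beta>) F) \<le> ennreal ((1 - u) * sum (wt s1 \<beta>1) F + u * sum (wt s2 \<beta>2) F)"
      by (rule ennreal_leI)
    also have "\<dots> = ennreal (1 - u) * ennreal (sum (wt s1 \<beta>1) F) + ennreal u * ennreal (sum (wt s2 \<beta>2) F)"
      using u by (simp add: ennreal_mult'[symmetric] ennreal_plus[symmetric] sum_nonneg wt_pos less_imp_le del: ennreal_plus)
    also have "\<dots> \<le> ennreal (1 - u) * z s1 \<beta>1 n + ennreal u * z s2 \<beta>2 n"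
      by (intro add_mono mult_left_mono sum_le_z F) auto
    finally show "ennreal (sum (wt ?s ?\<beta>) F) \<le> \<dots>" .
  qed
  have "\<forall>\<^sub>F n in sequentially. z s1 \<beta>1 n \<le> ennreal (exp (\<epsilon> * real n))"
    "\<forall>\<^sub>F n in sequentially. z s2 \<beta>2 n \<le> ennreal (exp (\<epsilon> * real n))"
    using sub \<epsilon> unfolding subcritical_def by blast+
  then have "\<forall>\<^sub>F n in sequentially. ennreal (1 - u) * z s1 \<beta>1 n + ennreal u * z s2 \<beta>2 n \<le> ennreal (exp (\<epsilon> * real n))"
  proof eventually_elim
    case (elim n)
    have "ennreal (1 - u) * z s1 \<beta>1 n + ennreal u * z s2 \<beta>2 n
        \<le> ennreal (1 - u) * ennreal (exp (\<epsilon> * real n)) + ennreal u * ennreal (exp (\<epsilon> * real n))"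
      by (intro add_mono mult_left_mono elim) auto
    also have "\<dots> = (ennreal (1 - u) + ennreal u) * ennreal (exp (\<epsilon> * real n))"
      by (simp only: distrib_right)
    also have "ennreal (1 - u) + ennreal u = 1" using u by (subst ennreal_plus[symmetric]) auto
    also have "1 * ennreal (exp (\<epsilon> * real n)) = ennreal (exp (\<epsilon> * real n))" by simp
    finally show ?case .
  qed
  then show "\<forall>\<^sub>F n in sequentially. z ?s ?\<beta> n \<le> ennreal (exp (\<epsilon> * real n))"
    by (rule eventually_mono) (rule order_trans[OF le])
qed

lemma supercritical_large_sum:
  assumes "\<not> subcritical s \<beta>"
  obtains n F where "1 \<le> n" "finite F" "F \<subseteq> words I n" "sum (wt s \<beta>) F > Y"
proof -
  obtain \<epsilon> where \<epsilon>: "\<epsilon> > 0" "\<not> (\<forall>\<^sub>F n in sequentially. z s \<beta> n \<le> ennreal (exp (\<epsilon> * real n)))"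
    using assms unfolding subcritical_def by blast
  obtain N where N: "real N > Y / \<epsilon>" using reals_Archimedean2 by blast
  obtain n where n: "n \<ge> max 1 N" "\<not> z s \<beta> n \<le> ennreal (exp (\<epsilon> * real n))"
    using \<epsilon>(2) unfolding eventually_sequentially by blast
  have "\<exists>F. finite F \<and> F \<subseteq> words I n \<and> \<not> ennreal (sum (wt s \<beta>) F) \<le> ennreal (exp (\<epsilon> * real n))"
  proof (rule ccontr)
    assume none: "\<not> ?thesis"
    have "z s \<beta> n \<le> ennreal (exp (\<epsilon> * real n))"
    proof (rule z_le)
      fix F assume "finite F" "F \<subseteq> words I n"
      then show "ennreal (sum (wt s \<beta>) F) \<le> ennreal (exp (\<epsilon> * real n))" using none by blast
    qed
    then show False using n(2) by simp
  qed
  then obtain F where F: "finite F" "F \<subseteq> words I n" "sum (wt s \<beta>) F > exp (\<epsilon> * real n)"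
    by (meson ennreal_leI not_less)
  have "Y / \<epsilon> < real n" using N n(1) by (meson less_le_trans max.bounded_iff of_nat_mono)
  then have "Y < \<epsilon> * real n" using \<epsilon>(1) by (simp add: field_simps)
  also have "\<dots> \<le> exp (\<epsilon> * real n)" using exp_ge_add_one_self[of "\<epsilon> * real n"] by linarith
  finally show ?thesis using that[of n F] F n(1) by simp
qed

text \<open>How far \<open>w\<close> is from realising the ratio \<open>\<alpha>\<close> of \<open>B\<close> to \<open>lam\<close>.\<close>

definition disc :: "real \<Rightarrow> nat list \<Rightarrow> real" where
  "disc \<alpha> w = B w - \<alpha> * lam w"

text \<open>The weights \<open>wt\<close> in coordinates adapted to \<open>\<alpha>\<close>: the parameter \<open>\<beta>\<close> acts on the discrepancy only, so
  it has a bounded effect on words of bounded discrepancy.\<close>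

definition tilt :: "real \<Rightarrow> real \<Rightarrow> real \<Rightarrow> nat list \<Rightarrow> real" where
  "tilt \<alpha> s \<beta> w = exp (s * lam w + \<beta> * disc \<alpha> w)"

definition disc_err :: "real \<Rightarrow> real" where
  "disc_err \<alpha> = (1 + \<bar>\<alpha>\<bar>) * C"

lemma disc_err_nonneg: "disc_err \<alpha> \<ge> 0"
  using C_nonneg by (simp add: disc_err_def)

lemma disc_append:
  assumes "u \<in> lists I" "v \<in> lists I"
  shows "\<bar>disc \<alpha> (u @ v) - disc \<alpha> u - disc \<alpha> v\<bar> \<le> disc_err \<alpha>"
proof -
  have "\<bar>\<alpha> * (lam (u @ v) - lam u - lam v)\<bar> \<le> \<bar>\<alpha>\<bar> * C"
    unfolding abs_mult by (intro mult_left_mono lam_append assms) simp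
  then show ?thesis using B_append[OF assms] unfolding disc_def disc_err_def by (simp add: algebra_simps abs_le_iff)
qed

lemma disc_Nil: "disc \<alpha> [] = 0" by (simp add: disc_def lam_Nil B_Nil)

lemma tilt_wt: "tilt \<alpha> s \<beta> w = wt (s - \<alpha> * \<beta>) \<beta> w"
  by (simp add: tilt_def wt_def disc_def algebra_simps)

lemma tilt_pos: "tilt \<alpha> s \<beta> w > 0" by (simp add: tilt_def)

text \<open>The loss in the exponent of \<open>tilt\<close> per concatenation.\<close>

definition tilt_err :: "real \<Rightarrow> real \<Rightarrow> real \<Rightarrow> real" where
  "tilt_err \<alpha> s \<beta> = \<bar>s\<bar> * C + \<bar>\<beta>\<bar> * disc_err \<alpha>"

lemma tilt_append:
  assumes "u \<in> lists I" "v \<in> lists I"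
  shows "tilt \<alpha> s \<beta> u * tilt \<alpha> s \<beta> v \<le> exp (tilt_err \<alpha> s \<beta>) * tilt \<alpha> s \<beta> (u @ v)"
proof -
  have "\<bar>s * (lam (u @ v) - lam u - lam v)\<bar> \<le> \<bar>s\<bar> * C" "\<bar>\<beta> * (disc \<alpha> (u @ v) - disc \<alpha> u - disc \<alpha> v)\<bar> \<le> \<bar>\<beta>\<bar> * disc_err \<alpha>"
    unfolding abs_mult by (intro mult_left_mono lam_append disc_append assms; simp)+
  then show ?thesis unfolding tilt_def tilt_err_def exp_add[symmetric] by (simp add: algebra_simps abs_le_iff)
qed

text \<open>If \<open>(\<beta> - \<beta>') * disc \<alpha> w\<close> were bounded above, passing from \<open>\<beta>'\<close> to \<open>\<beta>\<close> would change all weights by at most a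
  constant factor and so preserve subcriticality.\<close>

lemma ex_word_large_discrepancy:
  assumes sub: "subcritical (s - \<alpha> * \<beta>') \<beta>'" and super: "\<not> subcritical (s - \<alpha> * \<beta>) \<beta>"
  shows "\<exists>w\<in>lists I. (\<beta> - \<beta>') * disc \<alpha> w > M"
proof (rule ccontr)
  assume "\<not> (\<exists>w\<in>lists I. (\<beta> - \<beta>') * disc \<alpha> w > M)"
  then have le: "\<And>w. w \<in> lists I \<Longrightarrow> (\<beta> - \<beta>') * disc \<alpha> w \<le> M" by (meson not_le)
  have "subcritical (s - \<alpha> * \<beta>) \<beta>"
  proof (rule subcritical_transfer[OF sub], rule z_cmult_le)
    fix w n assume "w \<in> words I n"
    then have "(\<beta> - \<beta>') * disc \<alpha> w \<le> M" using le by (auto simp: words_def)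
    then show "wt (s - \<alpha> * \<beta>) \<beta> w \<le> exp M * wt (s - \<alpha> * \<beta>') \<beta>' w"
      unfolding tilt_wt[symmetric] tilt_def exp_add[symmetric] by (simp add: algebra_simps)
  qed simp
  then show False using super by blast
qed

text \<open>For a fixed finite family both sides of the strict inequality are continuous in \<open>\<beta>\<close>.\<close>

lemma tilted_words_open:
  "open {\<beta>. \<exists>n G. finite G \<and> G \<subseteq> words I n \<and> (\<forall>w\<in>G. P w) \<and> exp (tilt_err \<alpha> s \<beta>) < sum (tilt \<alpha> s \<beta>) G}"
proof -
  have "open {\<beta>. exp (tilt_err \<alpha> s \<beta>) < sum (tilt \<alpha> s \<beta>) G}" for G
    unfolding tilt_err_def tilt_def by (intro open_Collect_less continuous_intros)
  then have "open (\<Union>(n, G)\<in>{(n, G). finite G \<and> G \<subseteq> words I n \<and> (\<forall>w\<in>G. P w)}. {\<beta>. exp (tilt_err \<alpha> s \<beta>) < sum (tilt \<alpha> s \<beta>) G})"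
    by (intro open_UN) auto
  moreover have "(\<Union>(n, G)\<in>{(n, G). finite G \<and> G \<subseteq> words I n \<and> (\<forall>w\<in>G. P w)}. {\<beta>. exp (tilt_err \<alpha> s \<beta>) < sum (tilt \<alpha> s \<beta>) G})
     = {\<beta>. \<exists>n G. finite G \<and> G \<subseteq> words I n \<and> (\<forall>w\<in>G. P w) \<and> exp (tilt_err \<alpha> s \<beta>) < sum (tilt \<alpha> s \<beta>) G}"
    by auto
  ultimately show ?thesis by simp
qed

text \<open>The heart of the lower bound.  Both families are needed at the same \<open>\<beta>\<close>, since only then do the tilts of
  successive blocks of opposite signs cancel.  Such a \<open>\<beta>\<close> exists because the line is not a union of two
  disjoint nonempty open sets.\<close>

theorem common_tilt:
  assumes super: "\<And>\<beta>. \<not> subcritical (s - \<alpha> * \<beta>) \<beta>"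
    and up: "\<And>M. \<exists>u\<in>lists I. disc \<alpha> u > M" and down: "\<And>M. \<exists>u\<in>lists I. disc \<alpha> u < - M"
  obtains \<beta> p P q Q where
    "finite P" "P \<subseteq> words I p" "\<And>w. w \<in> P \<Longrightarrow> disc \<alpha> w \<ge> M" "exp (tilt_err \<alpha> s \<beta>) < sum (tilt \<alpha> s \<beta>) P"
    "finite Q" "Q \<subseteq> words I q" "\<And>w. w \<in> Q \<Longrightarrow> disc \<alpha> w \<le> - M" "exp (tilt_err \<alpha> s \<beta>) < sum (tilt \<alpha> s \<beta>) Q"
proof -
  define E where "E \<sigma> = {\<beta>. \<exists>n G. finite G \<and> G \<subseteq> words I n \<and> (\<forall>w\<in>G. \<sigma> * disc \<alpha> w \<ge> M) \<and>
      exp (tilt_err \<alpha> s \<beta>) < sum (tilt \<alpha> s \<beta>) G}" for \<sigma> :: real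
  have opn: "open (E \<sigma>)" for \<sigma> unfolding E_def by (rule tilted_words_open)
  have shift: "\<exists>u\<in>lists I. \<sigma> * disc \<alpha> u > M'" if "\<sigma> = 1 \<or> \<sigma> = -1" for \<sigma> M' :: real
    using that up[of M'] down[of M'] by force
  have nonempty: "E \<sigma> \<noteq> {}" if \<sigma>: "\<sigma> = 1 \<or> \<sigma> = -1" for \<sigma>
  proof -
    obtain u where u: "u \<in> lists I" "\<sigma> * disc \<alpha> u > max M (disc_err \<alpha> + 1)" using shift[OF \<sigma>] by blast
    \<comment> \<open>A single word suffices once \<open>\<bar>\<beta>\<bar>\<close> is large, because its discrepancy exceeds the error by \<open>1\<close>.\<close>
    define b where "b = max 1 (\<bar>s\<bar> * C - s * lam u + 1)"
    have b: "b \<ge> 1" "b > \<bar>s\<bar> * C - s * lam u" by (auto simp: b_def)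
    have "b * 1 \<le> b * (\<sigma> * disc \<alpha> u - disc_err \<alpha>)" using u b by (intro mult_left_mono) auto
    then have "b < b * (\<sigma> * disc \<alpha> u - disc_err \<alpha>) + 1" by linarith
    then have "\<bar>s\<bar> * C + b * disc_err \<alpha> < s * lam u + b * (\<sigma> * disc \<alpha> u)"
      using \<open>b * 1 \<le> _\<close> b(2) by (simp add: algebra_simps)
    moreover have "\<bar>\<sigma> * b\<bar> = b" using \<sigma> b by auto
    ultimately have "exp (tilt_err \<alpha> s (\<sigma> * b)) < sum (tilt \<alpha> s (\<sigma> * b)) {u}"
      by (simp add: tilt_err_def tilt_def algebra_simps)
    then have "\<sigma> * b \<in> E \<sigma>" unfolding E_def
      using u by (intro CollectI exI[of _ "length u"] exI[of _ "{u}"]) (auto simp: words_def)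
    then show ?thesis by blast
  qed
  have cover: "\<beta> \<in> E 1 \<union> E (-1)" for \<beta>
  proof -
    have "\<exists>u\<in>lists I. \<sigma> * disc \<alpha> u > M + disc_err \<alpha>" if "\<sigma> = 1 \<or> \<sigma> = -1" for \<sigma> using shift[OF that] .
    then obtain u where u: "\<And>\<sigma>::real. \<sigma> = 1 \<or> \<sigma> = -1 \<Longrightarrow> u \<sigma> \<in> lists I \<and> \<sigma> * disc \<alpha> (u \<sigma>) > M + disc_err \<alpha>"
      by metis
    \<comment> \<open>\<open>Y \<sigma>\<close> pays for appending \<open>u \<sigma>\<close>: its own weight, one error of concatenation, and the threshold.\<close>
    define Y where "Y \<sigma> = exp (2 * tilt_err \<alpha> s \<beta>) / tilt \<alpha> s \<beta> (u \<sigma>)" for \<sigma> :: real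
    obtain n F where F: "finite F" "F \<subseteq> words I n" "sum (tilt \<alpha> s \<beta>) F > Y 1 + Y (-1)"
      using supercritical_large_sum[OF super[of \<beta>], of "Y 1 + Y (-1)"] unfolding tilt_wt by metis
    define S where "S \<sigma> = {w\<in>F. \<sigma> * disc \<alpha> w \<ge> 0}" for \<sigma> :: real
    have "sum (tilt \<alpha> s \<beta>) F \<le> sum (tilt \<alpha> s \<beta>) (S 1 \<union> S (-1))"
      using F(1) tilt_pos by (intro sum_mono2) (auto simp: S_def less_imp_le)
    also have "\<dots> \<le> sum (tilt \<alpha> s \<beta>) (S 1) + sum (tilt \<alpha> s \<beta>) (S (-1))"
      using F(1) tilt_pos by (subst sum_Un) (auto simp: S_def sum_nonneg less_imp_le)
    finally have "sum (tilt \<alpha> s \<beta>) (S 1) > Y 1 \<or> sum (tilt \<alpha> s \<beta>) (S (-1)) > Y (-1)" using F(3) by linarith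
    then obtain \<sigma> :: real where \<sigma>: "\<sigma> = 1 \<or> \<sigma> = -1" "sum (tilt \<alpha> s \<beta>) (S \<sigma>) > Y \<sigma>" by blast
    define G where "G = (\<lambda>w. w @ u \<sigma>) ` S \<sigma>"
    have uI: "u \<sigma> \<in> lists I" "\<sigma> * disc \<alpha> (u \<sigma>) > M + disc_err \<alpha>" using u[OF \<sigma>(1)] by auto
    have SI: "w \<in> lists I" "w \<in> words I n" "\<sigma> * disc \<alpha> w \<ge> 0" if "w \<in> S \<sigma>" for w
      using that F(2) by (auto simp: S_def words_def)
    have "exp (tilt_err \<alpha> s \<beta>) * exp (tilt_err \<alpha> s \<beta>) = Y \<sigma> * tilt \<alpha> s \<beta> (u \<sigma>)"
      using tilt_pos[of \<alpha> s \<beta> "u \<sigma>"] by (simp add: Y_def exp_add[symmetric])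
    also have "\<dots> < sum (tilt \<alpha> s \<beta>) (S \<sigma>) * tilt \<alpha> s \<beta> (u \<sigma>)"
      using \<sigma>(2) tilt_pos by (rule mult_strict_right_mono)
    also have "\<dots> = (\<Sum>w\<in>S \<sigma>. tilt \<alpha> s \<beta> w * tilt \<alpha> s \<beta> (u \<sigma>))" by (rule sum_distrib_right)
    also have "\<dots> \<le> (\<Sum>w\<in>S \<sigma>. exp (tilt_err \<alpha> s \<beta>) * tilt \<alpha> s \<beta> (w @ u \<sigma>))"
      by (intro sum_mono tilt_append SI uI)
    also have "\<dots> = exp (tilt_err \<alpha> s \<beta>) * sum (tilt \<alpha> s \<beta>) G"
      unfolding G_def by (subst sum.reindex) (auto simp: inj_on_def sum_distrib_left)
    finally have "exp (tilt_err \<alpha> s \<beta>) < sum (tilt \<alpha> s \<beta>) G" by simp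
    moreover have "\<sigma> * disc \<alpha> v \<ge> M" if vG: "v \<in> G" for v
    proof -
      obtain w where w: "w \<in> S \<sigma>" "v = w @ u \<sigma>" using vG by (auto simp: G_def)
      have "\<bar>\<sigma> * (disc \<alpha> v - disc \<alpha> w - disc \<alpha> (u \<sigma>))\<bar> \<le> disc_err \<alpha>"
        using disc_append[OF SI(1)[OF w(1)] uI(1), of \<alpha>] \<sigma>(1) w(2) by (auto simp: abs_mult)
      then show ?thesis using SI(3)[OF w(1)] uI(2) by (simp add: algebra_simps abs_le_iff)
    qed
    moreover have "w @ u \<sigma> \<in> words I (n + length (u \<sigma>))" if "w \<in> S \<sigma>" for w
      using SI(2)[OF that] uI(1) by (simp add: words_def)
    then have "finite G" "G \<subseteq> words I (n + length (u \<sigma>))"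
      using F(1) by (auto simp: G_def S_def)
    ultimately have "\<beta> \<in> E \<sigma>" unfolding E_def by blast
    then show ?thesis using \<sigma>(1) by blast
  qed
  have "E 1 \<inter> E (-1) \<noteq> {}"
  proof
    assume "E 1 \<inter> E (-1) = {}"
    then have "E 1 = {} \<or> E (-1) = {}"
      using connectedD[OF connected_UNIV opn[of 1] opn[of "-1"]] cover by blast
    then show False using nonempty by blast
  qed
  then obtain \<beta> where "\<beta> \<in> E 1" "\<beta> \<in> E (-1)" by blast
  then obtain p P q Q where
    "finite P" "P \<subseteq> words I p" "\<forall>w\<in>P. 1 * disc \<alpha> w \<ge> M" "exp (tilt_err \<alpha> s \<beta>) < sum (tilt \<alpha> s \<beta>) P"
    "finite Q" "Q \<subseteq> words I q" "\<forall>w\<in>Q. -1 * disc \<alpha> w \<ge> M" "exp (tilt_err \<alpha> s \<beta>) < sum (tilt \<alpha> s \<beta>) Q"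
    unfolding E_def by blast
  then show ?thesis by (intro that[of P p \<beta> Q q]) auto
qed

lemma repeat_word_bounds:
  assumes u: "u \<in> lists I"
  shows "concat (replicate m u) \<in> words I (m * length u)"
    and "\<bar>disc \<alpha> (concat (replicate m u)) - real m * disc \<alpha> u\<bar> \<le> real m * disc_err \<alpha>"
proof -
  show in_words: "concat (replicate m u) \<in> words I (m * length u)" for m
    using u by (induction m) (auto simp: words_def)
  show "\<bar>disc \<alpha> (concat (replicate m u)) - real m * disc \<alpha> u\<bar> \<le> real m * disc_err \<alpha>"
  proof (induction m)
    case (Suc m)
    have "\<bar>disc \<alpha> (u @ concat (replicate m u)) - disc \<alpha> u - disc \<alpha> (concat (replicate m u))\<bar> \<le> disc_err \<alpha>"
      using in_words[of m] by (intro disc_append u) (auto simp: words_def)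
    then show ?case using Suc by (simp add: algebra_simps abs_le_iff)
  qed (simp add: disc_Nil)
qed

text \<open>The powers of a single word already bound the sums from below.\<close>

lemma not_subcritical_if_periodic_growth:
  assumes u: "u \<in> lists I" "u \<noteq> []" and \<delta>: "\<delta> > 0"
    and grow: "\<And>m. \<delta> * real (m * length u) \<le> s * lam (concat (replicate m u)) + \<beta> * disc \<alpha> (concat (replicate m u))"
  shows "\<not> subcritical (s - \<alpha> * \<beta>) \<beta>"
proof
  assume "subcritical (s - \<alpha> * \<beta>) \<beta>"
  then have "\<forall>\<^sub>F n in sequentially. z (s - \<alpha> * \<beta>) \<beta> n \<le> ennreal (exp (\<delta> / 2 * real n))"
    using \<delta> unfolding subcritical_def by (metis half_gt_zero)
  then obtain N where N: "\<And>n. n \<ge> N \<Longrightarrow> z (s - \<alpha> * \<beta>) \<beta> n \<le> ennreal (exp (\<delta> / 2 * real n))"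
    by (auto simp: eventually_sequentially)
  define m where "m = Suc N"
  have len: "m * length u \<ge> N" "m * length u > 0" using u(2) by (cases "length u"; simp add: m_def)+
  let ?w = "concat (replicate m u)"
  have "ennreal (wt (s - \<alpha> * \<beta>) \<beta> ?w) \<le> z (s - \<alpha> * \<beta>) \<beta> (m * length u)"
    using sum_le_z[of "{?w}"] repeat_word_bounds(1)[OF u(1)] by simp
  also have "\<dots> \<le> ennreal (exp (\<delta> / 2 * real (m * length u)))" using N len by blast
  finally have "wt (s - \<alpha> * \<beta>) \<beta> ?w \<le> exp (\<delta> / 2 * real (m * length u))" by (simp add: ennreal_le_iff)
  moreover have "exp (\<delta> * real (m * length u)) \<le> wt (s - \<alpha> * \<beta>) \<beta> ?w"
    unfolding tilt_wt[symmetric] tilt_def using grow[of m] by simp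
  ultimately have "\<delta> * real (m * length u) \<le> \<delta> / 2 * real (m * length u)"
    by (metis exp_le_cancel_iff order_trans)
  moreover have "0 < \<delta> * real (m * length u)"
    using \<delta> len(2) by (intro mult_pos_pos) (simp_all only: of_nat_0_less_iff)
  ultimately show False by linarith
qed

lemma lam_repeat_le: "u \<in> lists I \<Longrightarrow> lam (concat (replicate m u)) \<le> - \<kappa> * real (m * length u)"
  using lam_le[of "concat (replicate m u)"] repeat_word_bounds(1)[of u m] by (auto simp: words_def)

text \<open>For negative \<open>s\<close> the term \<open>s * lam\<close> grows linearly with the length.  Along the powers of a word whose
  discrepancy has the sign of \<open>\<beta>\<close>, the other term does not become negative, so the sums grow exponentially.\<close>

lemma subcritical_nonneg:
  assumes up: "\<And>M. \<exists>u\<in>lists I. disc \<alpha> u > M" and down: "\<And>M. \<exists>u\<in>lists I. disc \<alpha> u < - M"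
    and sub: "subcritical (s - \<alpha> * \<beta>) \<beta>"
  shows "s \<ge> 0"
proof (rule ccontr)
  assume "\<not> s \<ge> 0"
  then have s: "s < 0" by simp
  obtain u where u: "u \<in> lists I" "\<beta> * disc \<alpha> u \<ge> \<bar>\<beta>\<bar> * disc_err \<alpha>" "\<bar>disc \<alpha> u\<bar> > 0"
  proof (cases "\<beta> \<ge> 0")
    case True
    obtain u where "u \<in> lists I" "disc \<alpha> u > disc_err \<alpha>" using up by blast
    then show ?thesis
      using that[of u] True disc_err_nonneg[of \<alpha>] mult_left_mono[of "disc_err \<alpha>" "disc \<alpha> u" \<beta>] by auto
  next
    case False
    obtain u where "u \<in> lists I" "disc \<alpha> u < - disc_err \<alpha>" using down by blast
    then show ?thesis using that[of u] False disc_err_nonneg[of \<alpha>] mult_left_mono[of "disc_err \<alpha>" "- disc \<alpha> u" "- \<beta>"]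
      by (auto simp: abs_if)
  qed
  have ne: "u \<noteq> []" using u(3) disc_Nil by auto
  have "\<not> subcritical (s - \<alpha> * \<beta>) \<beta>"
  proof (rule not_subcritical_if_periodic_growth[OF u(1) ne, of "- s * \<kappa>"])
    show "0 < - s * \<kappa>" using s \<kappa>_pos by (simp add: mult_neg_pos)
    fix m
    let ?w = "concat (replicate m u)"
    have "\<bar>\<beta> * (disc \<alpha> ?w - real m * disc \<alpha> u)\<bar> \<le> \<bar>\<beta>\<bar> * (real m * disc_err \<alpha>)"
      unfolding abs_mult by (intro mult_left_mono repeat_word_bounds u) simp
    moreover have "real m * (\<bar>\<beta>\<bar> * disc_err \<alpha>) \<le> real m * (\<beta> * disc \<alpha> u)" by (intro mult_left_mono u) simp
    ultimately have "\<beta> * disc \<alpha> ?w \<ge> 0" by (simp add: algebra_simps abs_le_iff)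
    moreover have "s * lam ?w \<ge> s * (- \<kappa> * real (m * length u))"
      using lam_repeat_le[OF u(1), of m] s by (intro mult_left_mono_neg) auto
    ultimately show "- s * \<kappa> * real (m * length u) \<le> s * lam ?w + \<beta> * disc \<alpha> ?w" by simp
  qed
  then show False using sub by blast
qed

text \<open>Along the powers of one letter \<open>\<beta> * B\<close> changes at most linearly, and a very negative \<open>s\<close> outweighs this.\<close>

lemma subcritical_bounded_below: "\<exists>s0. \<forall>s. subcritical s \<beta> \<longrightarrow> s0 \<le> s"
proof -
  obtain e where e: "e \<in> I" using I_nonempty by blast
  define b where "b = \<bar>\<beta>\<bar> * (\<bar>disc 0 [e]\<bar> + disc_err 0)"
  have "- (b + 1) / \<kappa> \<le> s" if sub: "subcritical s \<beta>" for s
  proof (rule ccontr)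
    assume "\<not> - (b + 1) / \<kappa> \<le> s"
    then have "s < - (b + 1) / \<kappa>" by simp
    then have "s * \<kappa> < - (b + 1)" using \<kappa>_pos by (simp only: pos_less_divide_eq)
    then have s: "- s * \<kappa> > b + 1" by simp
    have "b \<ge> 0" using disc_err_nonneg[of 0] by (simp add: b_def)
    then have s0: "s < 0" using s \<kappa>_pos by (smt (verit) mult_nonneg_nonneg mult_minus_left)
    have "\<not> subcritical (s - 0 * \<beta>) \<beta>"
    proof (rule not_subcritical_if_periodic_growth[of "[e]" 1])
      fix m
      let ?w = "concat (replicate m [e])"
      have "\<bar>disc 0 ?w\<bar> \<le> real m * disc_err 0 + real m * \<bar>disc 0 [e]\<bar>"
        using repeat_word_bounds(2)[of "[e]" 0 m] e abs_mult[of "real m" "disc 0 [e]"] by simp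
      then have "\<bar>\<beta> * disc 0 ?w\<bar> \<le> \<bar>\<beta>\<bar> * (real m * disc_err 0 + real m * \<bar>disc 0 [e]\<bar>)"
        unfolding abs_mult by (intro mult_left_mono) auto
      also have "\<dots> = b * real m" by (simp add: b_def algebra_simps)
      finally have "- (b * real m) \<le> \<beta> * disc 0 ?w" by linarith
      moreover have "s * lam ?w \<ge> s * (- \<kappa> * real (m * length [e]))"
        using lam_repeat_le[of "[e]" m] e s0 by (intro mult_left_mono_neg) auto
      moreover have "(b + 1) * real m \<le> - s * \<kappa> * real m" using s by (intro mult_right_mono) auto
      ultimately show "1 * real (m * length [e]) \<le> s * lam ?w + \<beta> * disc 0 ?w" by (simp add: algebra_simps)
    qed (use e in auto)
    then show False using sub by simp
  qed
  then show ?thesis by blast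
qed

end

section \<open>Trees of words\<close>

inductive_set block_tree :: "('a list \<Rightarrow> 'a list set) \<Rightarrow> 'a list set" for ch where
  root: "[] \<in> block_tree ch"
| step: "v \<in> block_tree ch \<Longrightarrow> w \<in> ch v \<Longrightarrow> v @ w \<in> block_tree ch"

text \<open>Nodes are plain words, so it has to be excluded that a word is parsed into blocks in two ways.  All
  blocks admissible at a node have the same length, hence a node cannot lie strictly between
  another node and its child.\<close>

lemma block_tree_next:
  assumes len: "\<And>v w. w \<in> ch v \<Longrightarrow> length w = len v"
    and nonempty: "\<And>v w. w \<in> ch v \<Longrightarrow> w \<noteq> []"
    and "u \<in> block_tree ch" "v \<in> block_tree ch" "strict_prefix u v"
  shows "\<exists>w\<in>ch u. prefix (u @ w) v"
  using assms(3-)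
proof (induction "length v" arbitrary: u v rule: less_induct)
  case less
  from less.prems(2) show ?case
  proof (cases rule: block_tree.cases)
    case root
    then show ?thesis using less.prems(3) by simp
  next
    case (step v' w)
    have w: "length w = len v'" using len step(3) .
    consider "u = v'" | "strict_prefix u v'" | "strict_prefix v' u"
      using less.prems(3) step(1) by (metis prefix_order.le_less prefix_order.less_imp_le prefix_same_cases prefixI)
    then show ?thesis
    proof cases
      case 1
      then show ?thesis using step by auto
    next
      case 2
      have "length v' < length v" using step nonempty[OF step(3)] by simp
      then obtain w' where "w' \<in> ch u" "prefix (u @ w') v'"
        using less.hyps[of v' u] less.prems(1) step(2) 2 by blast
      then show ?thesis unfolding step(1) by (meson prefix_order.order_trans prefixI)
    next
      case 3
      have "length u < length v" using less.prems(3) by (rule prefix_length_less)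
      then obtain w' where w': "w' \<in> ch v'" "prefix (v' @ w') u"
        using less.hyps[of u v'] step less.prems(1) 3 by blast
      then have "length v \<le> length u" using prefix_length_le[OF w'(2)] len[OF w'(1)] w step(1) by simp
      then show ?thesis using prefix_length_less[OF less.prems(3)] by simp
    qed
  qed
qed

text \<open>A greedy descent in place of a measure on the tree.  At each node the total weight of the forbidden nodes
  that extend it is kept below the weight of the node itself.  The forbidden weight is distributed over the children,
  the weights of the children add up to at least the weight of the node, so some child inherits the strict
  inequality.  A node satisfying it is not forbidden, as it would count itself.\<close>

lemma tree_path_avoiding:
  fixes T :: "'a list set" and ch :: "'a list \<Rightarrow> 'a list set" and m :: "'a list \<Rightarrow> real"
  assumes root: "[] \<in> T"
    and closed: "\<And>v w. v \<in> T \<Longrightarrow> w \<in> ch v \<Longrightarrow> v @ w \<in> T"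
    and fin: "\<And>v. finite (ch v)"
    and len: "\<And>v w. w \<in> ch v \<Longrightarrow> length w = len v"
    and m_nonneg: "\<And>v. 0 \<le> m v"
    and m_super: "\<And>v. v \<in> T \<Longrightarrow> m v \<le> (\<Sum>w\<in>ch v. m (v @ w))"
    and finA: "\<And>i::nat. finite (A i)"
    and small: "(\<Sum>i. ennreal (sum m (A i))) < ennreal (m [])"
  shows "\<exists>v. v 0 = [] \<and> (\<forall>j. \<exists>w\<in>ch (v j). v (Suc j) = v j @ w) \<and> (\<forall>j. v j \<in> T) \<and> (\<forall>i j. v j \<notin> A i)"
proof -
  define a where "a i v = sum m {v'\<in>A i. prefix v v'}" for i v
  define P where "P v \<longleftrightarrow> v \<in> T \<and> (\<Sum>i. ennreal (a i v)) < ennreal (m v)" for v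
  have a_nonneg: "0 \<le> a i v" for i v unfolding a_def by (intro sum_nonneg m_nonneg)
  have "P []" using root small by (simp add: P_def a_def)
  have step: "\<exists>v'. P v' \<and> (\<exists>w\<in>ch v. v' = v @ w)" if v: "P v" for v
  proof (rule ccontr)
    assume none: "\<not> ?thesis"
    have heavy: "ennreal (m (v @ w)) \<le> (\<Sum>i. ennreal (a i (v @ w)))" if "w \<in> ch v" for w
    proof (rule ccontr)
      assume "\<not> ?thesis"
      then have "P (v @ w)" using closed[of v w] v that by (simp add: P_def not_le)
      then show False using none that by blast
    qed
    have split: "(\<Sum>w\<in>ch v. a i (v @ w)) \<le> a i v" for i
    proof -
      have "(\<Sum>w\<in>ch v. a i (v @ w)) = sum m (\<Union>w\<in>ch v. {v'\<in>A i. prefix (v @ w) v'})"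
        unfolding a_def
      proof (rule sum.UNION_disjoint[symmetric])
        show "\<forall>w\<in>ch v. \<forall>w'\<in>ch v. w \<noteq> w' \<longrightarrow> {v'\<in>A i. prefix (v @ w) v'} \<inter> {v'\<in>A i. prefix (v @ w') v'} = {}"
        proof (intro ballI impI)
          fix w w' assume w: "w \<in> ch v" "w' \<in> ch v" "w \<noteq> w'"
          then have "length w = length w'" using len by metis
          then show "{v'\<in>A i. prefix (v @ w) v'} \<inter> {v'\<in>A i. prefix (v @ w') v'} = {}"
            using w(3) by (auto simp: prefix_def)
        qed
      qed (use fin finA in auto)
      also have "\<dots> \<le> a i v"
        unfolding a_def using finA m_nonneg by (intro sum_mono2) (auto simp: prefix_def)
      finally show ?thesis .
    qed
    have "ennreal (m v) \<le> ennreal (\<Sum>w\<in>ch v. m (v @ w))" using v m_super by (auto simp: P_def intro: ennreal_leI)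
    also have "\<dots> = (\<Sum>w\<in>ch v. ennreal (m (v @ w)))" using m_nonneg by (simp add: sum_ennreal)
    also have "\<dots> \<le> (\<Sum>w\<in>ch v. \<Sum>i. ennreal (a i (v @ w)))" by (intro sum_mono heavy)
    also have "\<dots> = (\<Sum>i. \<Sum>w\<in>ch v. ennreal (a i (v @ w)))" by (rule suminf_sum[symmetric]) simp
    also have "\<dots> = (\<Sum>i. ennreal (\<Sum>w\<in>ch v. a i (v @ w)))" using a_nonneg by (simp add: sum_ennreal)
    also have "\<dots> \<le> (\<Sum>i. ennreal (a i v))" by (intro suminf_le ennreal_leI split) auto
    finally show False using v unfolding P_def by (meson leD)
  qed
  have avoid: "v \<notin> A i" if v: "P v" for v i
  proof
    assume "v \<in> A i"
    then have "m v \<le> a i v" unfolding a_def using finA m_nonneg by (intro member_le_sum) auto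
    then have "ennreal (m v) \<le> (\<Sum>i\<in>{i}. ennreal (a i v))" by (simp add: ennreal_leI)
    also have "\<dots> \<le> (\<Sum>i. ennreal (a i v))" by (intro sum_le_suminf) auto
    finally show False using v unfolding P_def by (meson leD)
  qed
  obtain v where v: "v 0 = []" "\<And>j. P (v j)" "\<And>j. \<exists>w\<in>ch (v j). v (Suc j) = v j @ w"
  proof -
    have "\<exists>v. \<forall>n. (P (v n) \<and> (n = 0 \<longrightarrow> v n = [])) \<and> (\<exists>w\<in>ch (v n). v (Suc n) = v n @ w)"
      by (rule dependent_nat_choice) (use \<open>P []\<close> step in auto)
    then show ?thesis using that by blast
  qed
  show ?thesis
    by (rule exI[of _ v]) (use v avoid P_def in blast)
qed

lemma ex_stream_through:
  assumes pre: "\<And>j. strict_prefix (v j) (v (Suc j))"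
  shows "\<exists>\<omega>::'a stream. \<forall>j. stake (length (v j)) \<omega> = v j"
proof -
  have mono: "prefix (v i) (v j)" if "i \<le> j" for i j
    using that by (induction rule: dec_induct) (use pre in \<open>auto intro: prefix_order.order_trans prefix_order.less_imp_le\<close>)
  have "length (v j) < length (v (Suc j))" for j using pre by (rule prefix_length_less)
  then have len: "j \<le> length (v j)" for j
    by (induction j) (auto simp: Suc_le_eq intro: le_less_trans)
  define \<omega> where "\<omega> = smap (\<lambda>n. v (Suc n) ! n) nats"
  have "stake (length (v j)) \<omega> = v j" for j
  proof (rule nth_equalityI)
    fix n assume "n < length (stake (length (v j)) \<omega>)"
    then have n: "n < length (v j)" by simp
    have n': "n < length (v (Suc n))" using len[of "Suc n"] by simp
    have "prefix (v j) (v (Suc n)) \<or> prefix (v (Suc n)) (v j)" using mono by (meson nat_le_linear)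
    then have "v (Suc n) ! n = v j ! n" using n n' by (auto simp: prefix_def nth_append)
    then show "stake (length (v j)) \<omega> ! n = v j ! n" using n by (simp add: \<omega>_def)
  qed simp
  then show ?thesis by blast
qed

section \<open>Hausdorff measure\<close>

text \<open>Natural covers are indexed by words; this allows any countable index type and tests the sums on
  finite sets of indices.\<close>

lemma hausdorff_measure_zeroI:
  fixes A :: "'a::metric_space set" and J :: "real \<Rightarrow> real \<Rightarrow> 'j::countable set"
  assumes "\<And>\<delta> \<epsilon>. 0 < \<delta> \<Longrightarrow> 0 < \<epsilon> \<Longrightarrow> A \<subseteq> (\<Union>j\<in>J \<delta> \<epsilon>. V j) \<and>
      (\<forall>j\<in>J \<delta> \<epsilon>. bounded (V j) \<and> diameter (V j) \<le> \<delta>) \<and>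
      (\<forall>F. finite F \<longrightarrow> F \<subseteq> J \<delta> \<epsilon> \<longrightarrow> (\<Sum>j\<in>F. diam_powr s (V j)) \<le> \<epsilon>)"
  shows "hausdorff_measure s A = 0"
proof -
  have nonneg: "0 \<le> diam_powr s U" for U :: "'a set" by (simp add: diam_powr_def)
  have "hausdorff_content \<delta> s A \<le> 0" if \<delta>: "0 < \<delta>" for \<delta>
  proof (rule ennreal_le_epsilon)
    fix \<epsilon> :: real assume \<epsilon>: "0 < \<epsilon>"
    note J = assms[OF \<delta> \<epsilon>]
    let ?J = "J \<delta> \<epsilon>"
    define U where "U n = (if n \<in> to_nat ` ?J then V (from_nat n) else {})" for n
    have "A \<subseteq> (\<Union>n. U n)"
    proof
      fix x assume "x \<in> A"
      then obtain j where "j \<in> ?J" "x \<in> V j" using J by blast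
      then have "x \<in> U (to_nat j)" by (simp add: U_def)
      then show "x \<in> (\<Union>n. U n)" by blast
    qed
    moreover have "\<forall>n. bounded (U n) \<and> diameter (U n) \<le> \<delta>" using J \<delta> by (auto simp: U_def)
    ultimately have "hausdorff_content \<delta> s A \<le> (\<Sum>n. ennreal (diam_powr s (U n)))"
      unfolding hausdorff_content_def by (intro INF_lower) simp
    also have "\<dots> \<le> ennreal \<epsilon>"
    proof (rule suminf_le_const)
      fix n
      let ?F = "{j\<in>?J. to_nat j < n}"
      have finF: "finite ?F"
        by (rule finite_imageD[of to_nat]) (auto intro: finite_subset[of _ "{..<n}"] inj_onI)
      have "(\<Sum>i<n. ennreal (diam_powr s (U i))) = ennreal (\<Sum>i<n. diam_powr s (U i))"
        by (rule sum_ennreal) (rule nonneg)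
      also have "(\<Sum>i<n. diam_powr s (U i)) = (\<Sum>i\<in>to_nat ` ?F. diam_powr s (U i))"
        by (rule sum.mono_neutral_right) (auto simp: U_def diam_powr_def)
      also have "\<dots> = (\<Sum>j\<in>?F. diam_powr s (V j))"
        by (subst sum.reindex) (auto simp: U_def intro!: sum.cong)
      also have "ennreal \<dots> \<le> ennreal \<epsilon>" using J finF by (intro ennreal_leI) blast
      finally show "(\<Sum>i<n. ennreal (diam_powr s (U i))) \<le> ennreal \<epsilon>" .
    qed simp
    finally show "hausdorff_content \<delta> s A \<le> 0 + ennreal \<epsilon>" by simp
  qed
  then have "hausdorff_measure s A \<le> 0" unfolding hausdorff_measure_def by (intro SUP_least) simp
  then show ?thesis by simp
qed

lemma hausdorff_measure_zeroD:
  assumes "hausdorff_measure s A = 0" and \<eta>: "\<eta> > 0"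
  obtains U :: "nat \<Rightarrow> 'a::metric_space set" where "A \<subseteq> (\<Union>i. U i)" "\<And>i. bounded (U i)"
    "(\<Sum>i. ennreal (diam_powr s (U i))) < ennreal \<eta>"
proof -
  have "hausdorff_content 1 s A \<le> hausdorff_measure s A"
    unfolding hausdorff_measure_def by (rule SUP_upper) simp
  then have "hausdorff_content 1 s A < ennreal \<eta>" using assms by (simp add: order_le_less_trans)
  then show ?thesis unfolding hausdorff_content_def INF_less_iff using that by blast
qed

lemma hausdorff_dim_le: "hausdorff_measure s A = 0 \<Longrightarrow> 0 \<le> s \<Longrightarrow> hausdorff_dim A \<le> ereal s"
  unfolding hausdorff_dim_def by (rule INF_lower) simp

lemma hausdorff_measure_empty: "hausdorff_measure s ({} :: 'a::metric_space set) = 0"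
  by (rule hausdorff_measure_zeroI[where J="\<lambda>_ _. {}::nat set" and V="\<lambda>_. {}"]) auto

lemma hausdorff_measure_0_eq_0D:
  fixes A :: "'a::metric_space set"
  assumes "hausdorff_measure 0 A = 0"
  shows "A = {}"
proof -
  obtain U :: "nat \<Rightarrow> 'a set" where U: "A \<subseteq> (\<Union>i. U i)" "(\<Sum>i. ennreal (diam_powr 0 (U i))) < ennreal 1"
    using hausdorff_measure_zeroD[OF assms, of 1] by (metis zero_less_one)
  have "U i = {}" for i
  proof (rule ccontr)
    assume "U i \<noteq> {}"
    then have "ennreal 1 = (\<Sum>i\<in>{i}. ennreal (diam_powr 0 (U i)))" by (simp add: diam_powr_def)
    also have "\<dots> \<le> (\<Sum>i. ennreal (diam_powr 0 (U i)))" by (intro sum_le_suminf) auto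
    finally show False using U(2) by (meson leD)
  qed
  then show ?thesis using U(1) by blast
qed

section \<open>Conformal derivatives on a set with the cone property\<close>

lemma onorm_similarity:
  fixes f :: "'a::euclidean_space \<Rightarrow> 'b::real_normed_vector"
  assumes "k \<ge> 0" and f: "\<And>v. norm (f v) = k * norm v"
  shows "onorm f = k"
  unfolding onorm_def
proof (rule cSup_eq_maximum)
  obtain b :: 'a where "b \<in> Basis" using nonempty_Basis by blast
  then have "norm (f b) / norm b = k" by (simp add: f)
  then show "k \<in> range (\<lambda>v. norm (f v) / norm v)" by (intro range_eqI[of _ _ b]) simp
  fix q assume "q \<in> range (\<lambda>v. norm (f v) / norm v)"
  then show "q \<le> k" using assms(1) by (auto simp: f)
qed

definition similarity_at :: "'a::euclidean_space set \<Rightarrow> ('a \<Rightarrow> 'a) \<Rightarrow> 'a \<Rightarrow> real \<Rightarrow> bool" where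
  "similarity_at X g x k \<longleftrightarrow>
     k > 0 \<and> (\<exists>T. orthogonal_transformation T \<and> (g has_derivative (\<lambda>v. k *\<^sub>R T v)) (at x within X))"

lemma similarity_at_compose:
  assumes g: "similarity_at X g x k2" and f: "similarity_at X f (g x) k1" and "g ` X \<subseteq> X"
  shows "similarity_at X (f \<circ> g) x (k1 * k2)"
proof -
  obtain T1 where T1: "orthogonal_transformation T1" "(f has_derivative (\<lambda>v. k1 *\<^sub>R T1 v)) (at (g x) within X)"
    using f by (auto simp: similarity_at_def)
  obtain T2 where T2: "orthogonal_transformation T2" "(g has_derivative (\<lambda>v. k2 *\<^sub>R T2 v)) (at x within X)"
    using g by (auto simp: similarity_at_def)
  have "(f \<circ> g has_derivative (\<lambda>v. k1 *\<^sub>R T1 v) \<circ> (\<lambda>v. k2 *\<^sub>R T2 v)) (at x within X)"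
    by (rule diff_chain_within[OF T2(2)]) (rule has_derivative_subset[OF T1(2) assms(3)])
  moreover have "(\<lambda>v. k1 *\<^sub>R T1 v) \<circ> (\<lambda>v. k2 *\<^sub>R T2 v) = (\<lambda>v. (k1 * k2) *\<^sub>R (T1 \<circ> T2) v)"
    using T1(1) by (auto simp: orthogonal_transformation_def linear_cmul)
  moreover have "orthogonal_transformation (T1 \<circ> T2)"
    using T1(1) T2(1) by (rule orthogonal_transformation_compose)
  ultimately show ?thesis using f g unfolding similarity_at_def by auto
qed

text \<open>The form in which the cone property is used: every point of \<open>X\<close> sees, along segments inside \<open>X\<close>, a ball of
  radius \<open>\<rho>\<close> in the interior of \<open>X\<close> at distance at most \<open>R\<close>.  This provides enough directions to make
  derivatives within \<open>X\<close> unique and enough segments for the mean value inequality.\<close>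

definition roomy :: "'a::euclidean_space set \<Rightarrow> real \<Rightarrow> real \<Rightarrow> bool" where
  "roomy X \<rho> R \<longleftrightarrow> (\<forall>x\<in>X. \<exists>p. ball p \<rho> \<subseteq> interior X \<and> (\<forall>y\<in>ball p \<rho>. dist x y \<le> R \<and> closed_segment x y \<subseteq> X))"

text \<open>Take the ball around the point of the axis at half the altitude, with a radius so small that the ball
  stays inside the cone; cones are star-shaped with respect to their vertex.\<close>

lemma roomy_if_cones:
  fixes X :: "'a::euclidean_space set"
  assumes \<gamma>: "0 < \<gamma>" "\<gamma> < pi / 2" and l: "0 < l"
    and cones: "\<forall>x\<in>X. \<exists>u. norm u = 1 \<and> open_cone x u \<gamma> l \<subseteq> interior X"
  shows "\<exists>\<rho>>0. roomy X \<rho> l"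
proof -
  define \<eta> where "\<eta> = cos (\<gamma> / 2)"
  have \<eta>: "0 < \<eta>" "\<eta> < 1"
  proof -
    show "0 < \<eta>" unfolding \<eta>_def using \<gamma> by (intro cos_gt_zero) auto
    have "cos (\<gamma> / 2) < cos 0" by (rule cos_monotone_0_pi) (use \<gamma> in auto)
    then show "\<eta> < 1" by (simp add: \<eta>_def)
  qed
  define \<rho> where "\<rho> = l / 2 * (1 - \<eta>) / 2"
  have "l * \<eta> > 0" "l * \<eta> < l" using \<eta> l by simp_all
  moreover have "\<rho> = l / 4 - l * \<eta> / 4" by (simp add: \<rho>_def field_simps)
  ultimately have \<rho>: "0 < \<rho>" "\<rho> < l / 2" by linarith+
  have key: "\<eta> * (l / 2 + \<rho>) < l / 2 - \<rho>"
  proof -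
    have "\<rho> * (1 + \<eta>) < \<rho> * 2" using \<rho> \<eta> by (intro mult_strict_left_mono) auto
    also have "\<dots> = l / 2 * (1 - \<eta>)" by (simp add: \<rho>_def)
    finally show ?thesis by (simp add: algebra_simps)
  qed
  have "roomy X \<rho> l" unfolding roomy_def
  proof
    fix x assume x: "x \<in> X"
    obtain u where u: "norm u = 1" and cone: "open_cone x u \<gamma> l \<subseteq> interior X" using cones x by blast
    define p where "p = x + (l / 2) *\<^sub>R u"
    have in_cone: "x + t *\<^sub>R (y - x) \<in> open_cone x u \<gamma> l" and near: "dist x y \<le> l"
      if y: "y \<in> ball p \<rho>" and t: "0 < t" "t \<le> 1" for y t
    proof -
      have yp: "norm (y - p) < \<rho>" using y by (simp add: dist_norm norm_minus_commute)
      have decomp: "y - x = (l / 2) *\<^sub>R u + (y - p)" by (simp add: p_def)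
      have nrm: "norm (y - x) < l / 2 + \<rho>"
        using norm_triangle_ineq[of "(l / 2) *\<^sub>R u" "y - p"] yp u l unfolding decomp by simp
      have ip: "\<bar>(y - p) \<bullet> u\<bar> < \<rho>"
        using Cauchy_Schwarz_ineq2[of "y - p" u] yp u by simp
      have dot: "(y - x) \<bullet> u = l / 2 + (y - p) \<bullet> u"
        unfolding decomp using u by (simp add: inner_add_left dot_square_norm)
      have up: "(y - x) \<bullet> u < l" using dot ip \<rho> by linarith
      have low: "\<eta> * norm (y - x) < (y - x) \<bullet> u"
      proof -
        have "\<eta> * norm (y - x) \<le> \<eta> * (l / 2 + \<rho>)" using nrm \<eta> by (intro mult_left_mono) auto
        then show ?thesis using key dot ip by linarith
      qed
      have "t * (\<eta> * norm (y - x)) < t * ((y - x) \<bullet> u)" using low t by simp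
      moreover have "t * ((y - x) \<bullet> u) < l"
      proof -
        have "0 \<le> \<eta> * norm (y - x)" using \<eta> by simp
        then have "0 < (y - x) \<bullet> u" using low by linarith
        then have "t * ((y - x) \<bullet> u) \<le> 1 * ((y - x) \<bullet> u)" using t by (intro mult_right_mono) auto
        then show ?thesis using up by simp
      qed
      ultimately show "x + t *\<^sub>R (y - x) \<in> open_cone x u \<gamma> l"
        using t by (simp add: open_cone_def \<eta>_def[symmetric] ac_simps)
      show "dist x y \<le> l" using nrm \<rho> by (simp add: dist_norm norm_minus_commute)
    qed
    have "ball p \<rho> \<subseteq> interior X"
    proof
      fix y assume "y \<in> ball p \<rho>"
      from in_cone[OF this, of 1] cone show "y \<in> interior X" by auto
    qed
    moreover have "closed_segment x y \<subseteq> X" if y: "y \<in> ball p \<rho>" for y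
    proof
      fix q assume "q \<in> closed_segment x y"
      then obtain t where t: "0 \<le> t" "t \<le> 1" "q = x + t *\<^sub>R (y - x)"
        by (auto simp: in_segment algebra_simps)
      show "q \<in> X"
      proof (cases "t = 0")
        case False
        then show ?thesis using in_cone[OF y, of t] t cone interior_subset by fastforce
      qed (use t x in auto)
    qed
    moreover have "dist x y \<le> l" if "y \<in> ball p \<rho>" for y using near[OF that, of 1] by simp
    ultimately show "\<exists>p. ball p \<rho> \<subseteq> interior X \<and> (\<forall>y\<in>ball p \<rho>. dist x y \<le> l \<and> closed_segment x y \<subseteq> X)"
      by blast
  qed
  then show ?thesis using \<rho> by blast
qed

lemma norm_fraction_less_1:
  fixes v :: "'a::real_normed_vector"
  shows "norm v / (2 * (1 + norm v)) < 1"
proof -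
  have "norm v < 2 * (1 + norm v)" using norm_ge_zero[of v] by (simp only: distrib_left mult_1_right)
  moreover have "0 < 2 * (1 + norm v)" using norm_ge_zero[of v] by (simp only: distrib_left mult_1_right)
  ultimately show ?thesis by (simp only: divide_less_eq_1_pos)
qed

lemma derivative_direction_approx:
  assumes f: "(g has_derivative f) (at x within X)" and v: "closed_segment x (x + v) \<subseteq> X" and e: "e > 0"
  obtains t where "0 < t" "t \<le> 1" "x + t *\<^sub>R v \<in> X" "norm (g (x + t *\<^sub>R v) - g x - t *\<^sub>R f v) \<le> e * norm (t *\<^sub>R v)"
    "\<And>t'. 0 < t' \<Longrightarrow> t' \<le> t \<Longrightarrow> norm (g (x + t' *\<^sub>R v) - g x - t' *\<^sub>R f v) \<le> e * norm (t' *\<^sub>R v)"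
proof -
  have lin: "linear f" using f has_derivative_linear by blast
  obtain d where d: "d > 0"
    "\<And>y. y \<in> X \<Longrightarrow> norm (y - x) < d \<Longrightarrow> norm (g y - g x - f (y - x)) \<le> e * norm (y - x)"
    using f e unfolding has_derivative_within_alt by blast
  define t where "t = min 1 (d / (2 * (1 + norm v)))"
  have t: "0 < t" "t \<le> 1" using d by (auto simp: t_def add_pos_nonneg)
  have "t * norm v < d"
  proof -
    have "t * norm v \<le> d / (2 * (1 + norm v)) * norm v" by (intro mult_right_mono) (auto simp: t_def)
    also have "\<dots> = d * (norm v / (2 * (1 + norm v)))" by simp
    also have "\<dots> < d * 1" using d by (intro mult_strict_left_mono norm_fraction_less_1)
    finally show ?thesis by simp
  qed
  then have small: "norm (t' *\<^sub>R v) < d" if "0 < t'" "t' \<le> t" for t'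
    using that mult_right_mono[OF that(2), of "norm v"] by simp
  have inX: "x + t' *\<^sub>R v \<in> X" if "0 < t'" "t' \<le> t" for t'
  proof -
    have "x + t' *\<^sub>R v \<in> closed_segment x (x + v)"
      using that t by (auto simp: in_segment intro!: exI[of _ t'] simp: algebra_simps)
    then show ?thesis using v by blast
  qed
  have approx: "norm (g (x + t' *\<^sub>R v) - g x - t' *\<^sub>R f v) \<le> e * norm (t' *\<^sub>R v)" if "0 < t'" "t' \<le> t" for t'
    using d(2)[OF inX[OF that]] small[OF that] by (simp add: linear_cmul[OF lin])
  show ?thesis using that[of t] t inX approx by blast
qed

text \<open>Along a segment of \<open>X\<close> that starts at \<open>x\<close> the same difference quotients approximate both values.\<close>

lemma derivative_within_unique_direction:
  assumes f1: "(g has_derivative f1) (at x within X)" and f2: "(g has_derivative f2) (at x within X)"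
    and v: "closed_segment x (x + v) \<subseteq> X"
  shows "f1 v = f2 v"
proof -
  have "norm (f1 v - f2 v) \<le> 0 + e" if e: "e > 0" for e
  proof -
    define e' where "e' = e / (2 * (1 + norm v))"
    have e': "e' > 0" using e by (simp add: e'_def add_pos_nonneg)
    obtain t1 where t1: "0 < t1" "\<And>t'. 0 < t' \<Longrightarrow> t' \<le> t1 \<Longrightarrow> norm (g (x + t' *\<^sub>R v) - g x - t' *\<^sub>R f1 v) \<le> e' * norm (t' *\<^sub>R v)"
      using derivative_direction_approx[OF f1 v e'] by metis
    obtain t2 where t2: "0 < t2" "\<And>t'. 0 < t' \<Longrightarrow> t' \<le> t2 \<Longrightarrow> norm (g (x + t' *\<^sub>R v) - g x - t' *\<^sub>R f2 v) \<le> e' * norm (t' *\<^sub>R v)"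
      using derivative_direction_approx[OF f2 v e'] by metis
    define t where "t = min t1 t2"
    have t: "0 < t" using t1 t2 by (simp add: t_def)
    have "norm (t *\<^sub>R f1 v - t *\<^sub>R f2 v) \<le> 2 * (e' * norm (t *\<^sub>R v))"
      using t1(2)[of t] t2(2)[of t] t
        norm_triangle_ineq4[of "g (x + t *\<^sub>R v) - g x - t *\<^sub>R f2 v" "g (x + t *\<^sub>R v) - g x - t *\<^sub>R f1 v"]
      by (simp add: t_def)
    then have "t * norm (f1 v - f2 v) \<le> t * (2 * (e' * norm v))"
      using t by (simp add: real_vector.scale_right_diff_distrib[symmetric] del: real_vector.scale_right_diff_distrib)
    then have "norm (f1 v - f2 v) \<le> 2 * e' * norm v" using t by simp
    also have "\<dots> \<le> e" unfolding e'_def using e by (simp add: divide_le_eq add_pos_nonneg)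
    finally show ?thesis by simp
  qed
  then have "norm (f1 v - f2 v) \<le> 0" by (rule field_le_epsilon)
  then show ?thesis by simp
qed

text \<open>The directions towards the points of the ball form an open set, on which two linear maps agree only if
  they are equal.\<close>

lemma roomy_derivative_unique:
  fixes X :: "'a::euclidean_space set"
  assumes room: "roomy X \<rho> R" "\<rho> > 0" "x \<in> X"
    and f1: "(g has_derivative f1) (at x within X)" and f2: "(g has_derivative f2) (at x within X)"
  shows "f1 = f2"
proof
  fix w :: 'a
  obtain p where p: "\<And>y. y \<in> ball p \<rho> \<Longrightarrow> closed_segment x y \<subseteq> X" using room unfolding roomy_def by blast
  have lin: "linear f1" "linear f2" using f1 f2 has_derivative_linear by blast+
  define \<epsilon> where "\<epsilon> = \<rho> / (2 * (1 + norm w))"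
  have \<epsilon>: "\<epsilon> > 0" using room by (simp add: \<epsilon>_def add_pos_nonneg)
  have "\<epsilon> * norm w = \<rho> * (norm w / (2 * (1 + norm w)))" by (simp add: \<epsilon>_def)
  also have "\<dots> < \<rho> * 1" using room by (intro mult_strict_left_mono norm_fraction_less_1)
  finally have "p + \<epsilon> *\<^sub>R w \<in> ball p \<rho>" using \<epsilon> by (simp add: dist_norm)
  moreover have "p \<in> ball p \<rho>" using room by simp
  ultimately have "closed_segment x (x + (p - x)) \<subseteq> X" "closed_segment x (x + (p - x + \<epsilon> *\<^sub>R w)) \<subseteq> X"
    using p by (simp_all add: algebra_simps)
  from this[THEN derivative_within_unique_direction[OF f1 f2]]
  have "f1 (\<epsilon> *\<^sub>R w) = f2 (\<epsilon> *\<^sub>R w)" by (simp add: linear_add[OF lin(1)] linear_add[OF lin(2)])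
  then show "f1 w = f2 w" using \<epsilon> by (simp add: linear_cmul[OF lin(1)] linear_cmul[OF lin(2)])
qed

lemma similarity_at_norms:
  assumes room: "roomy X \<rho> R" "\<rho> > 0" "x \<in> X" and sim: "similarity_at X g x k"
  shows "deriv_norm X g x = k" "onorm (inv (deriv_in X g x)) = 1 / k"
proof -
  obtain T where T: "orthogonal_transformation T" "(g has_derivative (\<lambda>v. k *\<^sub>R T v)) (at x within X)" and k: "k > 0"
    using sim by (auto simp: similarity_at_def)
  have "g differentiable (at x within X)" using T(2) differentiable_def by blast
  then have D: "deriv_in X g x = (\<lambda>v. k *\<^sub>R T v)"
    unfolding deriv_in_def frechet_derivative_works
    by (rule roomy_derivative_unique[OF room _ T(2)])
  have nrm: "norm (k *\<^sub>R T v) = k * norm v" for v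
    using T(1) k by (simp add: orthogonal_transformation_norm)
  show "deriv_norm X g x = k" unfolding deriv_norm_def D using k nrm by (intro onorm_similarity) auto
  have "surj (\<lambda>v. k *\<^sub>R T v)"
  proof (rule surjI)
    fix y show "k *\<^sub>R T (inv T ((1 / k) *\<^sub>R y)) = y"
      using orthogonal_transformation_surj[OF T(1)] k by (simp add: surj_f_inv_f)
  qed
  then have "norm (inv (\<lambda>v. k *\<^sub>R T v) v) = 1 / k * norm v" for v
    using nrm[of "inv (\<lambda>v. k *\<^sub>R T v) v"] k surj_f_inv_f[of "\<lambda>v. k *\<^sub>R T v" v]
    by (simp add: field_simps)
  then show "onorm (inv (deriv_in X g x)) = 1 / k" unfolding D using k by (intro onorm_similarity) auto
qed

lemma similarity_at_le_lipschitz: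
  assumes room: "roomy X \<rho> R" "\<rho> > 0" "x \<in> X" and sim: "similarity_at X g x k" and lip: "c-lipschitz_on X g"
  shows "k \<le> c"
proof -
  obtain T where T: "orthogonal_transformation T" "(g has_derivative (\<lambda>v. k *\<^sub>R T v)) (at x within X)" and k: "k > 0"
    using sim by (auto simp: similarity_at_def)
  obtain p where p: "\<And>y. y \<in> ball p \<rho> \<Longrightarrow> closed_segment x y \<subseteq> X" using room unfolding roomy_def by blast
  obtain q where q: "q \<in> ball p \<rho>" "q \<noteq> x"
  proof (cases "p = x")
    case True
    obtain b :: 'a where b: "b \<in> Basis" using nonempty_Basis by blast
    have "norm ((\<rho> / 2) *\<^sub>R b) = \<rho> / 2" using b room by simp
    then have "p + (\<rho> / 2) *\<^sub>R b \<in> ball p \<rho>" "p + (\<rho> / 2) *\<^sub>R b \<noteq> x"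
      using True room by (auto simp: dist_norm)
    then show ?thesis using that by blast
  next
    case False
    then show ?thesis using that[of p] room by simp
  qed
  define v where "v = q - x"
  have v: "closed_segment x (x + v) \<subseteq> X" "norm v > 0" using p[OF q(1)] q by (auto simp: v_def)
  have nrm: "norm (k *\<^sub>R T v) = k * norm v" for v
    using T(1) k by (simp add: orthogonal_transformation_norm)
  have "k \<le> c + e" if e: "e > 0" for e
  proof -
    obtain t where t: "0 < t" "x + t *\<^sub>R v \<in> X"
      "norm (g (x + t *\<^sub>R v) - g x - t *\<^sub>R (k *\<^sub>R T v)) \<le> e * norm (t *\<^sub>R v)"
      using derivative_direction_approx[OF T(2) v(1) e] by metis
    have "dist (g (x + t *\<^sub>R v)) (g x) \<le> c * dist (x + t *\<^sub>R v) x"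
      by (rule lipschitz_onD[OF lip]) (use t room in auto)
    then have "norm (g (x + t *\<^sub>R v) - g x) \<le> c * norm (t *\<^sub>R v)" by (simp add: dist_norm)
    moreover have "norm A \<le> norm q + norm (q - A)" for q A :: 'a
      using norm_triangle_ineq4[of q "q - A"] by simp
    ultimately have "norm (t *\<^sub>R (k *\<^sub>R T v)) \<le> c * norm (t *\<^sub>R v) + e * norm (t *\<^sub>R v)"
      using t(3) by (meson add_mono order_trans)
    moreover have "norm (t *\<^sub>R (k *\<^sub>R T v)) = t * norm v * k"
      unfolding norm_scaleR[of t] nrm using t by simp
    ultimately have "t * norm v * k \<le> t * norm v * (c + e)" using t by (simp add: algebra_simps)
    then show ?thesis using t v by simp
  qed
  then show ?thesis by (rule field_le_epsilon)
qed

text \<open>The consequences of the axioms of a conformal system that are needed below.  The Hoelder condition on the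
  derivatives enters in logarithmic form, which is additive along compositions.\<close>

locale conformal_system =
  fixes X :: "'a::euclidean_space set" and I :: "nat set" and \<phi> :: "nat \<Rightarrow> 'a \<Rightarrow> 'a"
    and c \<rho> R L a :: real
  assumes compact_X: "compact X" and X_nonempty: "X \<noteq> {}" and I_nonempty: "I \<noteq> {}"
    and maps_into: "e \<in> I \<Longrightarrow> \<phi> e ` X \<subseteq> X" and inj: "e \<in> I \<Longrightarrow> inj_on (\<phi> e) X"
    and c: "0 < c" "c < 1" and lipschitz: "e \<in> I \<Longrightarrow> c-lipschitz_on X (\<phi> e)"
    and open_set: "e \<in> I \<Longrightarrow> e' \<in> I \<Longrightarrow> e \<noteq> e' \<Longrightarrow> \<phi> e ` interior X \<inter> \<phi> e' ` interior X = {}"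
    and \<rho>: "\<rho> > 0" and roomy_X: "roomy X \<rho> R"
    and similarity: "e \<in> I \<Longrightarrow> x \<in> X \<Longrightarrow> \<exists>k. similarity_at X (\<phi> e) x k"
    and L: "L \<ge> 0" and a: "a > 0"
    and ln_holder: "e \<in> I \<Longrightarrow> x \<in> X \<Longrightarrow> y \<in> X \<Longrightarrow>
      \<bar>ln (deriv_norm X (\<phi> e) x) - ln (deriv_norm X (\<phi> e) y)\<bar> \<le> L * dist x y powr a"

lemma ln_diff_le_of_relative_bound:
  fixes x y d :: real
  assumes "x > 0" "y > 0" "\<bar>x - y\<bar> \<le> d * y" "d \<ge> 0"
  shows "ln x - ln y \<le> d"
proof -
  have "x \<le> y * (1 + d)" using assms by (simp add: algebra_simps abs_le_iff)
  then have "ln x \<le> ln (y * (1 + d))" using assms by (subst ln_le_cancel_iff) auto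
  also have "\<dots> = ln y + ln (1 + d)" using assms by (intro ln_mult_pos) auto
  also have "\<dots> \<le> ln y + d" using assms ln_add_one_self_le_self[of d] by simp
  finally show ?thesis by simp
qed

text \<open>The norm of the derivative is continuous and positive on the compact set \<open>X\<close>.  Therefore the supremum of
  the norms of the inverse derivatives is a genuine supremum, its reciprocal is a lower bound of
  the norm of the derivative, and the Hoelder condition bounds the relative oscillation of that norm.\<close>

theorem CIFS_imp_conformal_system:
  assumes "compact X" "X \<noteq> {}" and sys: "CIFS X I \<phi>"
  shows "\<exists>c \<rho> R L a. conformal_system X I \<phi> c \<rho> R L a"
proof -
  have card: "infinite I \<or> 2 \<le> card I" and maps: "\<forall>e\<in>I. \<phi> e ` X \<subseteq> X \<and> inj_on (\<phi> e) X"
    and lip: "\<exists>c<1. \<forall>e\<in>I. c-lipschitz_on X (\<phi> e)"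
    and osc: "\<forall>a\<in>I. \<forall>b\<in>I. a \<noteq> b \<longrightarrow> \<phi> a ` interior X \<inter> \<phi> b ` interior X = {}"
    and ext: "\<exists>W. open W \<and> connected W \<and> X \<subseteq> W \<and>
        (\<forall>e\<in>I. \<exists>g. (\<forall>x\<in>X. g x = \<phi> e x) \<and> C1_diffeo_into W g \<and> conformal_on W g)"
    and cone: "\<exists>\<gamma>>0. \<exists>l>0. \<gamma> < pi / 2 \<and>
        (\<forall>x\<in>X. \<exists>u. norm u = 1 \<and> open_cone x u \<gamma> l \<subseteq> interior X)"
    and hol: "\<exists>L\<ge>1. \<exists>\<alpha>>0. \<forall>e\<in>I. \<forall>x\<in>X. \<forall>y\<in>X.
        \<bar>deriv_norm X (\<phi> e) y - deriv_norm X (\<phi> e) x\<bar>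
          \<le> L / sup_inverse_deriv_norm X (\<phi> e) * norm (y - x) powr \<alpha>"
    using sys unfolding CIFS_def by blast+
  obtain \<gamma> l where "\<gamma> > 0" "l > 0" "\<gamma> < pi / 2"
    "\<forall>x\<in>X. \<exists>u. norm u = 1 \<and> open_cone x u \<gamma> l \<subseteq> interior X" using cone by blast
  then obtain \<rho> where \<rho>: "\<rho> > 0" and room: "roomy X \<rho> l" using roomy_if_cones by blast
  obtain c0 where c0: "c0 < 1" "\<forall>e\<in>I. c0-lipschitz_on X (\<phi> e)" using lip by blast
  define c where "c = max c0 (1 / 2)"
  have lip_c: "c-lipschitz_on X (\<phi> e)" if "e \<in> I" for e
    using c0 that by (auto simp: c_def intro: lipschitz_on_mono)
  obtain W where W: "open W" "X \<subseteq> W"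
    "\<forall>e\<in>I. \<exists>g. (\<forall>x\<in>X. g x = \<phi> e x) \<and> C1_diffeo_into W g \<and> conformal_on W g" using ext by blast
  have deriv: "(\<exists>k. similarity_at X (\<phi> e) x k) \<and>
      (\<exists>G. continuous_on X G \<and> (\<forall>x\<in>X. deriv_norm X (\<phi> e) x = norm (G x :: 'a \<Rightarrow>\<^sub>L 'a)))" if e: "e \<in> I" and x: "x \<in> X" for e x
  proof -
    obtain g where g: "\<forall>x\<in>X. g x = \<phi> e x" "C1_diffeo_into W g" "conformal_on W g" using W(3) e by blast
    obtain G :: "'a \<Rightarrow> 'a \<Rightarrow>\<^sub>L 'a" where G: "continuous_on W G"
      "\<And>x. x \<in> W \<Longrightarrow> (g has_derivative blinfun_apply (G x)) (at x)"
      using g(2) unfolding C1_diffeo_into_def C1_on_def by blast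
    have transfer: "(\<phi> e has_derivative f) (at y within X)" if "(g has_derivative f) (at y)" "y \<in> X" for f y
      using has_derivative_at_withinI[OF that(1), of X] that(2) g(1)
      by (auto intro: has_derivative_transform_within[where d=1])
    have sim: "\<exists>k. similarity_at X (\<phi> e) y k" if y: "y \<in> X" for y
    proof -
      obtain k T where "k > 0" "orthogonal_transformation T" "(g has_derivative (\<lambda>v. k *\<^sub>R T v)) (at y)"
        using g(3) W(2) y unfolding conformal_on_def by blast
      then show ?thesis unfolding similarity_at_def using transfer[OF _ y] by blast
    qed
    have "deriv_norm X (\<phi> e) y = norm (G y)" if y: "y \<in> X" for y
    proof -
      have *: "(\<phi> e has_derivative blinfun_apply (G y)) (at y within X)" using transfer[OF G(2)] W y by blast
      have "\<phi> e differentiable (at y within X)" using * differentiable_def by blast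
      then have "deriv_in X (\<phi> e) y = blinfun_apply (G y)"
        unfolding deriv_in_def frechet_derivative_works
        by (rule roomy_derivative_unique[OF room \<rho> y _ *])
      then show ?thesis by (simp add: deriv_norm_def norm_blinfun.rep_eq)
    qed
    moreover have "continuous_on X G" using G(1) W(2) continuous_on_subset by blast
    ultimately show ?thesis using sim x by blast
  qed
  have dn_pos: "deriv_norm X (\<phi> e) x > 0" and inv_norm: "onorm (inv (deriv_in X (\<phi> e) x)) = 1 / deriv_norm X (\<phi> e) x"
    if ex: "e \<in> I" "x \<in> X" for e x
  proof -
    obtain k where k: "similarity_at X (\<phi> e) x k" using deriv[OF ex] by blast
    then show "deriv_norm X (\<phi> e) x > 0" "onorm (inv (deriv_in X (\<phi> e) x)) = 1 / deriv_norm X (\<phi> e) x"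
      using similarity_at_norms[OF room \<rho> ex(2) k] by (auto simp: similarity_at_def)
  qed
  have inv_sup: "1 / sup_inverse_deriv_norm X (\<phi> e) \<le> deriv_norm X (\<phi> e) x"
      "0 \<le> 1 / sup_inverse_deriv_norm X (\<phi> e)" if ex: "e \<in> I" "x \<in> X" for e x
  proof -
    obtain G where G: "continuous_on X G" "\<And>x. x \<in> X \<Longrightarrow> deriv_norm X (\<phi> e) x = norm (G x :: 'a \<Rightarrow>\<^sub>L 'a)"
      using deriv[OF ex] by blast
    have "continuous_on X (\<lambda>x. 1 / norm (G x))"
      by (intro continuous_intros G) (use G(2) dn_pos[OF ex(1)] in force)
    then have "bounded ((\<lambda>x. 1 / norm (G x)) ` X)"
      using assms(1) compact_continuous_image compact_imp_bounded by blast
    moreover have "(\<lambda>x. 1 / norm (G x)) ` X = (\<lambda>x. onorm (inv (deriv_in X (\<phi> e) x))) ` X"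
      by (rule image_cong) (simp_all add: inv_norm ex G)
    ultimately have bdd: "bdd_above ((\<lambda>x. onorm (inv (deriv_in X (\<phi> e) x))) ` X)"
      by (simp add: bounded_imp_bdd_above)
    have *: "1 / deriv_norm X (\<phi> e) x \<le> sup_inverse_deriv_norm X (\<phi> e)"
      unfolding sup_inverse_deriv_norm_def inv_norm[OF ex, symmetric] by (rule cSUP_upper[OF ex(2) bdd])
    moreover have "0 < 1 / deriv_norm X (\<phi> e) x" using dn_pos[OF ex] by simp
    ultimately have "0 < sup_inverse_deriv_norm X (\<phi> e)" by linarith
    then show "1 / sup_inverse_deriv_norm X (\<phi> e) \<le> deriv_norm X (\<phi> e) x"
      "0 \<le> 1 / sup_inverse_deriv_norm X (\<phi> e)"
      using * dn_pos[OF ex] by (simp_all add: divide_le_eq mult.commute)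
  qed
  obtain L \<alpha> where L: "L \<ge> 1" "\<alpha> > 0" and hol': "\<And>e x y. e \<in> I \<Longrightarrow> x \<in> X \<Longrightarrow> y \<in> X \<Longrightarrow>
        \<bar>deriv_norm X (\<phi> e) y - deriv_norm X (\<phi> e) x\<bar>
          \<le> L / sup_inverse_deriv_norm X (\<phi> e) * norm (y - x) powr \<alpha>" using hol by metis
  have one_sided: "ln (deriv_norm X (\<phi> e) y) - ln (deriv_norm X (\<phi> e) x) \<le> L * dist x y powr \<alpha>"
    if e: "e \<in> I" and x: "x \<in> X" and y: "y \<in> X" for e x y
  proof (rule ln_diff_le_of_relative_bound)
    have "\<bar>deriv_norm X (\<phi> e) y - deriv_norm X (\<phi> e) x\<bar>
        \<le> (L * dist x y powr \<alpha>) * (1 / sup_inverse_deriv_norm X (\<phi> e))"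
      using hol'[OF e x y] by (simp add: dist_norm norm_minus_commute)
    also have "\<dots> \<le> (L * dist x y powr \<alpha>) * deriv_norm X (\<phi> e) x"
      using inv_sup[OF e x] L by (intro mult_left_mono) auto
    finally show "\<bar>deriv_norm X (\<phi> e) y - deriv_norm X (\<phi> e) x\<bar> \<le> \<dots>" .
  qed (use L dn_pos e x y in auto)
  have "conformal_system X I \<phi> c \<rho> l L \<alpha>"
  proof
    show "I \<noteq> {}" using card by auto
    show "\<exists>k. similarity_at X (\<phi> e) x k" if "e \<in> I" "x \<in> X" for e x using deriv[OF that] by blast
    show "\<bar>ln (deriv_norm X (\<phi> e) x) - ln (deriv_norm X (\<phi> e) y)\<bar> \<le> L * dist x y powr \<alpha>"
      if "e \<in> I" "x \<in> X" "y \<in> X" for e x y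
      using one_sided[of e x y] one_sided[of e y x] that by (auto simp: abs_le_iff dist_commute)
  qed (use assms maps osc c0 lip_c room \<rho> L in \<open>auto simp: c_def\<close>)
  then show ?thesis by blast
qed

section \<open>Bounded distortion and the coding map\<close>

lemma birkhoff_sum_add: "birkhoff_sum (m + n) g \<omega> = birkhoff_sum m g \<omega> + birkhoff_sum n g (sdrop m \<omega>)"
  unfolding birkhoff_sum_def
  by (induction n) (simp_all add: add.assoc)

lemma birkhoff_sum_Suc: "birkhoff_sum (Suc n) g \<omega> = g \<omega> + birkhoff_sum n g (stl \<omega>)"
  unfolding birkhoff_sum_def by (subst sum.lessThan_Suc_shift) simp

text \<open>The \<open>k\<close>-th shifts of two sequences that agree on \<open>n\<close> letters agree on \<open>n - k\<close> letters, so the differences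
  are dominated by a geometric series.\<close>

lemma holder_birkhoff_variation:
  assumes "holder_continuous_on_shift I \<psi>"
  shows "\<exists>V. \<forall>n. \<forall>\<omega>\<in>streams I. \<forall>\<tau>\<in>streams I. stake n \<omega> = stake n \<tau> \<longrightarrow>
      \<bar>birkhoff_sum n \<psi> \<omega> - birkhoff_sum n \<psi> \<tau>\<bar> \<le> V"
proof -
  obtain \<theta> H where \<theta>: "\<theta> > 0" and H: "\<And>\<omega> \<tau> n. 1 \<le> n \<Longrightarrow> \<omega> \<in> streams I \<Longrightarrow> \<tau> \<in> streams I \<Longrightarrow>
      stake n \<omega> = stake n \<tau> \<Longrightarrow> \<bar>\<psi> \<omega> - \<psi> \<tau>\<bar> * exp (\<theta> * real n) \<le> H"
    using assms unfolding holder_continuous_on_shift_def bdd_above_def by blast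
  define q where "q = exp (- \<theta>)"
  have q: "0 < q" "q < 1" using \<theta> by (auto simp: q_def)
  have one: "\<bar>\<psi> \<omega> - \<psi> \<tau>\<bar> \<le> max H 0 * q ^ n"
    if "1 \<le> n" "\<omega> \<in> streams I" "\<tau> \<in> streams I" "stake n \<omega> = stake n \<tau>" for \<omega> \<tau> n
  proof -
    have "\<bar>\<psi> \<omega> - \<psi> \<tau>\<bar> = \<bar>\<psi> \<omega> - \<psi> \<tau>\<bar> * exp (\<theta> * real n) * q ^ n"
      by (simp add: q_def exp_of_nat_mult[symmetric] exp_add[symmetric] mult.commute)
    also have "\<dots> \<le> max H 0 * q ^ n" using H[OF that] q by (intro mult_right_mono) auto
    finally show ?thesis .
  qed
  have "\<bar>birkhoff_sum n \<psi> \<omega> - birkhoff_sum n \<psi> \<tau>\<bar> \<le> max H 0 * (1 / (1 - q))"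
    if "\<omega> \<in> streams I" "\<tau> \<in> streams I" "stake n \<omega> = stake n \<tau>" for n \<omega> \<tau>
  proof -
    have "\<bar>birkhoff_sum n \<psi> \<omega> - birkhoff_sum n \<psi> \<tau>\<bar> \<le> max H 0 * (\<Sum>j<n. q ^ Suc j)"
      using that
    proof (induction n arbitrary: \<omega> \<tau>)
      case (Suc n)
      have "stake n (stl \<omega>) = stake n (stl \<tau>)" using Suc.prems(3) by simp
      then have "\<bar>birkhoff_sum n \<psi> (stl \<omega>) - birkhoff_sum n \<psi> (stl \<tau>)\<bar> \<le> max H 0 * (\<Sum>j<n. q ^ Suc j)"
        using Suc.IH Suc.prems streams_stl by blast
      moreover have "\<bar>\<psi> \<omega> - \<psi> \<tau>\<bar> \<le> max H 0 * q ^ Suc n" by (rule one) (use Suc.prems in auto)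
      ultimately show ?case
        by (simp add: birkhoff_sum_Suc distrib_left)
    qed (simp add: birkhoff_sum_def)
    also have "\<dots> \<le> max H 0 * (1 / (1 - q))"
    proof (rule mult_left_mono)
      have "(\<Sum>j<n. q ^ Suc j) \<le> (\<Sum>j<n. q ^ j)" using q by (intro sum_mono) (simp add: mult_left_le_one_le)
      also have "\<dots> = (1 - q ^ n) / (1 - q)" using q by (simp add: sum_gp_strict)
      also have "\<dots> \<le> 1 / (1 - q)" using q by (intro divide_right_mono) auto
      finally show "(\<Sum>j<n. q ^ Suc j) \<le> 1 / (1 - q)" .
    qed simp
    finally show ?thesis .
  qed
  then show ?thesis by blast
qed

lemma card_disjoint_balls_le:
  fixes x :: "'i \<Rightarrow> 'a::euclidean_space"
  assumes fin: "finite S" and r: "0 < r" and sub: "\<And>i. i \<in> S \<Longrightarrow> ball (x i) r \<subseteq> ball z s"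
    and disj: "\<And>i j. i \<in> S \<Longrightarrow> j \<in> S \<Longrightarrow> i \<noteq> j \<Longrightarrow> ball (x i) r \<inter> ball (x j) r = {}" and s: "0 < s"
  shows "real (card S) \<le> (s / r) ^ DIM('a)"
proof -
  let ?v = "unit_ball_vol (real DIM('a))"
  have v: "?v > 0" by simp
  have fin_ball: "emeasure lborel (ball p q) \<noteq> \<infinity>" for p :: 'a and q
    using emeasure_lborel_ball_finite[of p q] by simp
  have "(\<Sum>i\<in>S. measure lborel (ball (x i) r)) = measure lborel (\<Union>i\<in>S. ball (x i) r)"
    by (rule measure_finite_Union[symmetric])
       (use fin disj fin_ball in \<open>auto simp: disjoint_family_on_def\<close>)
  also have "\<dots> \<le> measure lborel (ball z s)"
    by (rule measure_mono_fmeasurable)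
       (use sub fin emeasure_lborel_ball_finite in \<open>auto simp: fmeasurable_def\<close>)
  finally have "real (card S) * (?v * r ^ DIM('a)) \<le> ?v * s ^ DIM('a)"
    using r s by (simp add: content_ball)
  then have "real (card S) * r ^ DIM('a) \<le> s ^ DIM('a)" using v by (simp add: mult.left_commute)
  then show ?thesis using r by (simp add: power_divide field_simps)
qed

context conformal_system
begin

lemma word_maps_into: "w \<in> lists I \<Longrightarrow> foldr \<phi> w ` X \<subseteq> X"
proof (induction w)
  case (Cons e w)
  then show ?case using maps_into[of e] by (fastforce simp: image_comp[symmetric])
qed simp

lemma word_in_X: "w \<in> lists I \<Longrightarrow> x \<in> X \<Longrightarrow> foldr \<phi> w x \<in> X"
  using word_maps_into by blast

lemma word_inj: "w \<in> lists I \<Longrightarrow> inj_on (foldr \<phi> w) X"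
proof (induction w)
  case (Cons e w)
  have "inj_on (\<phi> e) (foldr \<phi> w ` X)" using Cons inj[of e] word_maps_into[of w] by (auto intro: inj_on_subset)
  then have "inj_on (\<phi> e \<circ> foldr \<phi> w) X" using Cons by (intro comp_inj_on) auto
  then show ?case by (simp add: comp_def)
qed simp

lemma word_dist_le: "w \<in> lists I \<Longrightarrow> x \<in> X \<Longrightarrow> y \<in> X \<Longrightarrow>
  dist (foldr \<phi> w x) (foldr \<phi> w y) \<le> c ^ length w * dist x y"
proof (induction w)
  case (Cons e w)
  have "dist (foldr \<phi> (e # w) x) (foldr \<phi> (e # w) y) \<le> c * dist (foldr \<phi> w x) (foldr \<phi> w y)"
    using Cons lipschitz_onD[OF lipschitz, of e "foldr \<phi> w x" "foldr \<phi> w y"] word_in_X by simp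
  also have "\<dots> \<le> c * (c ^ length w * dist x y)" using Cons c by (intro mult_left_mono) auto
  finally show ?case by (simp add: mult.assoc)
qed simp

lemma word_continuous: "w \<in> lists I \<Longrightarrow> continuous_on X (foldr \<phi> w)"
  by (rule lipschitz_on_continuous_on[of "c ^ length w"], rule lipschitz_onI)
     (use word_dist_le c in auto)

lemma word_similarity: "w \<in> lists I \<Longrightarrow> x \<in> X \<Longrightarrow> similarity_at X (foldr \<phi> w) x (deriv_norm X (foldr \<phi> w) x)"
proof (induction w)
  case Nil
  have "similarity_at X id x 1" unfolding similarity_at_def
    by (auto intro!: exI[of _ id] orthogonal_transformation_id simp: id_def)
  then show ?case using similarity_at_norms(1)[OF roomy_X \<rho> \<open>x \<in> X\<close>] by (simp add: id_def)
next
  case (Cons e w)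
  obtain k where "similarity_at X (\<phi> e) (foldr \<phi> w x) k"
    using similarity[of e "foldr \<phi> w x"] Cons word_in_X by auto
  then have "similarity_at X (foldr \<phi> (e # w)) x (k * deriv_norm X (foldr \<phi> w) x)"
    using similarity_at_compose[OF Cons.IH, of "\<phi> e" k] Cons.prems word_maps_into[of w] by simp
  then show ?case using similarity_at_norms(1)[OF roomy_X \<rho> \<open>x \<in> X\<close>] by metis
qed

lemma word_deriv_pos: "w \<in> lists I \<Longrightarrow> x \<in> X \<Longrightarrow> deriv_norm X (foldr \<phi> w) x > 0"
  using word_similarity by (auto simp: similarity_at_def)

lemma word_deriv_append:
  assumes "u \<in> lists I" "v \<in> lists I" "x \<in> X"
  shows "deriv_norm X (foldr \<phi> (u @ v)) x = deriv_norm X (foldr \<phi> u) (foldr \<phi> v x) * deriv_norm X (foldr \<phi> v) x"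
proof -
  have "similarity_at X (foldr \<phi> u \<circ> foldr \<phi> v) x
      (deriv_norm X (foldr \<phi> u) (foldr \<phi> v x) * deriv_norm X (foldr \<phi> v) x)"
    by (intro similarity_at_compose word_similarity word_maps_into word_in_X assms)
  moreover have "foldr \<phi> (u @ v) = foldr \<phi> u \<circ> foldr \<phi> v" by (simp add: fun_eq_iff)
  ultimately show ?thesis using similarity_at_norms(1)[OF roomy_X \<rho> assms(3)] by simp
qed

lemma word_deriv_Nil: "x \<in> X \<Longrightarrow> deriv_norm X (foldr \<phi> []) x = 1"
  using word_deriv_append[of "[]" "[]" x] word_deriv_pos[of "[]" x] by simp

lemma letter_word: "foldr \<phi> [e] = \<phi> e" by simp

lemma word_deriv_le: "w \<in> lists I \<Longrightarrow> x \<in> X \<Longrightarrow> deriv_norm X (foldr \<phi> w) x \<le> c ^ length w"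
  by (rule similarity_at_le_lipschitz[OF roomy_X \<rho> _ word_similarity])
     (use word_dist_le c in \<open>auto intro!: lipschitz_onI\<close>)

text \<open>The value \<open>L * (diameter X powr a) * (1 + q + q\<^sup>2 + \<dots>)\<close> with \<open>q = c powr a\<close>.\<close>

definition distortion :: real where
  "distortion = L * diameter X powr a / (1 - c powr a)"

lemma c_powr_a: "0 < c powr a" "c powr a < 1"
  using c a powr_less_mono2[of a c 1] by auto

lemma distortion_nonneg: "distortion \<ge> 0"
  unfolding distortion_def using L c_powr_a by auto

text \<open>Bounded distortion: by the chain rule the logarithmic derivative of \<open>\<phi>\<^sub>w\<close> is a sum over the letters of
  \<open>w\<close>.  The letter followed by \<open>j\<close> others is evaluated at points whose distance has been contracted by
  \<open>c ^ j\<close>, so the Hoelder condition gives a geometric series.\<close>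

lemma ln_word_deriv_diff_le:
  assumes w: "w \<in> lists I" and x: "x \<in> X" and y: "y \<in> X"
  shows "\<bar>ln (deriv_norm X (foldr \<phi> w) x) - ln (deriv_norm X (foldr \<phi> w) y)\<bar> \<le> distortion"
proof -
  let ?q = "c powr a"
  have "\<bar>ln (deriv_norm X (foldr \<phi> w) x) - ln (deriv_norm X (foldr \<phi> w) y)\<bar>
      \<le> L * diameter X powr a * (\<Sum>j<length w. ?q ^ j)"
    using w
  proof (induction w rule: list.induct)
    case Nil
    then show ?case using x y using word_deriv_Nil[OF x] word_deriv_Nil[OF y] by (simp add: id_def)
  next
    case (Cons e w)
    let ?x = "foldr \<phi> w x" and ?y = "foldr \<phi> w y"
    have w: "w \<in> lists I" "e \<in> I" "[e] \<in> lists I" using Cons.prems by auto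
    have split: "ln (deriv_norm X (foldr \<phi> (e # w)) p) =
        ln (deriv_norm X (\<phi> e) (foldr \<phi> w p)) + ln (deriv_norm X (foldr \<phi> w) p)" if p: "p \<in> X" for p
    proof -
      have "deriv_norm X (foldr \<phi> (e # w)) p = deriv_norm X (\<phi> e) (foldr \<phi> w p) * deriv_norm X (foldr \<phi> w) p"
        using word_deriv_append[OF w(3,1) p] by (simp only: letter_word append_Cons append_Nil)
      moreover have "deriv_norm X (\<phi> e) (foldr \<phi> w p) > 0"
        using word_deriv_pos[OF w(3) word_in_X[OF w(1) p]] by (simp only: letter_word)
      ultimately show ?thesis using word_deriv_pos[OF w(1) p] by (simp add: ln_mult_pos)
    qed
    have "dist ?x ?y \<le> c ^ length w * diameter X"
      using word_dist_le[OF w(1) x y] diameter_bounded_bound[OF compact_imp_bounded[OF compact_X] x y] c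
      by (meson mult_left_mono order_trans zero_le_power less_imp_le)
    then have "dist ?x ?y powr a \<le> (c ^ length w * diameter X) powr a"
      using a by (intro powr_mono2) auto
    also have "\<dots> = ?q ^ length w * diameter X powr a"
      using c diameter_ge_0[OF compact_imp_bounded[OF compact_X]]
      by (simp add: powr_mult powr_powr powr_realpow[symmetric] mult.commute)
    finally have "L * dist ?x ?y powr a \<le> L * (?q ^ length w * diameter X powr a)"
      using L by (intro mult_left_mono) auto
    moreover have "\<bar>ln (deriv_norm X (\<phi> e) ?x) - ln (deriv_norm X (\<phi> e) ?y)\<bar> \<le> L * dist ?x ?y powr a"
      using ln_holder[OF w(2)] word_in_X[OF w(1)] x y by blast
    ultimately have "\<bar>ln (deriv_norm X (foldr \<phi> (e # w)) x) - ln (deriv_norm X (foldr \<phi> (e # w)) y)\<bar>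
        \<le> L * (?q ^ length w * diameter X powr a) + L * diameter X powr a * (\<Sum>j<length w. ?q ^ j)"
      using Cons.IH[OF w(1)] unfolding split[OF x] split[OF y] by linarith
    then show ?case by (simp add: algebra_simps comp_def)
  qed
  also have "\<dots> \<le> L * diameter X powr a * (1 / (1 - ?q))"
  proof (rule mult_left_mono)
    have "(\<Sum>j<length w. ?q ^ j) = (1 - ?q ^ length w) / (1 - ?q)"
      using c_powr_a by (simp add: sum_gp_strict)
    also have "\<dots> \<le> 1 / (1 - ?q)" using c_powr_a by (intro divide_right_mono) auto
    finally show "(\<Sum>j<length w. ?q ^ j) \<le> 1 / (1 - ?q)" .
  qed (use L in auto)
  finally show ?thesis by (simp add: distortion_def)
qed

definition word_norm :: "nat list \<Rightarrow> real" where
  "word_norm w = sup_deriv_norm X (foldr \<phi> w)"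

definition lam :: "nat list \<Rightarrow> real" where
  "lam w = ln (word_norm w)"

lemma word_norm_bounds:
  assumes w: "w \<in> lists I"
  shows "x \<in> X \<Longrightarrow> deriv_norm X (foldr \<phi> w) x \<le> word_norm w" "word_norm w \<le> c ^ length w"
    "word_norm w > 0" 
proof -
  have bdd: "bdd_above ((\<lambda>x. deriv_norm X (foldr \<phi> w) x) ` X)"
    using word_deriv_le[OF w] by (auto intro!: bdd_aboveI2)
  show *: "deriv_norm X (foldr \<phi> w) x \<le> word_norm w" if "x \<in> X" for x
    unfolding word_norm_def sup_deriv_norm_def by (rule cSUP_upper[OF that bdd])
  show "word_norm w \<le> c ^ length w"
    unfolding word_norm_def sup_deriv_norm_def using word_deriv_le[OF w] X_nonempty by (intro cSUP_least) auto
  obtain x where "x \<in> X" using X_nonempty by blast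
  then show "word_norm w > 0" using * word_deriv_pos[OF w] less_le_trans by blast
qed

lemma ln_word_deriv_approx:
  assumes w: "w \<in> lists I" and x: "x \<in> X"
  shows "ln (deriv_norm X (foldr \<phi> w) x) \<le> lam w" "lam w \<le> ln (deriv_norm X (foldr \<phi> w) x) + distortion"
proof -
  show "ln (deriv_norm X (foldr \<phi> w) x) \<le> lam w"
    unfolding lam_def using word_norm_bounds[OF w] word_deriv_pos[OF w x] x by simp
  have "word_norm w \<le> deriv_norm X (foldr \<phi> w) x * exp distortion"
    unfolding word_norm_def sup_deriv_norm_def
  proof (rule cSUP_least[OF X_nonempty])
    fix y assume y: "y \<in> X"
    have "ln (deriv_norm X (foldr \<phi> w) y) \<le> ln (deriv_norm X (foldr \<phi> w) x) + distortion"
      using ln_word_deriv_diff_le[OF w x y] by linarith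
    then have "exp (ln (deriv_norm X (foldr \<phi> w) y)) \<le> exp (ln (deriv_norm X (foldr \<phi> w) x) + distortion)"
      by simp
    then show "deriv_norm X (foldr \<phi> w) y \<le> deriv_norm X (foldr \<phi> w) x * exp distortion"
      using word_deriv_pos[OF w x] word_deriv_pos[OF w y] by (simp add: exp_add)
  qed
  then have "ln (word_norm w) \<le> ln (deriv_norm X (foldr \<phi> w) x * exp distortion)"
    using word_norm_bounds(3)[OF w] word_deriv_pos[OF w x] by (subst ln_le_cancel_iff) auto
  then show "lam w \<le> ln (deriv_norm X (foldr \<phi> w) x) + distortion"
    unfolding lam_def using word_deriv_pos[OF w x] by (simp add: ln_mult_pos)
qed

lemma exp_lam: "w \<in> lists I \<Longrightarrow> exp (lam w) = word_norm w"
  unfolding lam_def using word_norm_bounds(3) by simp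

lemma lam_append_bounds:
  assumes u: "u \<in> lists I" and v: "v \<in> lists I"
  shows "lam (u @ v) \<le> lam u + lam v" "lam u + lam v \<le> lam (u @ v) + 2 * distortion"
proof -
  obtain x where x: "x \<in> X" using X_nonempty by blast
  have vx: "foldr \<phi> v x \<in> X" using word_in_X[OF v x] .
  have uv: "u @ v \<in> lists I" using u v by simp
  have split: "ln (deriv_norm X (foldr \<phi> (u @ v)) x) = ln (deriv_norm X (foldr \<phi> u) (foldr \<phi> v x)) + ln (deriv_norm X (foldr \<phi> v) x)"
    if x: "x \<in> X" for x
    unfolding word_deriv_append[OF u v x]
    by (intro ln_mult_pos word_deriv_pos u v word_in_X x)
  show "lam u + lam v \<le> lam (u @ v) + 2 * distortion"
    using split[OF x] ln_word_deriv_approx[OF u vx] ln_word_deriv_approx[OF v x] ln_word_deriv_approx[OF uv x]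
    by linarith
  have "word_norm (u @ v) \<le> word_norm u * word_norm v"
    unfolding word_norm_def[of "u @ v"] sup_deriv_norm_def
  proof (rule cSUP_least[OF X_nonempty])
    fix y assume y: "y \<in> X"
    show "deriv_norm X (foldr \<phi> (u @ v)) y \<le> word_norm u * word_norm v"
      unfolding word_deriv_append[OF u v y]
      using word_norm_bounds[OF u] word_norm_bounds[OF v] word_in_X[OF v y] y word_deriv_pos[OF u] word_deriv_pos[OF v]
      by (intro mult_mono) (auto intro: less_imp_le)
  qed
  then have "ln (word_norm (u @ v)) \<le> ln (word_norm u * word_norm v)"
    using word_norm_bounds(3) u v uv by (subst ln_le_cancel_iff) auto
  then show "lam (u @ v) \<le> lam u + lam v"
    unfolding lam_def using word_norm_bounds(3) u v by (simp add: ln_mult_pos)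
qed

lemma lam_le_length: "w \<in> lists I \<Longrightarrow> lam w \<le> ln c * real (length w)"
proof -
  assume w: "w \<in> lists I"
  have "lam w \<le> ln (c ^ length w)"
    unfolding lam_def using word_norm_bounds[OF w] c by (subst ln_le_cancel_iff) auto
  then show ?thesis using c by (simp add: ln_realpow mult.commute)
qed

lemma minus_ln_c_pos: "- ln c > 0" using c by simp

lemma lam_Nil: "lam [] = 0"
proof -
  obtain x where x: "x \<in> X" using X_nonempty by blast
  have "word_norm [] \<ge> 1" using word_norm_bounds(1)[of "[]" x] word_deriv_Nil[OF x] x by simp
  moreover have "word_norm [] \<le> 1" using word_norm_bounds(2)[of "[]"] by simp
  ultimately show ?thesis by (simp add: lam_def)
qed

lemma stake_in_lists: "\<omega> \<in> streams I \<Longrightarrow> stake k \<omega> \<in> lists I"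
proof (induction k arbitrary: \<omega>)
  case (Suc k)
  then show ?case using streams_shd streams_stl by (metis Cons_in_lists_iff stake.simps(2))
qed simp

lemma coding_map_eq:
  assumes \<omega>: "\<omega> \<in> streams I"
  shows "{coding_map X \<phi> \<omega>} = (\<Inter>k. foldr \<phi> (stake k \<omega>) ` X)"
proof -
  let ?S = "\<lambda>k. foldr \<phi> (stake k \<omega>) ` X"
  have w: "stake k \<omega> \<in> lists I" for k by (rule stake_in_lists[OF \<omega>])
  have suc: "?S (Suc k) \<subseteq> ?S k" for k
  proof -
    have "stake (Suc k) \<omega> = stake k \<omega> @ [\<omega> !! k]" by (rule stake_Suc)
    moreover have "\<omega> !! k \<in> I" using \<omega> by (rule snth_in)
    ultimately show ?thesis using maps_into[of "\<omega> !! k"] by (auto simp del: stake.simps)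
  qed
  have "\<exists>p. \<Inter>(range ?S) = {p}"
  proof (rule decreasing_closed_nest_sing)
    show "closed (?S n)" for n
      using compact_continuous_image[OF word_continuous[OF w] compact_X] by (rule compact_imp_closed)
    show "?S n \<noteq> {}" for n using X_nonempty by simp
    show "?S n \<subseteq> ?S m" if "m \<le> n" for m n using that by (rule lift_Suc_antimono_le[of ?S, OF suc])
    fix \<epsilon> :: real assume \<epsilon>: "\<epsilon> > 0"
    have "(\<lambda>n. c ^ n * diameter X) \<longlonglongrightarrow> 0 * diameter X" using c by (intro tendsto_intros LIMSEQ_realpow_zero) auto
    then have "\<forall>\<^sub>F n in sequentially. c ^ n * diameter X < \<epsilon>" using \<epsilon> by (intro order_tendstoD) auto
    then obtain n where n: "c ^ n * diameter X < \<epsilon>" by (auto simp: eventually_sequentially)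
    have "dist p q < \<epsilon>" if "p \<in> ?S n" "q \<in> ?S n" for p q
    proof -
      obtain x y where xy: "x \<in> X" "y \<in> X" "p = foldr \<phi> (stake n \<omega>) x" "q = foldr \<phi> (stake n \<omega>) y"
        using \<open>p \<in> ?S n\<close> \<open>q \<in> ?S n\<close> by blast
      have "dist p q \<le> c ^ n * dist x y" using word_dist_le[OF w xy(1,2), of n] xy by simp
      also have "\<dots> \<le> c ^ n * diameter X"
        using diameter_bounded_bound[OF compact_imp_bounded[OF compact_X] xy(1,2)] c by (intro mult_left_mono) auto
      finally show ?thesis using n by simp
    qed
    then show "\<exists>n. \<forall>x\<in>?S n. \<forall>y\<in>?S n. dist x y < \<epsilon>" by blast
  qed
  then obtain p where p: "\<Inter>(range ?S) = {p}" by blast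
  have "coding_map X \<phi> \<omega> = p" unfolding coding_map_def using p by (intro the_equality) auto
  then show ?thesis using p by simp
qed

lemma coding_map_in_cylinder: "\<omega> \<in> streams I \<Longrightarrow> coding_map X \<phi> \<omega> \<in> foldr \<phi> (stake k \<omega>) ` X"
  using coding_map_eq by blast

lemma coding_map_in_X: "\<omega> \<in> streams I \<Longrightarrow> coding_map X \<phi> \<omega> \<in> X"
  using coding_map_in_cylinder[of \<omega> 0] by simp

lemma sdrop_in_streams: "\<omega> \<in> streams I \<Longrightarrow> sdrop n \<omega> \<in> streams I"
  by (simp add: streams_iff_snth sdrop_snth)

text \<open>The point on the right lies in all sets of the intersection that defines the left-hand side.\<close>

lemma coding_map_step:
  assumes \<omega>: "\<omega> \<in> streams I"
  shows "coding_map X \<phi> \<omega> = \<phi> (shd \<omega>) (coding_map X \<phi> (stl \<omega>))"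
proof -
  have stl: "stl \<omega> \<in> streams I" "shd \<omega> \<in> I" using \<omega> streams_stl streams_shd by blast+
  have "\<phi> (shd \<omega>) (coding_map X \<phi> (stl \<omega>)) \<in> foldr \<phi> (stake k \<omega>) ` X" for k
  proof (cases k)
    case 0
    then show ?thesis using maps_into[OF stl(2)] coding_map_in_X[OF stl(1)] by auto
  next
    case (Suc m)
    then show ?thesis using coding_map_in_cylinder[OF stl(1), of m] by auto
  qed
  then have "\<phi> (shd \<omega>) (coding_map X \<phi> (stl \<omega>)) \<in> {coding_map X \<phi> \<omega>}"
    unfolding coding_map_eq[OF \<omega>] by (rule INT_I)
  then show ?thesis by simp
qed

lemma birkhoff_sum_geometric_potential:
  "\<omega> \<in> streams I \<Longrightarrow> birkhoff_sum n (geometric_potential X \<phi>) \<omega> =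
     ln (deriv_norm X (foldr \<phi> (stake n \<omega>)) (coding_map X \<phi> (sdrop n \<omega>))) \<and>
     foldr \<phi> (stake n \<omega>) (coding_map X \<phi> (sdrop n \<omega>)) = coding_map X \<phi> \<omega>"
proof (induction n arbitrary: \<omega>)
  case 0
  then show ?case using word_deriv_Nil[OF coding_map_in_X[OF 0]] by (simp add: birkhoff_sum_def id_def)
next
  case (Suc n)
  have stl: "stl \<omega> \<in> streams I" "shd \<omega> \<in> I" "[shd \<omega>] \<in> lists I" "stake n (stl \<omega>) \<in> lists I"
    using Suc.prems streams_stl streams_shd stake_in_lists[OF streams_stl] by auto
  let ?p = "coding_map X \<phi> (sdrop n (stl \<omega>))"
  have p: "?p \<in> X" using sdrop_in_streams[OF stl(1)] by (rule coding_map_in_X)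
  have IH: "birkhoff_sum n (geometric_potential X \<phi>) (stl \<omega>) = ln (deriv_norm X (foldr \<phi> (stake n (stl \<omega>))) ?p)"
    "foldr \<phi> (stake n (stl \<omega>)) ?p = coding_map X \<phi> (stl \<omega>)" using Suc.IH[OF stl(1)] by auto
  have "deriv_norm X (foldr \<phi> (shd \<omega> # stake n (stl \<omega>))) ?p =
      deriv_norm X (\<phi> (shd \<omega>)) (coding_map X \<phi> (stl \<omega>)) * deriv_norm X (foldr \<phi> (stake n (stl \<omega>))) ?p"
    using word_deriv_append[OF stl(3,4) p] IH(2) by (simp only: letter_word append_Cons append_Nil)
  moreover have "deriv_norm X (\<phi> (shd \<omega>)) (coding_map X \<phi> (stl \<omega>)) > 0"
    using word_deriv_pos[OF stl(3) coding_map_in_X[OF stl(1)]] by (simp only: letter_word)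
  ultimately have "ln (deriv_norm X (foldr \<phi> (shd \<omega> # stake n (stl \<omega>))) ?p) =
      geometric_potential X \<phi> \<omega> + birkhoff_sum n (geometric_potential X \<phi>) (stl \<omega>)"
    using word_deriv_pos[OF stl(4) p] IH(1) by (simp add: ln_mult_pos geometric_potential_def)
  then show ?case using coding_map_step[OF Suc.prems] IH(2) by (simp add: birkhoff_sum_Suc comp_def)
qed

lemma birkhoff_sum_geometric_potential_approx:
  assumes \<omega>: "\<omega> \<in> streams I"
  shows "\<bar>birkhoff_sum n (geometric_potential X \<phi>) \<omega> - lam (stake n \<omega>)\<bar> \<le> distortion"
proof -
  have "coding_map X \<phi> (sdrop n \<omega>) \<in> X" using sdrop_in_streams[OF \<omega>] by (rule coding_map_in_X)
  from ln_word_deriv_approx[OF stake_in_lists[OF \<omega>, of n] this]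
  show ?thesis using birkhoff_sum_geometric_potential[OF \<omega>, of n] distortion_nonneg by (simp add: abs_le_iff)
qed

section \<open>Size and separation of the images of words\<close>

lemma word_deriv_within:
  assumes w: "w \<in> lists I" and x: "x \<in> X"
  obtains T where "orthogonal_transformation T"
    "(foldr \<phi> w has_derivative (\<lambda>v. deriv_norm X (foldr \<phi> w) x *\<^sub>R T v)) (at x within X)"
  using word_similarity[OF w x] by (auto simp: similarity_at_def)

text \<open>The segment has to lie in \<open>X\<close>, as the derivatives are controlled by \<open>word_norm\<close> on \<open>X\<close> only and \<open>X\<close> need not
  be convex.\<close>

lemma word_dist_segment_le:
  assumes w: "w \<in> lists I" and seg: "closed_segment x y \<subseteq> X"
  shows "dist (foldr \<phi> w x) (foldr \<phi> w y) \<le> word_norm w * dist x y"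
proof -
  let ?d = "\<lambda>p. deriv_norm X (foldr \<phi> w) p"
  have "\<exists>T. orthogonal_transformation T \<and> (foldr \<phi> w has_derivative (\<lambda>v. ?d p *\<^sub>R T v)) (at p within X)" if "p \<in> X" for p
    using word_deriv_within[OF w that] by blast
  then obtain T where T: "\<And>p. p \<in> X \<Longrightarrow> orthogonal_transformation (T p)"
    "\<And>p. p \<in> X \<Longrightarrow> (foldr \<phi> w has_derivative (\<lambda>v. ?d p *\<^sub>R T p v)) (at p within X)" by metis
  have "norm (foldr \<phi> w x - foldr \<phi> w y) \<le> word_norm w * norm (x - y)"
  proof (rule differentiable_bound[where S="closed_segment x y" and f'="\<lambda>p v. ?d p *\<^sub>R T p v"])
    fix p assume "p \<in> closed_segment x y"
    then have p: "p \<in> X" using seg by blast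
    show "(foldr \<phi> w has_derivative (\<lambda>v. ?d p *\<^sub>R T p v)) (at p within closed_segment x y)"
      using has_derivative_subset[OF T(2)[OF p] seg] .
    show "onorm (\<lambda>v. ?d p *\<^sub>R T p v) \<le> word_norm w"
      using word_norm_bounds[OF w] p word_deriv_pos[OF w p] T(1)[OF p]
      by (intro onorm_bound) (auto simp: orthogonal_transformation_norm intro!: mult_right_mono)
  qed auto
  then show ?thesis by (simp add: dist_norm)
qed

definition centre :: "'a \<Rightarrow> 'a" where
  "centre x = (SOME p. ball p \<rho> \<subseteq> interior X \<and> (\<forall>y\<in>ball p \<rho>. dist x y \<le> R \<and> closed_segment x y \<subseteq> X))"

lemma centre:
  assumes "x \<in> X"
  shows "ball (centre x) \<rho> \<subseteq> interior X" "y \<in> ball (centre x) \<rho> \<Longrightarrow> dist x y \<le> R"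
    "y \<in> ball (centre x) \<rho> \<Longrightarrow> closed_segment x y \<subseteq> X"
proof -
  have "\<exists>p. ball p \<rho> \<subseteq> interior X \<and> (\<forall>y\<in>ball p \<rho>. dist x y \<le> R \<and> closed_segment x y \<subseteq> X)"
    using roomy_X assms unfolding roomy_def by blast
  from someI_ex[OF this] show "ball (centre x) \<rho> \<subseteq> interior X" "y \<in> ball (centre x) \<rho> \<Longrightarrow> dist x y \<le> R"
    "y \<in> ball (centre x) \<rho> \<Longrightarrow> closed_segment x y \<subseteq> X"
    unfolding centre_def by blast+
qed

lemma centre_in_X: "x \<in> X \<Longrightarrow> centre x \<in> X"
  using centre(1)[of x] \<rho> interior_subset by (metis centre_in_ball subset_iff)

lemma R_nonneg: "R \<ge> 0"
proof -
  obtain x where x: "x \<in> X" using X_nonempty by blast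
  have "dist x (centre x) \<le> R" using centre(2)[OF x, of "centre x"] \<rho> by simp
  then show ?thesis using zero_le_dist order_trans by blast
qed

lemma word_dist_centre_le:
  assumes w: "w \<in> lists I" and x: "x \<in> X" and y: "y \<in> ball (centre x) \<rho>"
  shows "dist (foldr \<phi> w x) (foldr \<phi> w y) \<le> word_norm w * R"
proof -
  have "dist (foldr \<phi> w x) (foldr \<phi> w y) \<le> word_norm w * dist x y"
    using word_dist_segment_le[OF w centre(3)[OF x y]] .
  also have "\<dots> \<le> word_norm w * R"
    using centre(2)[OF x y] word_norm_bounds(3)[OF w] by (intro mult_left_mono) auto
  finally show ?thesis .
qed

text \<open>Group the points of \<open>X\<close> by the approximate position of their centres.  Two points of the same piece see a
  common point of \<open>X\<close> and so are joined by two segments in \<open>X\<close>.  The number of pieces depends on \<open>X\<close> only, so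
  the pieces serve as well as \<open>X\<close> itself in covers.\<close>

theorem finite_pieces:
  obtains P :: "'a set set" where "finite P" "X \<subseteq> \<Union>P"
    "\<And>w A x y. w \<in> lists I \<Longrightarrow> A \<in> P \<Longrightarrow> x \<in> A \<Longrightarrow> y \<in> A \<Longrightarrow>
       dist (foldr \<phi> w x) (foldr \<phi> w y) \<le> 2 * R * word_norm w"
proof -
  have "X \<subseteq> (\<Union>q\<in>X. ball q (\<rho> / 2))" using \<rho> by force
  then obtain Q where Q: "finite Q" "X \<subseteq> (\<Union>q\<in>Q. ball q (\<rho> / 2))"
    using compactE_image[OF compact_X, of X "\<lambda>q. ball q (\<rho> / 2)"] by (metis open_ball)
  define piece where "piece q = {x\<in>X. centre x \<in> ball q (\<rho> / 2)}" for q
  have "dist (foldr \<phi> w x) (foldr \<phi> w y) \<le> 2 * R * word_norm w"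
    if w: "w \<in> lists I" and A: "A \<in> piece ` Q" and x: "x \<in> A" and y: "y \<in> A" for w A x y
  proof -
    obtain q where q: "A = piece q" using A by blast
    have xX: "x \<in> X" and yX: "y \<in> X" and near: "dist q (centre x) < \<rho> / 2" "dist q (centre y) < \<rho> / 2"
      using x y q by (auto simp: piece_def)
    have "dist (centre x) (centre y) < \<rho>"
      using near dist_triangle3[of "centre x" "centre y" q] by linarith
    then have "dist (foldr \<phi> w x) (foldr \<phi> w (centre y)) \<le> word_norm w * R"
      by (intro word_dist_centre_le[OF w xX]) simp
    moreover have "dist (foldr \<phi> w y) (foldr \<phi> w (centre y)) \<le> word_norm w * R"
      using \<rho> by (intro word_dist_centre_le[OF w yX]) simp
    ultimately show ?thesis
      using dist_triangle2[of "foldr \<phi> w x" "foldr \<phi> w y" "foldr \<phi> w (centre y)"] by (simp add: algebra_simps)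
  qed
  moreover have "X \<subseteq> \<Union>(piece ` Q)"
  proof
    fix x assume x: "x \<in> X"
    then have "centre x \<in> (\<Union>q\<in>Q. ball q (\<rho> / 2))" using centre_in_X Q by blast
    then show "x \<in> \<Union>(piece ` Q)" using x by (auto simp: piece_def)
  qed
  ultimately show ?thesis using that[of "piece ` Q"] Q by blast
qed

lemma word_interior: "w \<in> lists I \<Longrightarrow> foldr \<phi> w ` interior X \<subseteq> interior X"
proof -
  assume w: "w \<in> lists I"
  have "open (foldr \<phi> w ` interior X)"
    by (rule invariance_of_domain)
       (use word_continuous[OF w] word_inj[OF w] interior_subset in \<open>auto intro: continuous_on_subset inj_on_subset\<close>)
  moreover have "foldr \<phi> w ` interior X \<subseteq> X" using word_maps_into[OF w] interior_subset by blast
  ultimately show ?thesis by (rule interior_maximal[rotated])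
qed

text \<open>At the first letter where the words differ the open set condition applies, and the map of the common prefix
  is injective.\<close>

lemma incomparable_words_disjoint:
  assumes u: "u \<in> lists I" and v: "v \<in> lists I" and inc: "\<not> prefix u v" "\<not> prefix v u"
  shows "foldr \<phi> u ` interior X \<inter> foldr \<phi> v ` interior X = {}"
proof -
  obtain p e u' e' v' where dec: "e \<noteq> e'" "u = p @ e # u'" "v = p @ e' # v'"
    using parallel_decomp[of u v] inc by (auto simp: parallel_def)
  have p: "p \<in> lists I" and e: "e \<in> I" "e' \<in> I" and w: "u' \<in> lists I" "v' \<in> lists I" using u v dec by auto
  let ?A = "\<phi> e ` interior X" and ?B = "\<phi> e' ` interior X"
  have "foldr \<phi> u' ` interior X \<subseteq> interior X" "foldr \<phi> v' ` interior X \<subseteq> interior X"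
    using word_interior w by blast+
  then have "foldr \<phi> u ` interior X \<subseteq> foldr \<phi> p ` ?A" "foldr \<phi> v ` interior X \<subseteq> foldr \<phi> p ` ?B"
    unfolding dec by (auto simp: image_subset_iff)
  moreover have "foldr \<phi> p ` ?A \<inter> foldr \<phi> p ` ?B = foldr \<phi> p ` (?A \<inter> ?B)"
    by (rule inj_on_image_Int[OF word_inj[OF p], symmetric])
       (use maps_into[OF e(1)] maps_into[OF e(2)] interior_subset in blast)+
  ultimately show ?thesis using open_set[OF e dec(1)] by blast
qed

lemma word_norm_distortion:
  assumes w: "w \<in> lists I" and x: "x \<in> X"
  shows "word_norm w * exp (- distortion) \<le> deriv_norm X (foldr \<phi> w) x"
proof -
  have "exp (lam w - distortion) \<le> exp (ln (deriv_norm X (foldr \<phi> w) x))"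
    using ln_word_deriv_approx(2)[OF w x] by simp
  then show ?thesis using word_deriv_pos[OF w x] exp_lam[OF w] by (simp add: exp_diff exp_minus divide_inverse)
qed

text \<open>Otherwise there is a nearest point \<open>z\<close> outside the image, at distance \<open>d\<close> from the image of \<open>p\<close>.  On the open
  ball of radius \<open>d\<close> the inverse map is defined, and its derivative is bounded by \<open>1 / m\<close>, so it maps
  this ball into a compact ball around \<open>p\<close> of radius \<open>d / m < \<rho>\<close>.  The image of that compact ball is closed,
  so it contains the boundary point \<open>z\<close>.\<close>

lemma word_image_contains_ball:
  assumes w: "w \<in> lists I" and p: "ball p \<rho> \<subseteq> interior X"
  shows "ball (foldr \<phi> w p) (\<rho> * exp (- distortion) * word_norm w) \<subseteq> foldr \<phi> w ` ball p \<rho>"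
proof (rule ccontr)
  let ?f = "foldr \<phi> w" and ?U = "ball p \<rho>"
  define m where "m = exp (- distortion) * word_norm w"
  have m: "m > 0" using word_norm_bounds(3)[OF w] by (simp add: m_def)
  have UX: "?U \<subseteq> X" using p interior_subset by blast
  have cont: "continuous_on ?U ?f" using word_continuous[OF w] UX continuous_on_subset by blast
  have inj: "inj_on ?f ?U" using word_inj[OF w] UX inj_on_subset by blast
  have opn: "open (?f ` ?U)" by (rule invariance_of_domain[OF cont _ inj]) simp
  assume "\<not> ball (?f p) (\<rho> * exp (- distortion) * word_norm w) \<subseteq> ?f ` ?U"
  then obtain z0 where "z0 \<in> ball (?f p) (\<rho> * m)" and z0_out: "z0 \<notin> ?f ` ?U"
    unfolding m_def mult.assoc by blast
  then have z0: "z0 \<notin> ?f ` ?U" "dist (?f p) z0 < \<rho> * m" by simp_all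
  obtain z where z: "z \<in> - ?f ` ?U" "\<And>y. y \<in> - ?f ` ?U \<Longrightarrow> dist (?f p) z \<le> dist (?f p) y"
    using distance_attains_inf[of "- ?f ` ?U" "?f p"] opn z0(1) by blast
  define d where "d = dist (?f p) z"
  have d: "d < \<rho> * m" using z(2)[of z0] z0 by (simp add: d_def)
  have pU: "p \<in> ?U" using \<rho> by simp
  have "?f p \<noteq> z" using z(1) pU by blast
  then have d0: "d > 0" by (simp add: d_def)
  have inside: "ball (?f p) d \<subseteq> ?f ` ?U"
  proof
    fix y assume "y \<in> ball (?f p) d"
    then show "y \<in> ?f ` ?U" using z(2)[of y] by (fastforce simp: d_def)
  qed
  let ?g = "inv_into ?U ?f"
  have lip: "dist p (?g y) \<le> d / m" if y: "y \<in> ball (?f p) d" for y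
  proof -
    have der: "\<exists>G. (?g has_derivative G) (at q) \<and> onorm G \<le> 1 / m" if q: "q \<in> ball (?f p) d" for q
    proof -
      have "q \<in> ?f ` ?U" using q inside by blast
      then have gq: "?g q \<in> ?U" "?f (?g q) = q" by (rule inv_into_into, rule f_inv_into_f)
      then have gX: "?g q \<in> X" using UX by blast
      let ?k = "deriv_norm X ?f (?g q)"
      obtain T where T: "orthogonal_transformation T" "(?f has_derivative (\<lambda>v. ?k *\<^sub>R T v)) (at (?g q) within X)"
        using word_deriv_within[OF w gX] by blast
      have "(?f has_derivative (\<lambda>v. ?k *\<^sub>R T v)) (at (?g q) within ?U)"
        using has_derivative_subset[OF T(2) UX] .
      then have at: "(?f has_derivative (\<lambda>v. ?k *\<^sub>R T v)) (at (?g q))"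
        unfolding at_within_open[OF gq(1) open_ball] .
      have k: "?k \<ge> m" "?k > 0" using word_norm_distortion[OF w gX] word_deriv_pos[OF w gX] by (simp_all add: m_def mult.commute)
      have surjT: "T (inv T v) = v" for v using orthogonal_transformation_surj[OF T(1)] by (rule surj_f_inv_f)
      have linT: "linear T" using T(1) by (simp add: orthogonal_transformation_def)
      have "(?g has_derivative (\<lambda>v. inv T ((1 / ?k) *\<^sub>R v))) (at q)"
      proof (rule has_derivative_inverse_strong_x[where S="?U" and f="?f" and f'="\<lambda>v. ?k *\<^sub>R T v"])
        show "(\<lambda>v. ?k *\<^sub>R T v) \<circ> (\<lambda>v. inv T ((1 / ?k) *\<^sub>R v)) = id" using surjT k by (auto simp: fun_eq_iff)
        show "?g (?f x) = x" if "x \<in> ?U" for x using inv_into_f_f[OF inj that] .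
      qed (use gq cont at in simp_all)
      moreover have "norm (inv T ((1 / ?k) *\<^sub>R v)) = 1 / ?k * norm v" for v
      proof -
        have "norm (T (inv T ((1 / ?k) *\<^sub>R v))) = norm (inv T ((1 / ?k) *\<^sub>R v))"
          using T(1) by (rule orthogonal_transformation_norm)
        then show ?thesis using surjT k by simp
      qed
      then have "onorm (\<lambda>v. inv T ((1 / ?k) *\<^sub>R v)) = 1 / ?k" using k by (intro onorm_similarity) auto
      moreover have "1 / ?k \<le> 1 / m" using k m by (simp add: frac_le)
      ultimately show ?thesis by (intro exI[of _ "\<lambda>v. inv T ((1 / ?k) *\<^sub>R v)"]) simp
    qed
    then obtain G where G: "\<And>q. q \<in> ball (?f p) d \<Longrightarrow> (?g has_derivative G q) (at q)"
      "\<And>q. q \<in> ball (?f p) d \<Longrightarrow> onorm (G q) \<le> 1 / m" by metis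
    have "norm (?g (?f p) - ?g y) \<le> 1 / m * norm (?f p - y)"
      by (rule differentiable_bound[where S="ball (?f p) d" and f'=G])
         (use G y d0 in \<open>auto intro: has_derivative_at_withinI\<close>)
    also have "\<dots> \<le> 1 / m * d" using y m by (intro mult_left_mono) (auto simp: dist_norm)
    finally show ?thesis using inv_into_f_f[OF inj pU] by (simp add: dist_norm)
  qed
  define K where "K = cball p (d / m)"
  have "d / m < \<rho>" using d m by (simp add: pos_divide_less_eq)
  then have KU: "K \<subseteq> ?U" by (auto simp: K_def)
  have "ball (?f p) d \<subseteq> ?f ` K"
  proof
    fix y assume y: "y \<in> ball (?f p) d"
    then have "?f (?g y) = y" using inside by (simp add: f_inv_into_f subset_iff)
    moreover have "?g y \<in> K" using lip[OF y] by (simp add: K_def)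
    ultimately show "y \<in> ?f ` K" by force
  qed
  moreover have "closed (?f ` K)"
    using compact_continuous_image[OF continuous_on_subset[OF cont KU]] by (simp add: K_def compact_imp_closed)
  ultimately have "closure (ball (?f p) d) \<subseteq> ?f ` K" by (rule closure_minimal)
  then have "z \<in> ?f ` K" using d0 by (auto simp: d_def)
  then show False using z(1) KU by blast
qed

text \<open>Incomparable words map the interior of \<open>X\<close> to disjoint sets.  Each of these contains a ball of radius
  comparable to \<open>r\<close>, and this ball is near \<open>U\<close>, because the centre seen from a point \<open>x\<close> is mapped to within
  \<open>R * r\<close> of the image of \<open>x\<close>.  Comparing volumes bounds the number of balls.\<close>

theorem card_antichain_hitting_le:
  assumes fin: "finite S" and S: "S \<subseteq> lists I"
    and anti: "\<And>u v. u \<in> S \<Longrightarrow> v \<in> S \<Longrightarrow> u \<noteq> v \<Longrightarrow> \<not> prefix u v"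
    and r: "r > 0" and \<eta>: "\<eta> > 0"
    and size: "\<And>w. w \<in> S \<Longrightarrow> word_norm w \<le> r" "\<And>w. w \<in> S \<Longrightarrow> \<eta> * r \<le> word_norm w"
    and hit: "\<And>w. w \<in> S \<Longrightarrow> foldr \<phi> w ` X \<inter> U \<noteq> {}"
    and U: "bounded U" "diameter U \<le> r"
  shows "real (card S) \<le> ((2 + R) / (\<rho> * exp (- distortion) * \<eta>)) ^ DIM('a)"
proof (cases "S = {}")
  case True
  have "0 \<le> (2 + R) / (\<rho> * exp (- distortion) * \<eta>)" using R_nonneg \<rho> \<eta> by simp
  then show ?thesis using True by simp
next
  case False
  then obtain w0 where "w0 \<in> S" by blast
  then obtain z where z: "z \<in> U" using hit by blast
  have "\<exists>x\<in>X. foldr \<phi> w x \<in> U" if "w \<in> S" for w using hit[OF that] by blast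
  then obtain x where x: "\<And>w. w \<in> S \<Longrightarrow> x w \<in> X" "\<And>w. w \<in> S \<Longrightarrow> foldr \<phi> w (x w) \<in> U" by metis
  define q where "q w = foldr \<phi> w (centre (x w))" for w
  define b where "b = \<rho> * exp (- distortion) * \<eta> * r"
  have b: "b > 0" using \<rho> \<eta> r by (simp add: b_def)
  have image: "ball (q w) b \<subseteq> foldr \<phi> w ` ball (centre (x w)) \<rho>" if w: "w \<in> S" for w
  proof -
    have "b \<le> \<rho> * exp (- distortion) * word_norm w"
      using size(2)[OF w] \<rho> by (simp add: b_def mult.assoc)
    then have "ball (q w) b \<subseteq> ball (q w) (\<rho> * exp (- distortion) * word_norm w)" by (rule subset_ball)
    also have "\<dots> \<subseteq> foldr \<phi> w ` ball (centre (x w)) \<rho>"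
      unfolding q_def by (rule word_image_contains_ball) (use w S centre(1) x in auto)
    finally show ?thesis .
  qed
  have "real (card S) \<le> (((2 + R) * r) / b) ^ DIM('a)"
  proof (rule card_disjoint_balls_le[OF fin b])
    show "(2 + R) * r > 0" using R_nonneg r by (simp add: add_pos_nonneg)
    fix w assume w: "w \<in> S"
    show "ball (q w) b \<subseteq> ball z ((2 + R) * r)"
    proof
      fix y assume "y \<in> ball (q w) b"
      then obtain y' where y': "y' \<in> ball (centre (x w)) \<rho>" "y = foldr \<phi> w y'" using image[OF w] by blast
      have "dist (foldr \<phi> w (x w)) y \<le> word_norm w * R"
        unfolding y'(2) by (rule word_dist_centre_le) (use w S x y' in auto)
      also have "\<dots> \<le> r * R" using size(1)[OF w] R_nonneg by (rule mult_right_mono)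
      finally have "dist (foldr \<phi> w (x w)) y \<le> r * R" .
      moreover have "dist z (foldr \<phi> w (x w)) \<le> r"
        using diameter_bounded_bound[OF U(1) z x(2)[OF w]] U(2) by linarith
      ultimately have "dist z y \<le> r + r * R" using dist_triangle[of z y "foldr \<phi> w (x w)"] by linarith
      then show "y \<in> ball z ((2 + R) * r)" using r by (simp add: algebra_simps)
    qed
    fix v assume v: "v \<in> S" "w \<noteq> v"
    have "foldr \<phi> w ` interior X \<inter> foldr \<phi> v ` interior X = {}"
      by (rule incomparable_words_disjoint) (use w v S anti in auto)
    then show "ball (q w) b \<inter> ball (q v) b = {}"
      using image[OF w] image[OF v(1)] centre(1)[OF x(1)[OF w]] centre(1)[OF x(1)[OF v(1)]] by blast
  qed
  also have "((2 + R) * r) / b = (2 + R) / (\<rho> * exp (- distortion) * \<eta>)"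
    using r by (simp add: b_def)
  finally show ?thesis .
qed

end

section \<open>The pressure as a growth rate\<close>

lemma exp_ereal_infinity: "exp_ereal \<infinity> = \<infinity>" "exp_ereal (- \<infinity>) = 0"
  using exp_ereal.simps(2,3) by (simp_all only: infinity_ereal_def uminus_ereal.simps)

lemma exp_ereal_ge: "ereal r \<le> x \<Longrightarrow> ennreal (exp r) \<le> exp_ereal x"
  by (cases x) (auto intro: ennreal_leI simp: exp_ereal_infinity)

lemma exp_ereal_le: "x \<le> ereal r \<Longrightarrow> exp_ereal x \<le> ennreal (exp r)"
  by (cases x) (auto intro: ennreal_leI simp: exp_ereal_infinity)

text \<open>Hoelder continuity enters through the resulting bound \<open>V\<close> on the variation of Birkhoff sums on
  cylinders.\<close>

locale multifractal = conformal_system +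
  fixes \<psi> :: "nat stream \<Rightarrow> real" and V :: real
  assumes variation: "\<omega> \<in> streams I \<Longrightarrow> \<tau> \<in> streams I \<Longrightarrow> stake n \<omega> = stake n \<tau> \<Longrightarrow>
      \<bar>birkhoff_sum n \<psi> \<omega> - birkhoff_sum n \<psi> \<tau>\<bar> \<le> V"
begin

text \<open>Birkhoff sums of a finite word are evaluated on its continuation by a fixed sequence; any other continuation
  changes them by at most \<open>V\<close>.\<close>

definition tail :: "nat stream" where
  "tail = sconst (SOME e. e \<in> I)"

definition B :: "nat list \<Rightarrow> real" where
  "B w = birkhoff_sum (length w) \<psi> (w @- tail)"

lemma tail_in: "tail \<in> streams I"
  unfolding tail_def by (rule sconst_streams) (use I_nonempty in \<open>simp add: some_in_eq\<close>)

lemma V_nonneg: "V \<ge> 0"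
  using variation[OF tail_in tail_in refl, of 0] by simp

lemma birkhoff_sum_approx:
  assumes "\<omega> \<in> streams I"
  shows "\<bar>birkhoff_sum n \<psi> \<omega> - B (stake n \<omega>)\<bar> \<le> V"
proof -
  have "stake n \<omega> @- tail \<in> streams I" using stake_in_lists[OF assms] tail_in by (rule shift_streams)
  moreover have "stake n (stake n \<omega> @- tail) = stake n \<omega>" by (simp add: stake_shift)
  ultimately show ?thesis using variation[OF assms, of "stake n \<omega> @- tail" n] by (simp add: B_def)
qed

lemma B_append:
  assumes "u \<in> lists I" "v \<in> lists I"
  shows "\<bar>B (u @ v) - B u - B v\<bar> \<le> V"
proof -
  have "u @- v @- tail \<in> streams I" using assms tail_in by (intro shift_streams)
  from birkhoff_sum_approx[OF this, of "length u"]
  have "\<bar>birkhoff_sum (length u) \<psi> (u @- v @- tail) - B u\<bar> \<le> V" by (simp add: stake_shift)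
  moreover have "B (u @ v) = birkhoff_sum (length u) \<psi> (u @- v @- tail) + B v"
    unfolding B_def by (simp add: birkhoff_sum_add sdrop_shift)
  ultimately show ?thesis by simp
qed

sublocale word_potentials I lam B "2 * distortion + V" "- ln c"
proof
  fix u v assume uv: "u \<in> lists I" "v \<in> lists I"
  show "\<bar>lam (u @ v) - lam u - lam v\<bar> \<le> 2 * distortion + V"
    using lam_append_bounds[OF uv] distortion_nonneg V_nonneg by (simp add: abs_le_iff)
  show "\<bar>B (u @ v) - B u - B v\<bar> \<le> 2 * distortion + V"
    using B_append[OF uv] distortion_nonneg by simp
qed (use I_nonempty lam_le_length minus_ln_c_pos lam_Nil in \<open>auto simp: B_def birkhoff_sum_def\<close>)

text \<open>On the cylinder of \<open>w\<close> the Birkhoff sum of \<open>s \<zeta> + \<beta> \<psi>\<close> differs from \<open>s * lam w + \<beta> * B w\<close> by a bounded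
  amount, so the partition sums are comparable with \<open>z s \<beta> n\<close>.\<close>

lemma pressure_le_0_iff:
  "pressure I (\<lambda>\<omega>. s * geometric_potential X \<phi> \<omega> + \<beta> * \<psi> \<omega>) \<le> 0 \<longleftrightarrow> subcritical s \<beta>"
proof -
  let ?g = "\<lambda>\<omega>. s * geometric_potential X \<phi> \<omega> + \<beta> * \<psi> \<omega>"
  define K where "K = \<bar>s\<bar> * distortion + \<bar>\<beta>\<bar> * V"
  have approx: "\<bar>birkhoff_sum n ?g \<tau> - (s * lam w + \<beta> * B w)\<bar> \<le> K"
    if \<tau>: "\<tau> \<in> streams I" "stake n \<tau> = w" for \<tau> w n
  proof -
    have "birkhoff_sum n ?g \<tau> = s * birkhoff_sum n (geometric_potential X \<phi>) \<tau> + \<beta> * birkhoff_sum n \<psi> \<tau>"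
      by (simp add: birkhoff_sum_def sum.distrib sum_distrib_left)
    moreover have "\<bar>s * (birkhoff_sum n (geometric_potential X \<phi>) \<tau> - lam w)\<bar> \<le> \<bar>s\<bar> * distortion"
      "\<bar>\<beta> * (birkhoff_sum n \<psi> \<tau> - B w)\<bar> \<le> \<bar>\<beta>\<bar> * V"
      unfolding abs_mult using birkhoff_sum_geometric_potential_approx[OF \<tau>(1), of n] birkhoff_sum_approx[OF \<tau>(1), of n] \<tau>(2)
      by (intro mult_left_mono; simp)+
    ultimately show ?thesis by (simp add: K_def algebra_simps abs_le_iff)
  qed
  let ?S = "\<lambda>w n. SUP \<tau>\<in>cylinder w \<inter> streams I. ereal (birkhoff_sum n ?g \<tau>)"
  have bounds: "exp_ereal (?S w n) \<le> ennreal (exp K * wt s \<beta> w)" "ennreal (wt s \<beta> w) \<le> ennreal (exp K) * exp_ereal (?S w n)"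
    if w: "w \<in> words I n" for w n
  proof -
    have wI: "w \<in> lists I" "length w = n" using w by (auto simp: words_def)
    have "?S w n \<le> ereal (s * lam w + \<beta> * B w + K)"
      using approx wI by (intro SUP_least) (force simp: cylinder_def abs_le_iff)
    then have "exp_ereal (?S w n) \<le> ennreal (exp (s * lam w + \<beta> * B w + K))" by (rule exp_ereal_le)
    then show "exp_ereal (?S w n) \<le> ennreal (exp K * wt s \<beta> w)" by (simp add: wt_def exp_add mult.commute)
    have \<tau>: "w @- tail \<in> cylinder w \<inter> streams I"
      using shift_streams[OF wI(1) tail_in] by (simp add: cylinder_def stake_shift)
    have "ereal (s * lam w + \<beta> * B w - K) \<le> ereal (birkhoff_sum n ?g (w @- tail))"
      using approx[of "w @- tail" n w] \<tau> wI by (simp add: cylinder_def abs_le_iff)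
    also have "\<dots> \<le> ?S w n" using \<tau> by (rule SUP_upper)
    finally have "ennreal (exp (s * lam w + \<beta> * B w - K)) \<le> exp_ereal (?S w n)" by (rule exp_ereal_ge)
    then have "ennreal (exp K) * ennreal (exp (s * lam w + \<beta> * B w - K)) \<le> ennreal (exp K) * exp_ereal (?S w n)"
      by (rule mult_left_mono) simp
    then show "ennreal (wt s \<beta> w) \<le> ennreal (exp K) * exp_ereal (?S w n)"
      by (simp add: ennreal_mult'[symmetric] exp_add[symmetric] wt_def)
  qed
  have part: "partition_sum I ?g n = (\<integral>\<^sup>+w. exp_ereal (?S w n) \<partial>count_space (words I n))" for n
    unfolding partition_sum_def by (rule infsum_ennreal_eq_nn_integral)
  show ?thesis unfolding pressure_def
  proof (rule lim_log_average_le_0_iff)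
    fix n :: nat
    show "partition_sum I ?g n \<le> ennreal (exp K) * z s \<beta> n"
      unfolding part z_def
      by (subst nn_integral_cmult[symmetric], simp, rule nn_integral_mono)
         (use bounds in \<open>simp add: ennreal_mult'[symmetric]\<close>)
    show "z s \<beta> n \<le> ennreal (exp K) * partition_sum I ?g n"
      unfolding part z_def
      by (subst nn_integral_cmult[symmetric], simp, rule nn_integral_mono) (use bounds in simp)
  qed
qed

lemma free_energy_eq: "free_energy X I \<phi> \<psi> \<beta> = (INF s\<in>{s. subcritical s \<beta>}. ereal s)"
  unfolding free_energy_def pressure_le_0_iff ..

lemma level_set_eq: "level_set X I \<phi> \<psi> \<alpha> = coding_map X \<phi> `
    {\<omega> \<in> streams I. (\<lambda>k. birkhoff_sum k \<psi> \<omega> / lam (stake k \<omega>)) \<longlonglongrightarrow> \<alpha>}"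
  unfolding level_set_def lam_def word_norm_def ..

lemma lam_neg: "w \<in> lists I \<Longrightarrow> w \<noteq> [] \<Longrightarrow> lam w < 0"
proof -
  assume w: "w \<in> lists I" "w \<noteq> []"
  then have "ln c * real (length w) < 0" using c by (intro mult_neg_pos) auto
  then show ?thesis using lam_le_length[OF w(1)] by linarith
qed

section \<open>Upper bound for the Hausdorff dimension\<close>

lemma geometric_tail_sum_le:
  fixes q :: real
  assumes q: "0 < q" "q < 1" and K: "finite K" "\<And>k. k \<in> K \<Longrightarrow> k1 \<le> k"
  shows "(\<Sum>k\<in>K. q ^ k) \<le> q ^ k1 / (1 - q)"
proof -
  define M where "M = Max K"
  have M: "k \<le> M" if "k \<in> K" for k using K(1) that by (simp add: M_def)
  have "(\<Sum>k\<in>K. q ^ k) \<le> (\<Sum>k=k1..max k1 M. q ^ k)"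
    using q K(2) M by (intro sum_mono2) (auto simp: le_max_iff_disj)
  also have "\<dots> = (q ^ k1 - q ^ Suc (max k1 M)) / (1 - q)"
    using sum_gp_multiplied[of k1 "max k1 M" q] q by (subst eq_divide_eq) (simp add: mult.commute)
  also have "\<dots> \<le> q ^ k1 / (1 - q)" using q by (intro divide_right_mono) auto
  finally show ?thesis .
qed

text \<open>The surplus of \<open>s\<close> over \<open>s0 + \<alpha> * \<beta>\<close> is spent in two halves of size \<open>d\<close>: one makes the sums decay, the other
  absorbs the deviation of the ratios from \<open>\<alpha>\<close>.\<close>

theorem level_set_null:
  assumes sub: "subcritical s0 \<beta>" and s: "s > 0" "s > s0 + \<alpha> * \<beta>"
  shows "hausdorff_measure s (level_set X I \<phi> \<psi> \<alpha>) = 0"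
proof -
  define d where "d = (s - (s0 + \<alpha> * \<beta>)) / 2"
  have "2 * d = s - (s0 + \<alpha> * \<beta>)" by (simp add: d_def)
  then have d: "d > 0" "s = s0 + \<alpha> * \<beta> + 2 * d" using s by linarith+
  define q where "q = exp (- (d * (- ln c) / 2))"
  have q: "0 < q" "q < 1" using d minus_ln_c_pos by (auto simp: q_def mult_pos_neg)
  have "\<forall>\<^sub>F n in sequentially. z s0 \<beta> n \<le> ennreal (exp (d * (- ln c) / 2 * real n))"
    using sub d(1) minus_ln_c_pos unfolding subcritical_def by (metis half_gt_zero mult_pos_pos)
  then obtain N0 where N0: "\<And>n. n \<ge> N0 \<Longrightarrow> z s0 \<beta> n \<le> ennreal (exp (d * (- ln c) / 2 * real n))"
    by (auto simp: eventually_sequentially)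
  have z_small: "z (s0 + d) \<beta> n \<le> ennreal (q ^ n)" if "n \<ge> N0" for n
  proof -
    have "z (s0 + d) \<beta> n \<le> ennreal (exp (- ((s0 + d - s0) * (- ln c) * real n))) * z s0 \<beta> n"
      using d by (intro z_decay) simp
    also have "\<dots> \<le> ennreal (exp (- ((s0 + d - s0) * (- ln c) * real n))) * ennreal (exp (d * (- ln c) / 2 * real n))"
      by (intro mult_left_mono N0 that) simp
    also have "\<dots> = ennreal (q ^ n)"
      by (simp add: ennreal_mult'[symmetric] exp_add[symmetric] q_def exp_of_nat_mult[symmetric] algebra_simps)
    finally show ?thesis .
  qed
  \<comment> \<open>The constant \<open>\<bar>\<beta>\<bar> * V\<close> accounts for replacing the Birkhoff sum by \<open>B\<close>.\<close>
  define good where "good w \<longleftrightarrow> s * lam w \<le> (s0 + d) * lam w + \<beta> * B w + \<bar>\<beta>\<bar> * V" for w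
  obtain P :: "'a set set" where P: "finite P" "X \<subseteq> \<Union>P"
    "\<And>w A x y. w \<in> lists I \<Longrightarrow> A \<in> P \<Longrightarrow> x \<in> A \<Longrightarrow> y \<in> A \<Longrightarrow>
       dist (foldr \<phi> w x) (foldr \<phi> w y) \<le> 2 * R * word_norm w"
    using finite_pieces by blast
  obtain ps where ps: "set ps = P" using finite_list[OF P(1)] by blast
  define piece where "piece j = (case j of (w, i) \<Rightarrow> foldr \<phi> w ` (ps ! i))" for j :: "nat list \<times> nat"
  define J where "J k = {(w, i). w \<in> lists I \<and> good w \<and> k \<le> length w \<and> i < length ps}" for k
  define K where "K = (2 * R) powr s * exp (\<bar>\<beta>\<bar> * V)"
  have K: "K \<ge> 0" by (simp add: K_def)
  have piece: "bounded (piece (w, i)) \<and> diameter (piece (w, i)) \<le> 2 * R * word_norm w"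
    if w: "w \<in> lists I" and i: "i < length ps" for w i
  proof -
    have A: "ps ! i \<in> P" using i ps by auto
    have *: "dist p p' \<le> 2 * R * word_norm w" if "p \<in> piece (w, i)" "p' \<in> piece (w, i)" for p p'
      using that P(3)[OF w A] by (auto simp: piece_def)
    have "bounded (piece (w, i))" unfolding bounded_two_points using * by blast
    moreover have "diameter (piece (w, i)) \<le> 2 * R * word_norm w"
      using * R_nonneg word_norm_bounds(3)[OF w] by (intro diameter_le) (auto simp: dist_norm)
    ultimately show ?thesis ..
  qed
  have powr_le: "diam_powr s (piece (w, i)) \<le> K * wt (s0 + d) \<beta> w"
    if w: "w \<in> lists I" "good w" and i: "i < length ps" for w i
  proof -
    have "diam_powr s (piece (w, i)) \<le> diameter (piece (w, i)) powr s" using s by (simp add: diam_powr_def)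
    also have "\<dots> \<le> (2 * R * word_norm w) powr s"
      using piece[OF w(1) i] s diameter_ge_0 by (intro powr_mono2) auto
    also have "\<dots> = (2 * R) powr s * exp (s * lam w)"
      using R_nonneg word_norm_bounds(3)[OF w(1)] by (simp add: powr_mult) (simp add: lam_def powr_def)
    also have "\<dots> \<le> (2 * R) powr s * exp ((s0 + d) * lam w + \<beta> * B w + \<bar>\<beta>\<bar> * V)"
      using w(2) by (intro mult_left_mono) (auto simp: good_def)
    also have "\<dots> = K * wt (s0 + d) \<beta> w" by (simp add: K_def wt_def exp_add algebra_simps)
    finally show ?thesis .
  qed
  have sum_wt: "(\<Sum>w\<in>W. wt (s0 + d) \<beta> w) \<le> q ^ k1 / (1 - q)"
    if W: "finite W" "W \<subseteq> lists I" "\<And>w. w \<in> W \<Longrightarrow> k1 \<le> length w" and k1: "N0 \<le> k1" for W k1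
  proof -
    have "(\<Sum>w\<in>W. wt (s0 + d) \<beta> w) = (\<Sum>k\<in>length ` W. sum (wt (s0 + d) \<beta>) {w\<in>W. length w = k})"
      by (rule sum.image_gen[OF W(1)])
    also have "\<dots> \<le> (\<Sum>k\<in>length ` W. q ^ k)"
    proof (rule sum_mono)
      fix k assume "k \<in> length ` W"
      then have "N0 \<le> k" using W(3) k1 by (auto intro: order_trans)
      have "ennreal (sum (wt (s0 + d) \<beta>) {w\<in>W. length w = k}) \<le> z (s0 + d) \<beta> k"
        using W by (intro sum_le_z) (auto simp: words_def)
      also have "\<dots> \<le> ennreal (q ^ k)" using \<open>N0 \<le> k\<close> by (rule z_small)
      finally show "sum (wt (s0 + d) \<beta>) {w\<in>W. length w = k} \<le> q ^ k" using q by (simp add: ennreal_le_iff)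
    qed
    also have "\<dots> \<le> q ^ k1 / (1 - q)" using W by (intro geometric_tail_sum_le q) auto
    finally show ?thesis .
  qed
  have covers: "level_set X I \<phi> \<psi> \<alpha> \<subseteq> (\<Union>j\<in>J k1. piece j)" for k1
  proof
    fix x assume "x \<in> level_set X I \<phi> \<psi> \<alpha>"
    then obtain \<omega> where \<omega>: "\<omega> \<in> streams I" "x = coding_map X \<phi> \<omega>"
      and lim: "(\<lambda>k. birkhoff_sum k \<psi> \<omega> / lam (stake k \<omega>)) \<longlonglongrightarrow> \<alpha>" unfolding level_set_eq by blast
    define \<eta> where "\<eta> = d / (\<bar>\<beta>\<bar> + 1)"
    have \<eta>: "\<eta> > 0" "\<bar>\<beta>\<bar> * \<eta> \<le> d" using d by (auto simp: \<eta>_def field_simps)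
    have "\<forall>\<^sub>F k in sequentially. dist (birkhoff_sum k \<psi> \<omega> / lam (stake k \<omega>)) \<alpha> < \<eta>"
      using lim \<eta>(1) by (rule tendstoD)
    then obtain k0 where k0: "\<And>k. k \<ge> k0 \<Longrightarrow> dist (birkhoff_sum k \<psi> \<omega> / lam (stake k \<omega>)) \<alpha> < \<eta>"
      by (auto simp: eventually_sequentially)
    define k where "k = max (max k0 k1) 1"
    let ?w = "stake k \<omega>" and ?S = "birkhoff_sum k \<psi> \<omega>"
    have w: "?w \<in> lists I" "?w \<noteq> []" using stake_in_lists[OF \<omega>(1)] by (auto simp: k_def)
    have neg: "lam ?w < 0" using lam_neg[OF w] .
    have "\<bar>?S / lam ?w - \<alpha>\<bar> < \<eta>" using k0[of k] by (simp add: k_def dist_real_def)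
    moreover have "?S - \<alpha> * lam ?w = (?S / lam ?w - \<alpha>) * lam ?w" using neg by (simp add: field_simps)
    then have "\<bar>?S - \<alpha> * lam ?w\<bar> = \<bar>?S / lam ?w - \<alpha>\<bar> * (- lam ?w)" using neg by (simp add: abs_mult)
    ultimately have "\<bar>?S - \<alpha> * lam ?w\<bar> \<le> \<eta> * (- lam ?w)" using neg by (simp add: mult_right_mono)
    then have "\<bar>\<beta> * (?S - \<alpha> * lam ?w)\<bar> \<le> \<bar>\<beta>\<bar> * (\<eta> * (- lam ?w))" unfolding abs_mult by (rule mult_left_mono) simp
    also have "\<dots> = \<bar>\<beta>\<bar> * \<eta> * (- lam ?w)" by simp
    also have "\<dots> \<le> d * (- lam ?w)" using \<eta>(2) neg by (intro mult_right_mono) auto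
    finally have "\<alpha> * \<beta> * lam ?w + d * lam ?w \<le> \<beta> * ?S" by (simp add: algebra_simps abs_le_iff)
    moreover have "\<bar>\<beta> * (?S - B ?w)\<bar> \<le> \<bar>\<beta>\<bar> * V"
      unfolding abs_mult by (intro mult_left_mono birkhoff_sum_approx \<omega>) simp
    ultimately have "good ?w" unfolding good_def d(2) by (simp add: algebra_simps abs_le_iff)
    obtain y where y: "y \<in> X" "x = foldr \<phi> ?w y" using coding_map_in_cylinder[OF \<omega>(1), of k] \<omega>(2) by blast
    then obtain i where i: "i < length ps" "y \<in> ps ! i" using P(2) ps by (metis UnionE in_set_conv_nth subsetD)
    have "(?w, i) \<in> J k1" using w \<open>good ?w\<close> i by (simp add: J_def k_def)
    moreover have "x \<in> piece (?w, i)" using y i by (simp add: piece_def)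
    ultimately show "x \<in> (\<Union>j\<in>J k1. piece j)" by blast
  qed
  have small: "\<exists>k1. N0 \<le> k1 \<and> 2 * R * c ^ k1 \<le> \<delta> \<and> K * real (length ps) * (q ^ k1 / (1 - q)) \<le> \<epsilon>"
    if "0 < \<delta>" "0 < \<epsilon>" for \<delta> \<epsilon> :: real
  proof -
    have "(\<lambda>k. 2 * R * c ^ k) \<longlonglongrightarrow> 2 * R * 0" using c by (intro tendsto_intros LIMSEQ_realpow_zero) auto
    then have "\<forall>\<^sub>F k in sequentially. 2 * R * c ^ k < \<delta>" using that by (intro order_tendstoD(2)) auto
    moreover have "(\<lambda>k. K * real (length ps) * (q ^ k / (1 - q))) \<longlonglongrightarrow> K * real (length ps) * (0 / (1 - q))"
      using q by (intro tendsto_intros LIMSEQ_realpow_zero) auto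
    then have "\<forall>\<^sub>F k in sequentially. K * real (length ps) * (q ^ k / (1 - q)) < \<epsilon>" using that by (intro order_tendstoD(2)) auto
    moreover have "\<forall>\<^sub>F k in sequentially. N0 \<le> k" by (rule eventually_ge_at_top)
    ultimately have "\<forall>\<^sub>F k in sequentially. N0 \<le> k \<and> 2 * R * c ^ k \<le> \<delta> \<and> K * real (length ps) * (q ^ k / (1 - q)) \<le> \<epsilon>"
      by eventually_elim auto
    then show ?thesis by (rule eventually_happens'[OF sequentially_bot])
  qed
  define k1 where "k1 \<delta> \<epsilon> = (SOME k. N0 \<le> k \<and> 2 * R * c ^ k \<le> \<delta> \<and> K * real (length ps) * (q ^ k / (1 - q)) \<le> \<epsilon>)" for \<delta> \<epsilon>
  have k1: "N0 \<le> k1 \<delta> \<epsilon>" "2 * R * c ^ k1 \<delta> \<epsilon> \<le> \<delta>" "K * real (length ps) * (q ^ k1 \<delta> \<epsilon> / (1 - q)) \<le> \<epsilon>"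
    if "0 < \<delta>" "0 < \<epsilon>" for \<delta> \<epsilon>
    using someI_ex[OF small[OF that]] unfolding k1_def by blast+
  show ?thesis
  proof (rule hausdorff_measure_zeroI[where J="\<lambda>\<delta> \<epsilon>. J (k1 \<delta> \<epsilon>)" and V=piece], intro conjI ballI allI impI)
    fix \<delta> \<epsilon> :: real assume \<delta>: "0 < \<delta>" and \<epsilon>: "0 < \<epsilon>"
    show "level_set X I \<phi> \<psi> \<alpha> \<subseteq> (\<Union>j\<in>J (k1 \<delta> \<epsilon>). piece j)" by (rule covers)
    fix j assume "j \<in> J (k1 \<delta> \<epsilon>)"
    then obtain w i where j: "j = (w, i)" "w \<in> lists I" "k1 \<delta> \<epsilon> \<le> length w" "i < length ps" by (auto simp: J_def)
    show "bounded (piece j)" using piece j by blast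
    have "diameter (piece j) \<le> 2 * R * word_norm w" using piece j by blast
    also have "\<dots> \<le> 2 * R * c ^ length w"
      using R_nonneg word_norm_bounds(2)[OF j(2)] by (intro mult_left_mono) auto
    also have "\<dots> \<le> 2 * R * c ^ k1 \<delta> \<epsilon>" using R_nonneg c j(3) by (intro mult_left_mono power_decreasing) auto
    also have "\<dots> \<le> \<delta>" using k1[OF \<delta> \<epsilon>] by blast
    finally show "diameter (piece j) \<le> \<delta>" .
  next
    fix \<delta> \<epsilon> :: real and F assume \<delta>: "0 < \<delta>" and \<epsilon>: "0 < \<epsilon>" and F: "finite F" "F \<subseteq> J (k1 \<delta> \<epsilon>)"
    have FJ: "w \<in> lists I" "good w" "k1 \<delta> \<epsilon> \<le> length w" "i < length ps" if "(w, i) \<in> F" for w i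
      using F(2) that by (auto simp: J_def)
    have "(\<Sum>j\<in>F. diam_powr s (piece j)) \<le> (\<Sum>j\<in>F. K * wt (s0 + d) \<beta> (fst j))"
      by (rule sum_mono) (use FJ powr_le in force)
    also have "\<dots> \<le> (\<Sum>j\<in>fst ` F \<times> {..<length ps}. K * wt (s0 + d) \<beta> (fst j))"
    proof (rule sum_mono2)
      show "finite (fst ` F \<times> {..<length ps})" using F by simp
      show "F \<subseteq> fst ` F \<times> {..<length ps}" using FJ by force
      show "0 \<le> K * wt (s0 + d) \<beta> (fst j)" for j using K wt_pos by (simp add: less_imp_le)
    qed
    also have "\<dots> = (\<Sum>w\<in>fst ` F. \<Sum>i<length ps. K * wt (s0 + d) \<beta> w)"
      unfolding sum.cartesian_product by (rule sum.cong) auto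
    also have "\<dots> = K * real (length ps) * (\<Sum>w\<in>fst ` F. wt (s0 + d) \<beta> w)"
      by (simp add: sum_distrib_left algebra_simps)
    also have "\<dots> \<le> K * real (length ps) * (q ^ k1 \<delta> \<epsilon> / (1 - q))"
    proof (intro mult_left_mono sum_wt)
      show "fst ` F \<subseteq> lists I" using FJ(1) by force
      show "k1 \<delta> \<epsilon> \<le> length w" if "w \<in> fst ` F" for w using that FJ(3) by auto
    qed (use F k1[OF \<delta> \<epsilon>] K in auto)
    also have "\<dots> \<le> \<epsilon>" using k1[OF \<delta> \<epsilon>] by blast
    finally show "(\<Sum>j\<in>F. diam_powr s (piece j)) \<le> \<epsilon>" .
  qed
qed

section \<open>Lower bound for the Hausdorff dimension\<close>

text \<open>Given a cover with a small sum, a branch of a tree of words is found that codes an uncovered point of the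
  level set.\<close>

theorem level_set_not_null:
  assumes s: "s > 0" and super: "\<And>\<beta>. \<not> subcritical (s - \<alpha> * \<beta>) \<beta>"
    and up: "\<And>M. \<exists>u\<in>lists I. disc \<alpha> u > M" and down: "\<And>M. \<exists>u\<in>lists I. disc \<alpha> u < - M"
  shows "hausdorff_measure s (level_set X I \<phi> \<psi> \<alpha>) \<noteq> 0"
proof
  assume null: "hausdorff_measure s (level_set X I \<phi> \<psi> \<alpha>) = 0"
  let ?D = "disc \<alpha>" and ?err = "disc_err \<alpha>"
  obtain \<beta> p P q Q where
    P: "finite P" "P \<subseteq> words I p" "\<And>w. w \<in> P \<Longrightarrow> ?D w \<ge> ?err + 1" "exp (tilt_err \<alpha> s \<beta>) < sum (tilt \<alpha> s \<beta>) P" and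
    Q: "finite Q" "Q \<subseteq> words I q" "\<And>w. w \<in> Q \<Longrightarrow> ?D w \<le> - (?err + 1)" "exp (tilt_err \<alpha> s \<beta>) < sum (tilt \<alpha> s \<beta>) Q"
    using common_tilt[OF super up down, of "?err + 1"] by metis
  \<comment> \<open>Steer back: a node of nonnegative discrepancy is continued by the blocks of negative discrepancy.\<close>
  define ch where "ch v = (if ?D v \<ge> 0 then Q else P)" for v
  define len where "len v = (if ?D v \<ge> 0 then q else p)" for v
  define m where "m v = tilt \<alpha> s \<beta> v" for v
  have ch: "finite (ch v)" "ch v \<subseteq> P \<union> Q" "w \<in> ch v \<Longrightarrow> w \<in> lists I" "w \<in> ch v \<Longrightarrow> length w = len v"
    "w \<in> ch v \<Longrightarrow> w \<noteq> []" for v w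
    using P(1-3) Q(1-3) disc_Nil[of \<alpha>] disc_err_nonneg[of \<alpha>] unfolding ch_def len_def
    by (auto simp: words_def split: if_splits) force+
  have m_super: "m v \<le> (\<Sum>w\<in>ch v. m (v @ w))" if v: "v \<in> lists I" for v
  proof -
    have "m v * exp (tilt_err \<alpha> s \<beta>) \<le> m v * sum (tilt \<alpha> s \<beta>) (ch v)"
      using P(4) Q(4) tilt_pos[of \<alpha> s \<beta> v] by (intro mult_left_mono) (auto simp: ch_def m_def less_imp_le)
    also have "\<dots> = (\<Sum>w\<in>ch v. tilt \<alpha> s \<beta> v * tilt \<alpha> s \<beta> w)" by (simp add: sum_distrib_left m_def)
    also have "\<dots> \<le> (\<Sum>w\<in>ch v. exp (tilt_err \<alpha> s \<beta>) * m (v @ w))"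
      unfolding m_def by (intro sum_mono tilt_append v ch(3))
    also have "\<dots> = (\<Sum>w\<in>ch v. m (v @ w)) * exp (tilt_err \<alpha> s \<beta>)" by (simp add: sum_distrib_right mult.commute)
    finally show ?thesis by simp
  qed
  \<comment> \<open>\<open>H0\<close> also bounds the prefixes of blocks: the ratios must converge along all lengths, not only at
    the nodes of the tree.\<close>
  have finPQ: "finite (P \<union> Q)" using P Q by simp
  have PQI: "P \<union> Q \<subseteq> lists I" using P(2) Q(2) by (auto simp: words_def)
  define H0 where "H0 = (\<Sum>w\<in>P \<union> Q. \<Sum>i\<le>length w. \<bar>?D (take i w)\<bar>)"
  have H0: "\<bar>?D (take i w)\<bar> \<le> H0" if "w \<in> P \<union> Q" "i \<le> length w" for i w
  proof -
    have "\<bar>?D (take i w)\<bar> \<le> (\<Sum>i\<le>length w. \<bar>?D (take i w)\<bar>)" using that by (intro member_le_sum) auto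
    also have "\<dots> \<le> H0" unfolding H0_def using that finPQ by (intro member_le_sum) (auto intro: sum_nonneg)
    finally show ?thesis .
  qed
  have H0': "\<bar>?D w\<bar> \<le> H0" if "w \<in> P \<union> Q" for w using H0[OF that, of "length w"] by simp
  define H where "H = H0 + ?err"
  have "H0 \<ge> 0" unfolding H0_def by (intro sum_nonneg) auto
  then have H_nonneg: "H \<ge> 0" using disc_err_nonneg by (simp add: H_def)
  define \<eta> where "\<eta> = Min (insert 1 ((\<lambda>w. exp (lam w - 2 * distortion)) ` (P \<union> Q)))"
  have \<eta>: "\<eta> > 0" "\<eta> \<le> 1" "\<And>w. w \<in> P \<union> Q \<Longrightarrow> \<eta> \<le> exp (lam w - 2 * distortion)"
    using finPQ by (auto simp: \<eta>_def)
  \<comment> \<open>The discrepancy of a block is at least \<open>?err + 1\<close> in absolute value and opposes that of the node, so even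
    with the error of concatenation a step never leaves \<open>[-H, H]\<close>.\<close>
  let ?T = "block_tree ch"
  have T_bounded: "v \<in> lists I \<and> \<bar>?D v\<bar> \<le> H" if "v \<in> ?T" for v
    using that
  proof (induction rule: block_tree.induct)
    case root
    then show ?case using H_nonneg by (simp add: disc_Nil)
  next
    case (step v w)
    have vI: "v \<in> lists I" "\<bar>?D v\<bar> \<le> H" using step.IH by auto
    have wI: "w \<in> lists I" "w \<in> P \<union> Q" using ch(3)[OF step.hyps(2)] ch(2)[of v] step.hyps(2) by blast+
    have app: "\<bar>?D (v @ w) - ?D v - ?D w\<bar> \<le> ?err" by (rule disc_append[OF vI(1) wI(1)])
    have "\<bar>?D (v @ w)\<bar> \<le> H"
    proof (cases "?D v \<ge> 0")
      case True
      then have "?D w \<le> - (?err + 1)" using step.hyps Q(3) by (simp add: ch_def)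
      then show ?thesis using True app vI(2) H0'[OF wI(2)] unfolding H_def by linarith
    next
      case False
      then have "?D w \<ge> ?err + 1" using step.hyps P(3) by (simp add: ch_def)
      then show ?thesis using False app vI(2) H0'[OF wI(2)] unfolding H_def by linarith
    qed
    then show ?case using vI wI by simp
  qed
  have T_I: "v \<in> lists I" if "v \<in> ?T" for v using T_bounded[OF that] by blast
  have m_le: "m v \<le> exp (\<bar>\<beta>\<bar> * H) * word_norm v powr s" if v: "v \<in> ?T" for v
  proof -
    have "\<bar>\<beta> * ?D v\<bar> \<le> \<bar>\<beta>\<bar> * H" unfolding abs_mult using T_bounded[OF v] by (intro mult_left_mono) auto
    then have "\<beta> * ?D v \<le> \<bar>\<beta>\<bar> * H" by linarith
    then have "m v \<le> exp (s * lam v + \<bar>\<beta>\<bar> * H)" by (simp add: m_def tilt_def)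
    also have "\<dots> = exp (\<bar>\<beta>\<bar> * H) * word_norm v powr s"
      using word_norm_bounds(3)[OF T_I[OF v]] by (simp add: exp_add lam_def powr_def)
    finally show ?thesis .
  qed
  have norm_mono: "word_norm v \<le> word_norm u" if uv: "prefix u v" "v \<in> lists I" for u v
  proof -
    obtain w where w: "v = u @ w" using uv(1) by (auto simp: prefix_def)
    have uw: "u \<in> lists I" "w \<in> lists I" using uv(2) w by auto
    have "ln c * real (length w) \<le> 0" using minus_ln_c_pos by (intro mult_nonpos_nonneg) auto
    then have "lam w \<le> 0" using lam_le_length[OF uw(2)] by linarith
    then have "lam v \<le> lam u" using lam_append_bounds(1)[OF uw] unfolding w by linarith
    then have "exp (lam v) \<le> exp (lam u)" by simp
    then show ?thesis using exp_lam uw uv(2) by simp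
  qed
  \<comment> \<open>The nodes at which a branch first drops below the scale \<open>r\<close>, as far as their images meet \<open>U\<close>.\<close>
  define A where "A U r = {v \<in> ?T. word_norm v \<le> r \<and>
      (v = [] \<or> (\<exists>v'\<in>?T. \<exists>w\<in>ch v'. v = v' @ w \<and> r < word_norm v')) \<and> foldr \<phi> v ` X \<inter> U \<noteq> {}}"
    for U :: "'a set" and r :: real
  have anti: "\<not> prefix u v" if u: "u \<in> A U r" and v: "v \<in> A U r" and ne: "u \<noteq> v" for u v U r
  proof
    assume pre: "prefix u v"
    then have "v \<noteq> []" using ne by auto
    then obtain v' w where v': "v' \<in> ?T" "w \<in> ch v'" "v = v' @ w" "r < word_norm v'"
      using v by (auto simp: A_def)
    have "\<not> prefix u v'"
      using norm_mono[of u v'] u v'(4) T_I[OF v'(1)] by (auto simp: A_def)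
    moreover have "prefix v' v" using v' by simp
    ultimately have "strict_prefix v' u" using pre by (metis prefix_same_cases prefix_order.le_less)
    moreover have "u \<in> ?T" using u by (simp add: A_def)
    ultimately have "\<exists>w'\<in>ch v'. prefix (v' @ w') u"
      using block_tree_next[of ch len v' u] ch(4,5) v'(1) by blast
    then obtain w' where w': "w' \<in> ch v'" "prefix (v' @ w') u" by blast
    have "length v \<le> length u" using prefix_length_le[OF w'(2)] ch(4)[OF w'(1)] ch(4)[OF v'(2)] v'(3) by simp
    then show False using pre ne prefix_length_le[OF pre] by (auto simp: prefix_def)
  qed
  have lower: "\<eta> * r \<le> word_norm v" if v: "v \<in> A U r" and r: "0 < r" "r \<le> 1" for v U r
  proof (cases "v = []")
    case True
    have "\<eta> * r \<le> 1 * 1" using \<eta> r by (intro mult_mono) auto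
    then show ?thesis using exp_lam[of "[]"] True lam_Nil by simp
  next
    case False
    then obtain v' w where v': "v' \<in> ?T" "w \<in> ch v'" "v = v' @ w" "r < word_norm v'"
      using v by (auto simp: A_def)
    have I: "v' \<in> lists I" "w \<in> lists I" "w \<in> P \<union> Q" using T_I[OF v'(1)] ch(3)[OF v'(2)] ch(2)[of v'] v'(2) by blast+
    have "r * \<eta> \<le> exp (lam v') * exp (lam w - 2 * distortion)"
      using v'(4) exp_lam[OF I(1)] \<eta> I(3) r by (intro mult_mono) auto
    also have "\<dots> = exp (lam v' + lam w - 2 * distortion)" by (simp add: exp_add[symmetric] algebra_simps)
    also have "\<dots> \<le> exp (lam v)" using lam_append_bounds(2)[OF I(1,2)] v'(3) by simp
    finally show ?thesis using exp_lam[OF T_I, of v] v by (simp add: A_def mult.commute)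
  qed
  define N where "N = ((2 + R) / (\<rho> * exp (- distortion) * \<eta>)) ^ DIM('a)"
  have N: "N \<ge> 0" unfolding N_def using R_nonneg \<rho> \<eta> by (intro zero_le_power) auto
  have cardA: "finite (A U r)" "real (card (A U r)) \<le> N"
    if U: "bounded U" "diameter U \<le> r" and r: "0 < r" "r \<le> 1" for U r
  proof -
    have fin_card: "real (card G) \<le> N" if G: "G \<subseteq> A U r" "finite G" for G
      unfolding N_def
    proof (rule card_antichain_hitting_le[OF G(2) _ _ r(1) \<eta>(1) _ _ _ U])
      show "G \<subseteq> lists I" using G T_I by (auto simp: A_def)
      show "\<not> prefix u v" if "u \<in> G" "v \<in> G" "u \<noteq> v" for u v using anti[of u U r v] G that by blast
      fix w assume "w \<in> G"
      then have w: "w \<in> A U r" using G by blast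
      then show "word_norm w \<le> r" "foldr \<phi> w ` X \<inter> U \<noteq> {}" by (auto simp: A_def)
      show "\<eta> * r \<le> word_norm w" using lower[OF w r] .
    qed
    have "card G \<le> nat \<lfloor>N\<rfloor>" if "G \<subseteq> A U r" "finite G" for G
      using fin_card[OF that] by (simp add: le_nat_floor)
    then have "finite (A U r)" using finite_if_finite_subsets_card_bdd by blast
    then show "finite (A U r)" "real (card (A U r)) \<le> N" using fin_card by auto
  qed
  \<comment> \<open>\<open>e\<close> is half of what the mass estimate tolerates: the diameters of the covering sets are enlarged
    below to make them positive, which costs another \<open>e\<close> in the sum.\<close>
  define K where "K = N * exp (\<bar>\<beta>\<bar> * H)"
  have K: "K \<ge> 0" using N by (simp add: K_def)
  define e where "e = 1 / (4 * (K + 1))"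
  have e: "0 < e" "2 * e \<le> 1" "K * (2 * e) < 1" using K by (auto simp: e_def field_simps)
  obtain U :: "nat \<Rightarrow> 'a set" where U: "level_set X I \<phi> \<psi> \<alpha> \<subseteq> (\<Union>i. U i)" "\<And>i. bounded (U i)"
    "(\<Sum>i. ennreal (diam_powr s (U i))) < ennreal e"
    using hausdorff_measure_zeroD[OF null e(1)] by blast
  have dp_nonneg: "0 \<le> diam_powr s (U i)" for i by (simp add: diam_powr_def)
  define t where "t i = diam_powr s (U i) + e * (1 / 2) ^ Suc i" for i
  define r where "r i = t i powr (1 / s)" for i
  have t: "0 < t i" "t i \<le> 1" "diam_powr s (U i) \<le> t i" for i
  proof -
    have p: "0 < e * (1 / 2) ^ Suc i" using e by simp
    then show "0 < t i" "diam_powr s (U i) \<le> t i" using dp_nonneg[of i] unfolding t_def by linarith+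
    have "(\<Sum>i\<in>{i}. ennreal (diam_powr s (U i))) \<le> (\<Sum>i. ennreal (diam_powr s (U i)))"
      by (intro sum_le_suminf) auto
    then have "ennreal (diam_powr s (U i)) < ennreal e" using U(3) by (simp add: order_le_less_trans)
    then have "diam_powr s (U i) < e" using e by (simp add: ennreal_less_iff dp_nonneg)
    moreover have "e * (1 / 2) ^ Suc i \<le> e * 1" using e by (intro mult_left_mono power_le_one) auto
    ultimately show "t i \<le> 1" unfolding t_def using e(2) by linarith
  qed
  have r: "0 < r i" "r i \<le> 1" "r i powr s = t i" for i
    using t[of i] s by (auto simp: r_def powr_powr intro: powr_le1)
  have diam: "diameter (U i) \<le> r i" for i
  proof (cases "U i = {}")
    case True
    then show ?thesis using r(1)[of i] by simp
  next
    case False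
    have "diameter (U i) = (diameter (U i) powr s) powr (1 / s)"
      using s diameter_ge_0[OF U(2)] by (simp add: powr_powr)
    also have "\<dots> \<le> r i" unfolding r_def using t(3)[of i] False s by (intro powr_mono2) (auto simp: diam_powr_def)
    finally show ?thesis .
  qed
  note cA = cardA[OF U(2) diam r(1,2)]
  have mass: "sum m (A (U i) (r i)) \<le> K * t i" for i
  proof -
    have "sum m (A (U i) (r i)) \<le> (\<Sum>v\<in>A (U i) (r i). exp (\<bar>\<beta>\<bar> * H) * t i)"
    proof (rule sum_mono)
      fix v assume v: "v \<in> A (U i) (r i)"
      then have vT: "v \<in> ?T" "word_norm v \<le> r i" by (auto simp: A_def)
      have "word_norm v powr s \<le> r i powr s"
        using vT word_norm_bounds(3)[OF T_I[OF vT(1)]] s by (intro powr_mono2) auto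
      then have "exp (\<bar>\<beta>\<bar> * H) * word_norm v powr s \<le> exp (\<bar>\<beta>\<bar> * H) * t i" by (simp add: r(3))
      then show "m v \<le> exp (\<bar>\<beta>\<bar> * H) * t i" using m_le[OF vT(1)] by linarith
    qed
    also have "\<dots> = real (card (A (U i) (r i))) * (exp (\<bar>\<beta>\<bar> * H) * t i)" by simp
    also have "\<dots> \<le> N * (exp (\<bar>\<beta>\<bar> * H) * t i)" using cA t(1)[of i] by (intro mult_right_mono) auto
    finally show ?thesis by (simp add: K_def mult.assoc)
  qed
  have small: "(\<Sum>i. ennreal (sum m (A (U i) (r i)))) < ennreal (m [])"
  proof -
    have half: "(\<Sum>i. ennreal (e * (1 / 2) ^ Suc i)) = ennreal e"
    proof (rule suminf_ennreal_eq)
      show "(\<lambda>i. e * (1 / 2) ^ Suc i) sums e" using sums_mult[OF power_half_series, of e] by simp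
    qed (use e in simp)
    have "(\<Sum>i. ennreal (sum m (A (U i) (r i)))) \<le> (\<Sum>i. ennreal K * ennreal (t i))"
      using mass t K by (intro suminf_le) (auto simp: ennreal_mult'[symmetric] intro: ennreal_leI)
    also have "\<dots> = ennreal K * (\<Sum>i. ennreal (t i))" by (rule ennreal_suminf_cmult)
    also have "(\<Sum>i. ennreal (t i)) = (\<Sum>i. ennreal (diam_powr s (U i)) + ennreal (e * (1 / 2) ^ Suc i))"
      unfolding t_def using dp_nonneg e by (intro suminf_cong ennreal_plus) auto
    also have "\<dots> = (\<Sum>i. ennreal (diam_powr s (U i))) + ennreal e"
      unfolding half[symmetric] by (rule suminf_add[symmetric]) auto
    also have "ennreal K * \<dots> \<le> ennreal K * (ennreal e + ennreal e)"
      using U(3) by (intro mult_left_mono add_mono) auto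
    also have "\<dots> = ennreal (K * (2 * e))"
      using e K by (simp add: ennreal_mult'[symmetric] ennreal_plus[symmetric] del: ennreal_plus)
    also have "\<dots> < ennreal 1" using e(3) by (intro ennreal_lessI) auto
    also have "ennreal 1 = ennreal (m [])" by (simp add: m_def tilt_def lam_Nil disc_Nil)
    finally show ?thesis .
  qed
  have "\<exists>v. v 0 = [] \<and> (\<forall>j. \<exists>w\<in>ch (v j). v (Suc j) = v j @ w) \<and> (\<forall>j. v j \<in> ?T) \<and>
      (\<forall>i j. v j \<notin> A (U i) (r i))"
  proof (rule tree_path_avoiding[where len=len and m=m])
    show "(\<Sum>i. ennreal (sum m (A (U i) (r i)))) < ennreal (m [])" by (rule small)
    show "0 \<le> m v" for v unfolding m_def using tilt_pos by (rule less_imp_le)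
  qed (use block_tree.intros cA ch(1,4) m_super T_I in blast)+
  then obtain v where path: "v 0 = []" "\<forall>j. \<exists>w\<in>ch (v j). v (Suc j) = v j @ w" "\<forall>j. v j \<in> ?T"
    "\<forall>i j. v j \<notin> A (U i) (r i)" by (elim exE conjE)
  note v = path(1) spec[OF path(2)] spec[OF path(3)] spec[OF spec[OF path(4)]]
  have "strict_prefix (v j) (v (Suc j))" for j
  proof -
    obtain w where "w \<in> ch (v j)" "v (Suc j) = v j @ w" using v(2)[of j] by blast
    then show ?thesis using ch(5) by (auto simp: strict_prefix_def)
  qed
  then obtain \<omega> where \<omega>: "\<And>j. stake (length (v j)) \<omega> = v j" using ex_stream_through by metis
  have length_less: "length (v j) < length (v (Suc j))" for j
    using \<open>strict_prefix (v j) (v (Suc j))\<close> by (rule prefix_length_less)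
  then have len_ge: "j \<le> length (v j)" for j by (induction j) (auto simp: Suc_le_eq intro: le_less_trans)
  have \<omega>_in: "\<omega> \<in> streams I" unfolding streams_iff_snth
  proof
    fix n
    have "n < length (v (Suc n))" using len_ge[of "Suc n"] by simp
    then have "\<omega> !! n \<in> set (v (Suc n))" using \<omega>[of "Suc n"] by (metis length_stake nth_mem stake_nth)
    then show "\<omega> !! n \<in> I" using T_I[OF v(3)[of "Suc n"]] by auto
  qed
  have D_bounded: "\<bar>?D (stake k \<omega>)\<bar> \<le> H + H0 + ?err" for k
  proof -
    define j where "j = (LEAST j. k < length (v (Suc j)))"
    have "k < length (v (Suc k))" using len_ge[of "Suc k"] by simp
    then have j: "k < length (v (Suc j))" unfolding j_def by (rule LeastI)
    have "length (v j) \<le> k"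
    proof (cases j)
      case (Suc i)
      then have "\<not> k < length (v (Suc i))" using not_less_Least[of i] unfolding j_def by (metis lessI)
      then show ?thesis using Suc by simp
    qed (use v(1) in simp)
    obtain w where w: "w \<in> ch (v j)" "v (Suc j) = v j @ w" using v(2) by blast
    have "stake k \<omega> = take k (stake (length (v (Suc j))) \<omega>)" using j by (simp add: take_stake)
    also have "\<dots> = v j @ take (k - length (v j)) w"
      using \<open>length (v j) \<le> k\<close> by (simp add: trans[OF \<omega>[of "Suc j"] w(2)] del: w(2))
    finally have split: "stake k \<omega> = v j @ take (k - length (v j)) w" .
    have "take (k - length (v j)) w \<in> lists I" using ch(3)[OF w(1)] by (auto dest: in_set_takeD)
    from disc_append[OF T_I[OF v(3)[of j]] this, of \<alpha>]
    have "\<bar>?D (stake k \<omega>) - ?D (v j) - ?D (take (k - length (v j)) w)\<bar> \<le> ?err" by (simp add: split)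
    moreover have "\<bar>?D (v j)\<bar> \<le> H" using T_bounded[OF v(3)] by blast
    moreover have "\<bar>?D (take (k - length (v j)) w)\<bar> \<le> H0"
      using j w ch(2) by (intro H0) auto
    ultimately show ?thesis by linarith
  qed
  have "(\<lambda>k. birkhoff_sum k \<psi> \<omega> / lam (stake k \<omega>) - \<alpha>) \<longlonglongrightarrow> 0"
  proof (rule Lim_null_comparison)
    let ?M = "(V + H + H0 + ?err) / (- ln c)"
    show "\<forall>\<^sub>F k in sequentially. norm (birkhoff_sum k \<psi> \<omega> / lam (stake k \<omega>) - \<alpha>) \<le> ?M / real k"
    proof (rule eventually_sequentiallyI[of 1])
      fix k :: nat assume k: "1 \<le> k"
      let ?w = "stake k \<omega>"
      have w: "?w \<in> lists I" "?w \<noteq> []" using stake_in_lists[OF \<omega>_in] k by auto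
      have neg: "lam ?w < 0" using lam_neg[OF w] .
      have le: "(- ln c) * real k \<le> - lam ?w" using lam_le_length[OF w(1)] by simp
      have pos: "0 < (- ln c) * real k" using k minus_ln_c_pos by (intro mult_pos_pos) auto
      have "\<bar>birkhoff_sum k \<psi> \<omega> - \<alpha> * lam ?w\<bar> \<le> V + H + H0 + ?err"
        using D_bounded[of k] birkhoff_sum_approx[OF \<omega>_in, of k] unfolding disc_def by linarith
      moreover have "birkhoff_sum k \<psi> \<omega> / lam ?w - \<alpha> = (birkhoff_sum k \<psi> \<omega> - \<alpha> * lam ?w) / lam ?w"
        using neg by (simp add: field_simps)
      then have "norm (birkhoff_sum k \<psi> \<omega> / lam ?w - \<alpha>) = \<bar>birkhoff_sum k \<psi> \<omega> - \<alpha> * lam ?w\<bar> / (- lam ?w)"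
        using neg by simp
      ultimately have "norm (birkhoff_sum k \<psi> \<omega> / lam ?w - \<alpha>) \<le> (V + H + H0 + ?err) / ((- ln c) * real k)"
        using le pos by (simp only:) (rule frac_le, auto)
      then show "norm (birkhoff_sum k \<psi> \<omega> / lam ?w - \<alpha>) \<le> ?M / real k" by simp
    qed
    show "(\<lambda>k. ?M / real k) \<longlonglongrightarrow> 0" by (rule lim_const_over_n)
  qed
  then have "(\<lambda>k. birkhoff_sum k \<psi> \<omega> / lam (stake k \<omega>)) \<longlonglongrightarrow> \<alpha>" by (rule LIM_zero_cancel)
  then have "coding_map X \<phi> \<omega> \<in> level_set X I \<phi> \<psi> \<alpha>" unfolding level_set_eq using \<omega>_in by blast
  then obtain i where i: "coding_map X \<phi> \<omega> \<in> U i" using U(1) by blast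
  have hit: "foldr \<phi> (v j) ` X \<inter> U i \<noteq> {}" for j
    using coding_map_in_cylinder[OF \<omega>_in, of "length (v j)"] i by (auto simp: \<omega>)
  have small_node: "\<exists>j. word_norm (v j) \<le> r i"
  proof -
    have "(\<lambda>j. c ^ j) \<longlonglongrightarrow> 0" using c by (intro LIMSEQ_realpow_zero) auto
    then have "\<forall>\<^sub>F j in sequentially. c ^ j < r i" using r(1) by (intro order_tendstoD(2)) auto
    then obtain j where "c ^ j < r i" by (auto simp: eventually_sequentially)
    moreover have "word_norm (v j) \<le> c ^ length (v j)" by (rule word_norm_bounds(2)[OF T_I[OF v(3)]])
    moreover have "c ^ length (v j) \<le> c ^ j" using c len_ge by (intro power_decreasing) auto
    ultimately show ?thesis by (intro exI[of _ j]) linarith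
  qed
  define j where "j = (LEAST j. word_norm (v j) \<le> r i)"
  have j: "word_norm (v j) \<le> r i" unfolding j_def using small_node by (rule LeastI_ex)
  have j_least: "r i < word_norm (v j')" if "j' < j" for j'
    using not_less_Least[of j' "\<lambda>j. word_norm (v j) \<le> r i"] that by (simp add: j_def not_le)
  have "v j \<in> A (U i) (r i)"
  proof (cases j)
    case 0
    then show ?thesis using j v(1) v(3)[of j] hit[of j] by (simp add: A_def)
  next
    case (Suc j')
    then obtain w where w: "w \<in> ch (v j')" "v j = v j' @ w" using v(2)[of j'] by blast
    moreover have "r i < word_norm (v j')" using j_least Suc by simp
    ultimately show ?thesis using j v(3)[of j'] v(3)[of j] hit[of j] unfolding A_def by blast
  qed
  then show False using v(4) by blast
qed

end

section \<open>The free energy and its Legendre transform\<close>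

text \<open>Difference quotients of a convex function are monotone, and those to the right of \<open>x\<close> are bounded below by
  any difference quotient to the left.\<close>

lemma convex_on_right_derivative:
  fixes f :: "real \<Rightarrow> real"
  assumes f: "convex_on A f" and x: "x \<in> interior A"
  shows "\<exists>D. (f has_real_derivative D) (at_right x)"
proof -
  obtain d where d: "d > 0" "cball x d \<subseteq> A" using x mem_interior_cball by blast
  then have A: "y \<in> A" if "\<bar>y - x\<bar> \<le> d" for y using that by (auto simp: dist_real_def abs_minus_commute)
  define q where "q y = (f y - f x) / (y - x)" for y
  have swap: "(f u - f v) / (u - v) = (f v - f u) / (v - u)" for u v
    using minus_divide_divide[of "f v - f u" "v - u"] by simp
  have mono: "q y \<le> q z" if "x < y" "y < z" "z \<le> x + d" for y z
  proof -
    have "(f x - f y) / (x - y) \<le> (f x - f z) / (x - z)"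
      using that d by (intro convex_on_slope_le(1)[OF f]) (auto intro!: A)
    then show ?thesis unfolding q_def swap[of x] .
  qed
  define l where "l = q (x - d)"
  have low: "l \<le> q y" if "x < y" "y \<le> x + d" for y
  proof -
    have "(f (x - d) - f y) / (x - d - y) \<le> (f x - f y) / (x - y)" "(f (x - d) - f x) / (x - d - x) \<le> (f (x - d) - f y) / (x - d - y)"
      using that d by (intro convex_on_slope_le[OF f]; auto intro!: A)+
    then show ?thesis unfolding q_def l_def swap[of x y] by (rule order_trans[rotated])
  qed
  define D where "D = Inf (q ` {x<..x + d})"
  have bdd: "bdd_below (q ` {x<..x + d})" using low by (auto intro!: bdd_belowI2)
  have "(q \<longlongrightarrow> D) (at_right x)"
  proof (rule order_tendstoI)
    fix b assume b: "b < D"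
    have "b < q y" if "x < y" "y < x + d" for y
      using cINF_lower[OF bdd, of y] that b by (simp add: D_def)
    then show "\<forall>\<^sub>F y in at_right x. b < q y" using d by (auto simp: eventually_at_right_field intro!: exI[of _ "x + d"])
  next
    fix b assume "D < b"
    then obtain y where y: "x < y" "y \<le> x + d" "q y < b"
      using cInf_lessD[of "q ` {x<..x + d}" b] d by (auto simp: D_def)
    have "q z < b" if "x < z" "z < y" for z using mono[of z y] that y by simp
    then show "\<forall>\<^sub>F z in at_right x. q z < b" using y by (auto simp: eventually_at_right_field intro!: exI[of _ y])
  qed
  then show ?thesis unfolding has_field_derivative_iff q_def by blast
qed

lemma convex_on_left_derivative:
  fixes f :: "real \<Rightarrow> real"
  assumes f: "convex_on A f" and x: "x \<in> interior A"
  shows "\<exists>D. (f has_real_derivative D) (at_left x)"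
proof -
  have "convex_on (uminus ` A) (\<lambda>y. f (- y))"
  proof (rule convex_onI)
    show "convex (uminus ` A)" using f by (simp add: convex_on_imp_convex convex_negations)
    fix u y z :: real assume "0 < u" "u < 1" "y \<in> uminus ` A" "z \<in> uminus ` A"
    then show "f (- ((1 - u) *\<^sub>R y + u *\<^sub>R z)) \<le> (1 - u) * f (- y) + u * f (- z)"
      using convex_onD[OF f, of u "- y" "- z"] by auto
  qed
  moreover have "- x \<in> interior (uminus ` A)" using x by (simp add: interior_negations)
  ultimately obtain D where "((\<lambda>y. f (- y)) has_real_derivative D) (at_right (- x))"
    using convex_on_right_derivative by blast
  then have "((\<lambda>y. - ((f (- y) - f x) / (y + x))) \<longlongrightarrow> - D) (at_right (- x))"
    unfolding has_field_derivative_iff by (intro tendsto_minus) simp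
  moreover have "- ((f (- y) - f x) / (y + x)) = (f (- y) - f x) / (- y - x)" for y
    by (simp flip: divide_minus_right)
  ultimately have "((\<lambda>y. (f y - f x) / (y - x)) \<longlongrightarrow> - D) (at_left x)"
    unfolding at_left_minus[of x] filterlim_filtermap by simp
  then show ?thesis unfolding has_field_derivative_iff by blast
qed

text \<open>Existence of the one-sided derivative turns the definite description into an actual limit.\<close>

lemma left_deriv_tendsto:
  assumes "convex_on A (\<lambda>y. real_of_ereal (t y))" "x \<in> interior A"
  shows "((\<lambda>y. (real_of_ereal (t y) - real_of_ereal (t x)) / (y - x)) \<longlongrightarrow> left_deriv t x) (at_left x)"
proof -
  obtain D where D: "((\<lambda>y. real_of_ereal (t y)) has_real_derivative D) (at_left x)"
    using convex_on_left_derivative[OF assms] by blast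
  have "left_deriv t x = D" unfolding left_deriv_def
  proof (rule the_equality)
    show "((\<lambda>y. real_of_ereal (t y)) has_real_derivative D) (at_left x)" by (rule D)
    fix D' assume "((\<lambda>y. real_of_ereal (t y)) has_real_derivative D') (at_left x)"
    then show "D' = D" using D unfolding has_field_derivative_iff by (rule tendsto_unique[OF trivial_limit_at_left_real])
  qed
  then show ?thesis using D unfolding has_field_derivative_iff by simp
qed

lemma right_deriv_tendsto:
  assumes "convex_on A (\<lambda>y. real_of_ereal (t y))" "x \<in> interior A"
  shows "((\<lambda>y. (real_of_ereal (t y) - real_of_ereal (t x)) / (y - x)) \<longlongrightarrow> right_deriv t x) (at_right x)"
proof -
  obtain D where D: "((\<lambda>y. real_of_ereal (t y)) has_real_derivative D) (at_right x)"
    using convex_on_right_derivative[OF assms] by blast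
  have "right_deriv t x = D" unfolding right_deriv_def
  proof (rule the_equality)
    show "((\<lambda>y. real_of_ereal (t y)) has_real_derivative D) (at_right x)" by (rule D)
    fix D' assume "((\<lambda>y. real_of_ereal (t y)) has_real_derivative D') (at_right x)"
    then show "D' = D" using D unfolding has_field_derivative_iff by (rule tendsto_unique[OF trivial_limit_at_right_real])
  qed
  then show ?thesis using D unfolding has_field_derivative_iff by simp
qed

context multifractal
begin

abbreviation t :: "real \<Rightarrow> ereal" where
  "t \<equiv> free_energy X I \<phi> \<psi>"

lemma free_energy_le: "subcritical s \<beta> \<Longrightarrow> t \<beta> \<le> ereal s"
  unfolding free_energy_eq by (rule INF_lower) simp

lemma subcritical_above_free_energy: "t \<beta> < ereal s \<Longrightarrow> subcritical s \<beta>"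
  unfolding free_energy_eq INF_less_iff by (auto intro: subcritical_mono)

lemma free_energy_not_minus_infinity: "t \<beta> \<noteq> -\<infinity>"
proof -
  obtain s0 where "\<And>s. subcritical s \<beta> \<Longrightarrow> s0 \<le> s" using subcritical_bounded_below by blast
  then have "ereal s0 \<le> t \<beta>" unfolding free_energy_eq by (intro INF_greatest) simp
  then show ?thesis by auto
qed

lemma free_energy_real: "x \<in> dom_finite t \<Longrightarrow> t x = ereal (real_of_ereal (t x))"
  using free_energy_not_minus_infinity[of x] by (cases "t x") (auto simp: dom_finite_def)

lemma free_energy_convex: "convex_on (dom_finite t) (\<lambda>x. real_of_ereal (t x))"
proof -
  let ?f = "\<lambda>x. real_of_ereal (t x)"
  have mix: "t ((1 - u) * x + u * y) \<le> ereal ((1 - u) * ?f x + u * ?f y)"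
    if xy: "x \<in> dom_finite t" "y \<in> dom_finite t" and u: "0 \<le> u" "u \<le> 1" for u x y
  proof (rule ereal_le_epsilon2)
    fix e :: real assume e: "0 < e"
    have "t x < ereal (?f x + e)" "t y < ereal (?f y + e)"
      using e xy[THEN free_energy_real] by (metis ereal_less(2) less_add_same_cancel1 less_ereal.simps(1))+
    then have "subcritical ((1 - u) * (?f x + e) + u * (?f y + e)) ((1 - u) * x + u * y)"
      using u by (intro subcritical_convex subcritical_above_free_energy)
    then have "t ((1 - u) * x + u * y) \<le> ereal ((1 - u) * (?f x + e) + u * (?f y + e))" by (rule free_energy_le)
    then show "t ((1 - u) * x + u * y) \<le> ereal ((1 - u) * ?f x + u * ?f y) + ereal e" by (simp add: algebra_simps)
  qed
  have dom: "(1 - u) * x + u * y \<in> dom_finite t"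
    if "x \<in> dom_finite t" "y \<in> dom_finite t" "0 \<le> u" "u \<le> 1" for u x y
    unfolding dom_finite_def mem_Collect_eq by (rule le_less_trans[OF mix[OF that]]) simp
  show ?thesis
  proof (rule convex_onI)
    show "convex (dom_finite t)" unfolding convex_alt using dom by simp
    fix u x y :: real assume u: "0 < u" "u < 1" and xy: "x \<in> dom_finite t" "y \<in> dom_finite t"
    show "?f ((1 - u) *\<^sub>R x + u *\<^sub>R y) \<le> (1 - u) * ?f x + u * ?f y"
      using mix[OF xy, of u] free_energy_real[OF dom[OF xy, of u]] u
      by (metis ereal_less_eq(3) less_imp_le real_scaleR_def)
  qed
qed

text \<open>Optimise \<open>level_set_null\<close> over all \<open>s0\<close> and \<open>\<beta>\<close>.\<close>

theorem spectrum_upper_bound: "spectrum X I \<phi> \<psi> \<alpha> \<le> max (- legendre_conjugate t (- \<alpha>)) 0"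
proof (cases "spectrum X I \<phi> \<psi> \<alpha> \<le> 0")
  case True
  then show ?thesis by (simp add: max.coboundedI2)
next
  case False
  let ?f = "spectrum X I \<phi> \<psi> \<alpha>"
  have le: "?f \<le> ereal (s0 + \<alpha> * \<beta>)" if sub: "subcritical s0 \<beta>" for s0 \<beta>
  proof -
    have "?f \<le> ereal (max (s0 + \<alpha> * \<beta>) 0) + ereal e" if e: "0 < e" for e
    proof -
      have "hausdorff_measure (max (s0 + \<alpha> * \<beta>) 0 + e) (level_set X I \<phi> \<psi> \<alpha>) = 0"
        using e by (intro level_set_null[OF sub]) auto
      then have "?f \<le> ereal (max (s0 + \<alpha> * \<beta>) 0 + e)"
        unfolding spectrum_def using e by (intro hausdorff_dim_le) auto
      then show ?thesis unfolding plus_ereal.simps .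
    qed
    then have "?f \<le> ereal (max (s0 + \<alpha> * \<beta>) 0)" by (rule ereal_le_epsilon2)
    moreover have "max (s0 + \<alpha> * \<beta>) 0 \<noteq> 0 \<Longrightarrow> max (s0 + \<alpha> * \<beta>) 0 = s0 + \<alpha> * \<beta>" by linarith
    moreover have "max (s0 + \<alpha> * \<beta>) 0 \<noteq> 0" using calculation(1) False by (metis zero_ereal_def)
    ultimately show ?thesis by simp
  qed
  have "ereal (\<beta> * - \<alpha>) - t \<beta> \<le> - ?f" for \<beta>
  proof -
    have "?f - ereal (\<alpha> * \<beta>) \<le> ereal s" if "subcritical s \<beta>" for s
      using le[OF that] by (cases ?f) (auto simp: algebra_simps)
    then have "?f - ereal (\<alpha> * \<beta>) \<le> t \<beta>" unfolding free_energy_eq by (intro INF_greatest) simp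
    then show ?thesis using False by (cases ?f; cases "t \<beta>") (auto simp: algebra_simps)
  qed
  then have "legendre_conjugate t (- \<alpha>) \<le> - ?f" unfolding legendre_conjugate_def by (intro SUP_least)
  then have "?f \<le> - legendre_conjugate t (- \<alpha>)" by (subst ereal_minus_le_minus[symmetric]) simp
  then show ?thesis by (rule max.coboundedI1)
qed

text \<open>If \<open>s\<close> is strictly between the two values, then the pair \<open>(s - \<alpha> * y, y)\<close> is subcritical while
  \<open>(s - \<alpha> * x, x)\<close> is not.\<close>

lemma ex_word_if_not_minimal:
  assumes xy: "x \<in> dom_finite t" "y \<in> dom_finite t"
    and less: "real_of_ereal (t y) + \<alpha> * y < real_of_ereal (t x) + \<alpha> * x"
  shows "\<exists>w\<in>lists I. (x - y) * disc \<alpha> w > M"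
proof -
  obtain s where s: "real_of_ereal (t y) + \<alpha> * y < s" "s < real_of_ereal (t x) + \<alpha> * x" using dense[OF less] by blast
  have "t y < ereal (s - \<alpha> * y)" using s(1) by (subst free_energy_real[OF xy(2)]) simp
  then have sub: "subcritical (s - \<alpha> * y) y" by (rule subcritical_above_free_energy)
  have "\<not> subcritical (s - \<alpha> * x) x"
  proof
    assume "subcritical (s - \<alpha> * x) x"
    then have "t x \<le> ereal (s - \<alpha> * x)" by (rule free_energy_le)
    then have "real_of_ereal (t x) \<le> s - \<alpha> * x" by (subst (asm) free_energy_real[OF xy(1)]) simp
    then show False using s(2) by simp
  qed
  then show ?thesis by (rule ex_word_large_discrepancy[OF sub])
qed

text \<open>The left derivative of \<open>t \<beta> + \<alpha> * \<beta>\<close> is positive at some point \<open>x\<close> inside the domain, so the value at a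
  point \<open>y\<close> slightly to the left is smaller.\<close>

lemma words_above:
  assumes "alpha_minus t < ereal \<alpha>"
  shows "\<exists>w\<in>lists I. disc \<alpha> w > M"
proof -
  obtain x where x: "x \<in> interior (dom_finite t)" "- left_deriv t x < \<alpha>"
    using assms unfolding alpha_minus_def INF_less_iff by auto
  have "\<forall>\<^sub>F y in at_left x. - \<alpha> < (real_of_ereal (t y) - real_of_ereal (t x)) / (y - x)"
    using left_deriv_tendsto[OF free_energy_convex x(1)] by (rule order_tendstoD(1)) (use x in simp)
  moreover have "\<forall>\<^sub>F y in at_left x. y \<in> interior (dom_finite t)"
    using x(1) by (intro eventually_at_in_open' [THEN filter_leD[OF at_le, rotated]]) auto
  moreover have "\<forall>\<^sub>F y in at_left x. y < x" by (simp add: eventually_at_filter)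
  ultimately have "\<forall>\<^sub>F y in at_left x. - \<alpha> < (real_of_ereal (t y) - real_of_ereal (t x)) / (y - x) \<and>
      y \<in> interior (dom_finite t) \<and> y < x" by eventually_elim auto
  then obtain y where y: "- \<alpha> < (real_of_ereal (t y) - real_of_ereal (t x)) / (y - x)"
      "y \<in> interior (dom_finite t)" "y < x"
    using eventually_happens'[OF trivial_limit_at_left_real] by blast
  have "real_of_ereal (t y) - real_of_ereal (t x) < - \<alpha> * (y - x)" using y(1,3) by (simp add: neg_less_divide_eq)
  then have "real_of_ereal (t y) + \<alpha> * y < real_of_ereal (t x) + \<alpha> * x" by (simp add: algebra_simps)
  moreover have "x \<in> dom_finite t" "y \<in> dom_finite t" using x(1) y(2) interior_subset by blast+
  ultimately obtain w where "w \<in> lists I" "(x - y) * disc \<alpha> w > (x - y) * M" using ex_word_if_not_minimal by blast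
  then show ?thesis using y(3) by (intro bexI[of _ w]) auto
qed

lemma words_below:
  assumes "ereal \<alpha> < alpha_plus t"
  shows "\<exists>w\<in>lists I. disc \<alpha> w < - M"
proof -
  obtain x where x: "x \<in> interior (dom_finite t)" "\<alpha> < - right_deriv t x"
    using assms unfolding alpha_plus_def less_SUP_iff by auto
  have "\<forall>\<^sub>F y in at_right x. (real_of_ereal (t y) - real_of_ereal (t x)) / (y - x) < - \<alpha>"
    using right_deriv_tendsto[OF free_energy_convex x(1)] by (rule order_tendstoD(2)) (use x in simp)
  moreover have "\<forall>\<^sub>F y in at_right x. y \<in> interior (dom_finite t)"
    using x(1) by (intro eventually_at_in_open' [THEN filter_leD[OF at_le, rotated]]) auto
  moreover have "\<forall>\<^sub>F y in at_right x. x < y" by (simp add: eventually_at_filter)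
  ultimately have "\<forall>\<^sub>F y in at_right x. (real_of_ereal (t y) - real_of_ereal (t x)) / (y - x) < - \<alpha> \<and>
      y \<in> interior (dom_finite t) \<and> x < y" by eventually_elim auto
  then obtain y where y: "(real_of_ereal (t y) - real_of_ereal (t x)) / (y - x) < - \<alpha>"
      "y \<in> interior (dom_finite t)" "x < y"
    using eventually_happens'[OF trivial_limit_at_right_real] by blast
  have "real_of_ereal (t y) - real_of_ereal (t x) < - \<alpha> * (y - x)" using y(1,3) by (simp add: pos_divide_less_eq)
  then have "real_of_ereal (t y) + \<alpha> * y < real_of_ereal (t x) + \<alpha> * x" by (simp add: algebra_simps)
  moreover have "x \<in> dom_finite t" "y \<in> dom_finite t" using x(1) y(2) interior_subset by blast+
  ultimately obtain w where w: "w \<in> lists I" "(x - y) * disc \<alpha> w > (x - y) * (- M)" using ex_word_if_not_minimal by blast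
  have "disc \<alpha> w < - M" using iffD1[OF mult_less_cancel_left_neg w(2)] y(3) by simp
  then show ?thesis using w(1) by blast
qed

text \<open>For exponents below the infimum of \<open>t \<beta> + \<alpha> * \<beta>\<close> no parameter is subcritical, so \<open>level_set_not_null\<close>
  applies.  It needs a positive exponent; measure zero in dimension \<open>0\<close> is excluded because it
  would mean that the level set is empty.\<close>

theorem spectrum_eq:
  assumes \<alpha>: "alpha_minus t < ereal \<alpha>" "ereal \<alpha> < alpha_plus t"
  shows "spectrum X I \<phi> \<psi> \<alpha> = - legendre_conjugate t (- \<alpha>)"
proof (rule antisym)
  let ?h = "- legendre_conjugate t (- \<alpha>)"
  let ?E = "level_set X I \<phi> \<psi> \<alpha>"
  have h_le: "?h \<le> ereal s" if sub: "subcritical (s - \<alpha> * \<beta>) \<beta>" for s \<beta>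
  proof -
    have "ereal (\<beta> * - \<alpha>) - t \<beta> \<le> legendre_conjugate t (- \<alpha>)"
      unfolding legendre_conjugate_def by (rule SUP_upper) simp
    moreover have "ereal (- s) \<le> ereal (\<beta> * - \<alpha>) - t \<beta>"
      using free_energy_le[OF sub] free_energy_not_minus_infinity[of \<beta>] by (cases "t \<beta>") (auto simp: algebra_simps)
    ultimately have "- ereal s \<le> legendre_conjugate t (- \<alpha>)" by (metis order_trans uminus_ereal.simps(1))
    then show ?thesis by (simp only: ereal_uminus_le_reorder)
  qed
  have "ereal (\<beta> * - \<alpha>) - t \<beta> \<le> 0" for \<beta>
  proof -
    have "ereal (- (\<alpha> * \<beta>)) \<le> ereal s0" if "subcritical s0 \<beta>" for s0
      using subcritical_nonneg[OF words_above[OF \<alpha>(1)] words_below[OF \<alpha>(2)], of "s0 + \<alpha> * \<beta>" \<beta>] that by simp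
    then have "ereal (- (\<alpha> * \<beta>)) \<le> t \<beta>" unfolding free_energy_eq by (intro INF_greatest) simp
    then show ?thesis by (cases "t \<beta>") (auto simp: algebra_simps)
  qed
  then have "legendre_conjugate t (- \<alpha>) \<le> 0" unfolding legendre_conjugate_def by (intro SUP_least)
  then have h_nonneg: "0 \<le> ?h" by simp
  show "spectrum X I \<phi> \<psi> \<alpha> \<le> ?h" using spectrum_upper_bound[of \<alpha>] h_nonneg by (simp add: max_absorb1)
  have pos: "hausdorff_measure s ?E \<noteq> 0" if s: "0 < s" "ereal s < ?h" for s
  proof (rule level_set_not_null[OF s(1)])
    show "\<not> subcritical (s - \<alpha> * \<beta>) \<beta>" for \<beta> using h_le[of s \<beta>] s(2) by (meson leD)
  qed (use words_above[OF \<alpha>(1)] words_below[OF \<alpha>(2)] in auto)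
  show "?h \<le> spectrum X I \<phi> \<psi> \<alpha>"
    unfolding spectrum_def hausdorff_dim_def
  proof (rule INF_greatest)
    fix s :: real assume "s \<in> {s. 0 \<le> s \<and> hausdorff_measure s ?E = 0}"
    then have s: "0 \<le> s" "hausdorff_measure s ?E = 0" by auto
    show "?h \<le> ereal s"
    proof (rule ccontr)
      assume "\<not> ?h \<le> ereal s"
      then have less: "ereal s < ?h" by simp
      then have "s = 0" using pos[of s] s by force
      then have "?E = {}" using hausdorff_measure_0_eq_0D s(2) by blast
      moreover obtain s' where "ereal s < ereal s'" "ereal s' < ?h" using ereal_dense2[OF less] by blast
      ultimately show False using pos[of s'] \<open>s = 0\<close> hausdorff_measure_empty by auto
    qed
  qed
qed

end

theorem theorem1p2:
  fixes X :: "(real ^ 'n) set" and I :: "nat set"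
    and \<phi> :: "nat \<Rightarrow> real ^ 'n \<Rightarrow> real ^ 'n" and \<psi> :: "nat stream \<Rightarrow> real"
    and t :: "real \<Rightarrow> ereal"
  assumes "compact X" and "connected X" and "X \<noteq> {}" and "X = closure (interior X)"
    and "CIFS X I \<phi>"
    and "holder_continuous_on_shift I \<psi>"
    and "t = free_energy X I \<phi> \<psi>"
  shows "(\<forall>\<alpha>::real. spectrum X I \<phi> \<psi> \<alpha> \<le> max (- legendre_conjugate t (- \<alpha>)) 0) \<and>
         (\<forall>\<alpha>::real. alpha_minus t < ereal \<alpha> \<and> ereal \<alpha> < alpha_plus t \<longrightarrow>
            spectrum X I \<phi> \<psi> \<alpha> = - legendre_conjugate t (- \<alpha>))"
proof -
  obtain c \<rho> R L a where "conformal_system X I \<phi> c \<rho> R L a"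
    using CIFS_imp_conformal_system[OF assms(1,3,5)] by blast
  then interpret conformal_system X I \<phi> c \<rho> R L a .
  obtain V where V: "\<forall>n. \<forall>\<omega>\<in>streams I. \<forall>\<tau>\<in>streams I. stake n \<omega> = stake n \<tau> \<longrightarrow>
      \<bar>birkhoff_sum n \<psi> \<omega> - birkhoff_sum n \<psi> \<tau>\<bar> \<le> V"
    using holder_birkhoff_variation[OF assms(6)] by blast
  interpret multifractal X I \<phi> c \<rho> R L a \<psi> V
    by unfold_locales (use V in blast)
  show ?thesis unfolding assms(7) using spectrum_upper_bound spectrum_eq by blast
qed

end
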